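(* Let $(X,\omega)$ be a connected integral symplectic manifold with quantum line bundle with connection $(L,\nabla)$ of curvature $\omega$, and let $(\widetilde X,\omega_{\widetilde X})$ be the induced symplectic manifold. The map $$C^{\infty}(X)\to C^{\infty}(\widetilde X),\qquad \varphi\mapsto r\,\widetilde\varphi$$ is a monomorphism of Poisson Lie algebras (an injective linear map carrying Poisson brackets to Poisson brackets). Moreover, for any $s\in S$ and $\varphi\in C^{\infty}(X)$ one has $$\widetilde{\pi(\varphi)(s)}=[r\,\widetilde\varphi,\widetilde s],$$ where the bracket on the right is Poisson bracket in $C^\infty(\widetilde X)$.
   Context: $C^\infty(M)$ denotes the smooth complex-valued functions on $M$. For a symplectic manifold $(M,\Omega)$ and $f\in C^\infty(M)$ the (complex) Hamiltonian vector field $\xi_f$ is defined by $\Omega(\xi_f,\eta)=\eta f$ for all vector fields $\eta$, and the Poisson bracket is $[f,g]=\xi_f\,g$. $(X,\omega)$ is a connected symplectic manifold that is integral: $[\omega]\in H^2(X,\mathbb R)$ lies in the image of $H^2(X,\mathbb Z)\to H^2(X,\mathbb R)$. $L$ is a complex line bundle over $X$ with connection $\nabla$ of curvature $\omega$ and with a Hilbert space structure on each fibre invariant under parallel transport; $\tau:L^1\to X$ is the principal $U(1)$-bundle of unit circles in the fibres of $L$. There is a real $U(1)$-invariant $1$-form $\alpha$ on $L^1$ which on each fibre corresponds to $d\theta/2\pi$ on $U(1)=\{e^{i\theta}\}$ and which satisfies $\nabla_\xi s=2\pi i\,\langle s^*(\alpha),\xi\rangle\,s$ for every local section $s$ of $L^1$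 and vector field $\xi$ on $X$; the normalization of curvature is such that $\omega=\mathrm{curv}(L,\nabla)$ means $d\alpha=\tau^*(\omega)$. $S$ is the space of smooth global sections of $L$. For $s\in S$, $\widetilde s\in C^\infty(L^1)$ is defined by $s(\tau(q))=\widetilde s(q)\,q$, so that $\widetilde s(q\,c)=c^{-1}\widetilde s(q)$ for $c\in U(1)$. For $\varphi\in C^\infty(X)$, $\widetilde\varphi=\varphi\circ\tau\in C^\infty(L^1)$. Prequantization is the map $\pi$ given by $\pi(\varphi)s=(\nabla_{\xi_\varphi}+2\pi i\,\varphi)s$ for $\varphi\in C^\infty(X)$, $s\in S$. Induced symplectic manifold: $\widetilde X=L^1\times\mathbb R^+$, where $\mathbb R^+$ is the positive reals with coordinate function $r(t)=t$; functions and forms on the factors are regarded as functions and forms on $\widetilde X$ by pullback, and $\omega_{\widetilde X}=d(r\alpha)=dr\wedge\alpha+r\,\tau^*(\omega)$, which is a symplectic form. *)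

theory Defs
  imports "HOL-Analysis.Analysis"
begin

section \<open>Smooth manifolds\<close>

text \<open>
  \<open>Ck k S f\<close>, for open \<open>S\<close> in a Euclidean space: all iterated directional derivatives of \<open>f\<close> up
  to order \<open>k\<close> exist and are continuous on \<open>S\<close>.
\<close>

primrec Ck :: "nat \<Rightarrow> 'a::euclidean_space set \<Rightarrow> ('a \<Rightarrow> 'b::real_normed_vector) \<Rightarrow> bool" where
  "Ck 0 S f = continuous_on S f"
| "Ck (Suc k) S f = ((\<forall>x\<in>S. f differentiable (at x)) \<and>
      (\<forall>v. Ck k S (\<lambda>x. frechet_derivative f (at x) v)))"

definition smooth :: "'a::euclidean_space set \<Rightarrow> ('a \<Rightarrow> 'b::real_normed_vector) \<Rightarrow> bool" where
  "smooth S f \<longleftrightarrow> (\<forall>k. Ck k S f)"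

text \<open>
  Charts are pairs of a domain and a coordinate map; the atlas need not be maximal.
\<close>

record ('m, 'e) manifold =
  mtop :: "'m topology"
  atlas :: "('m set \<times> ('m \<Rightarrow> 'e)) set"

abbreviation points :: "('m, 'e) manifold \<Rightarrow> 'm set" where
  "points M \<equiv> topspace (mtop M)"

definition smooth_manifold :: "('m, 'e::euclidean_space) manifold \<Rightarrow> bool" where
  "smooth_manifold M \<longleftrightarrow>
     Hausdorff_space (mtop M) \<and> second_countable (mtop M) \<and>
     \<Union> (fst ` atlas M) = points M \<and>
     (\<forall>(U, \<phi>) \<in> atlas M. openin (mtop M) U \<and> open (\<phi> ` U) \<and>
        homeomorphic_map (subtopology (mtop M) U) (top_of_set (\<phi> ` U)) \<phi>) \<and>
     (\<forall>(U, \<phi>) \<in> atlas M. \<forall>(V, \<psi>) \<in> atlas M. smooth (\<phi> ` (U \<inter> V)) (\<psi> \<circ> inv_into U \<phi>))"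

definition smooth_fun ::
    "('m, 'e::euclidean_space) manifold \<Rightarrow> 'm set \<Rightarrow> ('m \<Rightarrow> 'b::real_normed_vector) \<Rightarrow> bool" where
  "smooth_fun M U f \<longleftrightarrow> openin (mtop M) U \<and>
     (\<forall>(V, \<phi>) \<in> atlas M. smooth (\<phi> ` (U \<inter> V)) (f \<circ> inv_into V \<phi>))"

definition smooth_near ::
    "('m, 'e::euclidean_space) manifold \<Rightarrow> 'm \<Rightarrow> ('m \<Rightarrow> 'b::real_normed_vector) \<Rightarrow> bool" where
  "smooth_near M p f \<longleftrightarrow> (\<exists>U. p \<in> U \<and> smooth_fun M U f)"

definition smooth_map ::
    "('m, 'e::euclidean_space) manifold \<Rightarrow> 'm set \<Rightarrow> ('n, 'f::euclidean_space) manifold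
      \<Rightarrow> ('m \<Rightarrow> 'n) \<Rightarrow> bool" where
  "smooth_map M U N f \<longleftrightarrow> openin (mtop M) U \<and> f ` U \<subseteq> points N \<and>
     (\<forall>(V, \<psi>) \<in> atlas N. smooth_fun M (U \<inter> f -` V) (\<psi> \<circ> f))"

text \<open>
  The space of smooth complex functions on \<open>M\<close>. Since \<open>M\<close> need not fill its carrier type, functions
  are normalised to vanish outside \<open>M\<close>, so that equality in this space is equality on \<open>M\<close>.
\<close>

definition smooth_functions :: "('m, 'e::euclidean_space) manifold \<Rightarrow> ('m \<Rightarrow> complex) set" where
  "smooth_functions M = {f. smooth_fun M (points M) f \<and> (\<forall>p. p \<notin> points M \<longrightarrow> f p = 0)}"

definition open_manifold :: "'e::euclidean_space set \<Rightarrow> ('e, 'e) manifold" where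
  "open_manifold S = \<lparr>mtop = top_of_set S, atlas = {(S, \<lambda>x. x)}\<rparr>"

definition prod_manifold :: "('m, 'e) manifold \<Rightarrow> ('n, 'f) manifold \<Rightarrow> ('m \<times> 'n, 'e \<times> 'f) manifold" where
  "prod_manifold M N = \<lparr>mtop = prod_topology (mtop M) (mtop N),
     atlas = {(U \<times> V, map_prod \<phi> \<psi>) | U V \<phi> \<psi>. (U, \<phi>) \<in> atlas M \<and> (V, \<psi>) \<in> atlas N}\<rparr>"

text \<open>
  The smooth structure induced on an embedded submanifold \<open>S\<close> of \<open>M\<close>: the charts are all
  homeomorphisms from relatively open subsets of \<open>S\<close> to open sets of the model space that locally
  extend to smooth maps on \<open>M\<close> and have a smooth inverse into \<open>M\<close>. The dimension of \<open>S\<close> is that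
  of the type \<open>'f\<close>.
\<close>

definition submanifold ::
    "('m, 'e::euclidean_space) manifold \<Rightarrow> 'm set \<Rightarrow> ('m, 'f::euclidean_space) manifold" where
  "submanifold M S = \<lparr>mtop = subtopology (mtop M) S,
     atlas = {(V, \<psi>). openin (subtopology (mtop M) S) V \<and> open (\<psi> ` V) \<and>
        homeomorphic_map (subtopology (mtop M) V) (top_of_set (\<psi> ` V)) \<psi> \<and>
        (\<forall>p\<in>V. \<exists>W g. p \<in> W \<and> smooth_fun M W g \<and> (\<forall>q \<in> W \<inter> V. g q = \<psi> q)) \<and>
        smooth_map (open_manifold (\<psi> ` V)) (\<psi> ` V) M (inv_into V \<psi>)}\<rparr>"

section \<open>Tangent vectors, vector fields and forms\<close>

text \<open>
  A tangent vector at \<open>p\<close> is the operator of directional differentiation at \<open>p\<close>, acting on complex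
  functions that are smooth near \<open>p\<close>. As an operator on all functions it is set to \<open>0\<close> elsewhere;
  this makes it independent of the chart and makes equality of operators equality of vectors.
\<close>

type_synonym 'm tvec = "('m \<Rightarrow> complex) \<Rightarrow> complex"

definition tangent_space :: "('m, 'e::euclidean_space) manifold \<Rightarrow> 'm \<Rightarrow> 'm tvec set" where
  "tangent_space M p = {v. \<exists>U \<phi> w. (U, \<phi>) \<in> atlas M \<and> p \<in> U \<and>
     v = (\<lambda>f. if smooth_near M p f
              then frechet_derivative (f \<circ> inv_into U \<phi>) (at (\<phi> p)) w else 0)}"

definition complex_tangent_space :: "('m, 'e::euclidean_space) manifold \<Rightarrow> 'm \<Rightarrow> 'm tvec set" where
  "complex_tangent_space M p =
     {(\<lambda>f. u f + \<i> * v f) | u v. u \<in> tangent_space M p \<and> v \<in> tangent_space M p}"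

definition pushforward ::
    "('n, 'f::euclidean_space) manifold \<Rightarrow> ('m \<Rightarrow> 'n) \<Rightarrow> 'm \<Rightarrow> 'm tvec \<Rightarrow> 'n tvec" where
  "pushforward N F p v = (\<lambda>g. if smooth_near N (F p) g then v (g \<circ> F) else 0)"

definition velocity :: "('m, 'e::euclidean_space) manifold \<Rightarrow> (real \<Rightarrow> 'm) \<Rightarrow> real \<Rightarrow> 'm tvec" where
  "velocity M \<gamma> t =
     (\<lambda>f. if smooth_near M (\<gamma> t) f then vector_derivative (f \<circ> \<gamma>) (at t) else 0)"

text \<open>Vector fields are complex.\<close>

definition vector_field :: "('m, 'e::euclidean_space) manifold \<Rightarrow> 'm set \<Rightarrow> ('m \<Rightarrow> 'm tvec) \<Rightarrow> bool" where
  "vector_field M U \<xi> \<longleftrightarrow> openin (mtop M) U \<and> (\<forall>p\<in>U. \<xi> p \<in> complex_tangent_space M p) \<and>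
     (\<forall>W f. W \<subseteq> U \<and> smooth_fun M W f \<longrightarrow> smooth_fun M W (\<lambda>p. \<xi> p f))"

definition lie_bracket ::
    "('m, 'e::euclidean_space) manifold \<Rightarrow> ('m \<Rightarrow> 'm tvec) \<Rightarrow> ('m \<Rightarrow> 'm tvec) \<Rightarrow> 'm \<Rightarrow> 'm tvec" where
  "lie_bracket M \<xi> \<eta> p =
     (\<lambda>f. if smooth_near M p f then \<xi> p (\<lambda>q. \<eta> q f) - \<eta> p (\<lambda>q. \<xi> q f) else 0)"

definition complex_linear_on :: "'m tvec set \<Rightarrow> ('m tvec \<Rightarrow> complex) \<Rightarrow> bool" where
  "complex_linear_on T h \<longleftrightarrow>
     (\<forall>u\<in>T. \<forall>v\<in>T. h (\<lambda>f. u f + v f) = h u + h v) \<and> (\<forall>c. \<forall>v\<in>T. h (\<lambda>f. c * v f) = c * h v)"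

text \<open>
  Forms are real: real valued on real tangent vectors, and extended complex (bi)linearly to
  complex tangent vectors.
\<close>

type_synonym 'm form1 = "'m \<Rightarrow> 'm tvec \<Rightarrow> complex"
type_synonym 'm form2 = "'m \<Rightarrow> 'm tvec \<Rightarrow> 'm tvec \<Rightarrow> complex"

definition one_form :: "('m, 'e::euclidean_space) manifold \<Rightarrow> 'm set \<Rightarrow> 'm form1 \<Rightarrow> bool" where
  "one_form M U a \<longleftrightarrow> openin (mtop M) U \<and>
     (\<forall>p\<in>U. complex_linear_on (complex_tangent_space M p) (a p) \<and>
        (\<forall>v \<in> tangent_space M p. a p v \<in> \<real>)) \<and>
     (\<forall>W \<xi>. W \<subseteq> U \<and> vector_field M W \<xi> \<longrightarrow> smooth_fun M W (\<lambda>p. a p (\<xi> p)))"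

definition two_form :: "('m, 'e::euclidean_space) manifold \<Rightarrow> 'm set \<Rightarrow> 'm form2 \<Rightarrow> bool" where
  "two_form M U b \<longleftrightarrow> openin (mtop M) U \<and>
     (\<forall>p\<in>U. (\<forall>v \<in> complex_tangent_space M p.
           complex_linear_on (complex_tangent_space M p) (b p v) \<and> b p v v = 0 \<and>
           (\<forall>w \<in> complex_tangent_space M p. b p v w = - b p w v)) \<and>
        (\<forall>v \<in> tangent_space M p. \<forall>w \<in> tangent_space M p. b p v w \<in> \<real>)) \<and>
     (\<forall>W \<xi> \<eta>. W \<subseteq> U \<and> vector_field M W \<xi> \<and> vector_field M W \<eta>
        \<longrightarrow> smooth_fun M W (\<lambda>p. b p (\<xi> p) (\<eta> p)))"

definition differential :: "('m \<Rightarrow> complex) \<Rightarrow> 'm form1" where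
  "differential f = (\<lambda>p v. v f)"

definition wedge :: "'m form1 \<Rightarrow> 'm form1 \<Rightarrow> 'm form2" where
  "wedge a b = (\<lambda>p v w. a p v * b p w - a p w * b p v)"

definition pullback1 ::
    "('n, 'f::euclidean_space) manifold \<Rightarrow> ('m \<Rightarrow> 'n) \<Rightarrow> 'n form1 \<Rightarrow> 'm form1" where
  "pullback1 N F a = (\<lambda>p v. a (F p) (pushforward N F p v))"

definition pullback2 ::
    "('n, 'f::euclidean_space) manifold \<Rightarrow> ('m \<Rightarrow> 'n) \<Rightarrow> 'n form2 \<Rightarrow> 'm form2" where
  "pullback2 N F b = (\<lambda>p v w. b (F p) (pushforward N F p v) (pushforward N F p w))"

text \<open>
  \<open>b = da\<close> on \<open>U\<close>, by the invariant formula, with the normalisation matching \<open>wedge\<close> (no factor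
  1/2). The fields range over all open subsets, so no extension to \<open>U\<close> is involved.
\<close>

definition is_exterior_derivative ::
    "('m, 'e::euclidean_space) manifold \<Rightarrow> 'm set \<Rightarrow> 'm form1 \<Rightarrow> 'm form2 \<Rightarrow> bool" where
  "is_exterior_derivative M U a b \<longleftrightarrow>
     (\<forall>W \<xi> \<eta>. W \<subseteq> U \<and> vector_field M W \<xi> \<and> vector_field M W \<eta> \<longrightarrow>
        (\<forall>p\<in>W. b p (\<xi> p) (\<eta> p) =
           \<xi> p (\<lambda>q. a q (\<eta> q)) - \<eta> p (\<lambda>q. a q (\<xi> q)) - a p (lie_bracket M \<xi> \<eta> p)))"

definition closed_two_form :: "('m, 'e::euclidean_space) manifold \<Rightarrow> 'm form2 \<Rightarrow> bool" where
  "closed_two_form M b \<longleftrightarrow>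
     (\<forall>W \<xi> \<eta> \<zeta>. vector_field M W \<xi> \<and> vector_field M W \<eta> \<and> vector_field M W \<zeta> \<longrightarrow>
        (\<forall>p\<in>W. \<xi> p (\<lambda>q. b q (\<eta> q) (\<zeta> q)) + \<eta> p (\<lambda>q. b q (\<zeta> q) (\<xi> q)) + \<zeta> p (\<lambda>q. b q (\<xi> q) (\<eta> q))
           - b p (lie_bracket M \<xi> \<eta> p) (\<zeta> p) - b p (lie_bracket M \<eta> \<zeta> p) (\<xi> p)
           - b p (lie_bracket M \<zeta> \<xi> p) (\<eta> p) = 0))"

section \<open>Symplectic manifolds and the Poisson bracket\<close>

definition symplectic_manifold :: "('m, 'e::euclidean_space) manifold \<Rightarrow> 'm form2 \<Rightarrow> bool" where
  "symplectic_manifold M \<Omega> \<longleftrightarrow> smooth_manifold M \<and> two_form M (points M) \<Omega> \<and> closed_two_form M \<Omega> \<and>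
     (\<forall>p \<in> points M. \<forall>v \<in> tangent_space M p.
        (\<forall>w \<in> tangent_space M p. \<Omega> p v w = 0) \<longrightarrow> v = (\<lambda>f. 0))"

text \<open>
  The condition \<open>\<Omega>(\<xi>\<^sub>f, \<eta>) = \<eta> f\<close> is an identity of 1-forms in \<open>\<eta>\<close>, and is read pointwise. The value
  of the field outside \<open>M\<close> is fixed to make it unique.
\<close>

definition hamiltonian_field ::
    "('m, 'e::euclidean_space) manifold \<Rightarrow> 'm form2 \<Rightarrow> ('m \<Rightarrow> complex) \<Rightarrow> 'm \<Rightarrow> 'm tvec" where
  "hamiltonian_field M \<Omega> f = (THE \<xi>. vector_field M (points M) \<xi> \<and>
     (\<forall>p \<in> points M. \<forall>\<eta> \<in> complex_tangent_space M p. \<Omega> p (\<xi> p) \<eta> = \<eta> f) \<and>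
     (\<forall>p. p \<notin> points M \<longrightarrow> \<xi> p = (\<lambda>g. 0)))"

definition poisson_bracket ::
    "('m, 'e::euclidean_space) manifold \<Rightarrow> 'm form2 \<Rightarrow> ('m \<Rightarrow> complex) \<Rightarrow> ('m \<Rightarrow> complex) \<Rightarrow> 'm \<Rightarrow> complex" where
  "poisson_bracket M \<Omega> f g = (\<lambda>p. hamiltonian_field M \<Omega> f p g)"

definition poisson_monomorphism ::
    "('m, 'e::euclidean_space) manifold \<Rightarrow> 'm form2 \<Rightarrow> ('n, 'f::euclidean_space) manifold \<Rightarrow> 'n form2
      \<Rightarrow> (('m \<Rightarrow> complex) \<Rightarrow> ('n \<Rightarrow> complex)) \<Rightarrow> bool" where
  "poisson_monomorphism M \<Omega> N \<Omega>' F \<longleftrightarrow>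
     F ` smooth_functions M \<subseteq> smooth_functions N \<and>
     (\<forall>f \<in> smooth_functions M. \<forall>g \<in> smooth_functions M. \<forall>a b.
        F (\<lambda>p. a * f p + b * g p) = (\<lambda>q. a * F f q + b * F g q)) \<and>
     inj_on F (smooth_functions M) \<and>
     (\<forall>f \<in> smooth_functions M. \<forall>g \<in> smooth_functions M.
        F (poisson_bracket M \<Omega> f g) = poisson_bracket N \<Omega>' (F f) (F g))"

text \<open>
  Integrality in Cech--de Rham form. For a cover \<open>C\<close> by open sets, potentials \<open>a\<^sub>U\<close> with
  \<open>da\<^sub>U = \<omega>\<close> and real functions \<open>f\<^bsub>UV\<^esub>\<close> with \<open>df\<^bsub>UV\<^esub> = a\<^sub>V - a\<^sub>U\<close>, the cochain
  \<open>f\<^bsub>VW\<^esub> - f\<^bsub>UW\<^esub> + f\<^bsub>UV\<^esub>\<close> is a locally constant real cocycle representing the class of \<open>\<omega>\<close>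
  (up to the sign convention). The class is the image of an integral one iff \<open>C\<close>, \<open>a\<close> and \<open>f\<close>
  can be chosen such that this cocycle is integer valued: on a good cover, a real 1-cochain
  turning it into an integral cocycle is absorbed into \<open>f\<close>.
\<close>

definition integral_form :: "('m, 'e::euclidean_space) manifold \<Rightarrow> 'm form2 \<Rightarrow> bool" where
  "integral_form M \<omega> \<longleftrightarrow> (\<exists>C a f. \<Union> C = points M \<and>
     (\<forall>U\<in>C. one_form M U (a U) \<and> is_exterior_derivative M U (a U) \<omega>) \<and>
     (\<forall>U\<in>C. \<forall>V\<in>C. smooth_fun M (U \<inter> V) (f U V) \<and> (\<forall>p \<in> U \<inter> V. f U V p \<in> \<real> \<and>
        (\<forall>v \<in> complex_tangent_space M p. differential (f U V) p v = a V p v - a U p v))) \<and>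
     (\<forall>U\<in>C. \<forall>V\<in>C. \<forall>W\<in>C. \<forall>p \<in> U \<inter> V \<inter> W.
        f V W p - f U W p + f U V p \<in> (\<int> :: complex set)))"

section \<open>Line bundles with connection\<close>

record ('l, 'x, 'e) line_bundle =
  total :: "('l, 'e \<times> complex) manifold"
  proj :: "'l \<Rightarrow> 'x"
  fadd :: "'l \<Rightarrow> 'l \<Rightarrow> 'l"
  fscale :: "complex \<Rightarrow> 'l \<Rightarrow> 'l"

text \<open>
  The fibrewise linear local trivialisations \<open>\<Phi>\<close> transport the vector space axioms from
  \<open>\<complex>\<close> to the fibres.
\<close>

definition complex_line_bundle ::
    "('x, 'e::euclidean_space) manifold \<Rightarrow> ('l, 'x, 'e) line_bundle \<Rightarrow> bool" where
  "complex_line_bundle X L \<longleftrightarrow> smooth_manifold (total L) \<and>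
     smooth_map (total L) (points (total L)) X (proj L) \<and>
     (\<forall>x \<in> points X. \<exists>U \<Phi>. x \<in> U \<and> openin (mtop X) U \<and>
        (let P = prod_manifold X (open_manifold (UNIV :: complex set));
             E = {q \<in> points (total L). proj L q \<in> U}
         in bij_betw \<Phi> (U \<times> UNIV) E \<and>
            smooth_map P (U \<times> UNIV) (total L) \<Phi> \<and>
            smooth_map (total L) E P (inv_into (U \<times> UNIV) \<Phi>)) \<and>
        (\<forall>y\<in>U. \<forall>c d. proj L (\<Phi> (y, c)) = y \<and>
            fadd L (\<Phi> (y, c)) (\<Phi> (y, d)) = \<Phi> (y, c + d) \<and>
            fscale L c (\<Phi> (y, d)) = \<Phi> (y, c * d)))"

definition smooth_section ::
    "('x, 'e::euclidean_space) manifold \<Rightarrow> ('l, 'x, 'e) line_bundle \<Rightarrow> 'x set \<Rightarrow> ('x \<Rightarrow> 'l) \<Rightarrow> bool" where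
  "smooth_section X L U s \<longleftrightarrow> smooth_map X U (total L) s \<and> (\<forall>x\<in>U. proj L (s x) = x)"

text \<open>
  A connection: \<open>D p v s\<close> is the covariant derivative at \<open>p\<close>, in the direction of a complex
  tangent vector \<open>v\<close> at \<open>p\<close>, of a section \<open>s\<close> that is smooth near \<open>p\<close>.
\<close>

type_synonym ('l, 'x) covariant_derivative = "'x \<Rightarrow> 'x tvec \<Rightarrow> ('x \<Rightarrow> 'l) \<Rightarrow> 'l"

definition connection ::
    "('x, 'e::euclidean_space) manifold \<Rightarrow> ('l, 'x, 'e) line_bundle \<Rightarrow> ('l, 'x) covariant_derivative \<Rightarrow> bool" where
  "connection X L D \<longleftrightarrow>
     (\<forall>U s t. smooth_section X L U s \<and> smooth_section X L U t \<longrightarrow>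
        (\<forall>p\<in>U. \<forall>v \<in> complex_tangent_space X p.
           ((\<forall>x\<in>U. s x = t x) \<longrightarrow> D p v s = D p v t) \<and>
           (\<forall>w \<in> complex_tangent_space X p. D p (\<lambda>f. v f + w f) s = fadd L (D p v s) (D p w s)) \<and>
           (\<forall>c. D p (\<lambda>f. c * v f) s = fscale L c (D p v s)) \<and>
           D p v (\<lambda>x. fadd L (s x) (t x)) = fadd L (D p v s) (D p v t) \<and>
           (\<forall>f. smooth_fun X U f \<longrightarrow> D p v (\<lambda>x. fscale L (f x) (s x)) =
              fadd L (fscale L (v f) (s p)) (fscale L (f p) (D p v s)))) \<and>
        (\<forall>\<xi>. vector_field X U \<xi> \<longrightarrow> smooth_section X L U (\<lambda>p. D p (\<xi> p) s)))"

definition hermitian_structure ::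
    "('x, 'e::euclidean_space) manifold \<Rightarrow> ('l, 'x, 'e) line_bundle \<Rightarrow> ('l \<Rightarrow> 'l \<Rightarrow> complex) \<Rightarrow> bool" where
  "hermitian_structure X L H \<longleftrightarrow>
     (\<forall>x \<in> points X. let F = {q \<in> points (total L). proj L q = x} in
        \<forall>q\<in>F. \<forall>q'\<in>F. (\<forall>q''\<in>F. H (fadd L q q') q'' = H q q'' + H q' q'') \<and>
          (\<forall>c. H (fscale L c q) q' = c * H q q') \<and>
          H q' q = cnj (H q q') \<and> (q \<noteq> fscale L 0 q \<longrightarrow> 0 < Re (H q q))) \<and>
     (\<forall>U s t. smooth_section X L U s \<and> smooth_section X L U t \<longrightarrow>
        smooth_fun X U (\<lambda>x. H (s x) (t x)))"

text \<open>
  \<open>\<sigma>\<close> is a parallel section of \<open>L\<close> along the curve \<open>\<gamma>\<close>: if \<open>\<sigma> = c \<cdot> (s \<circ> \<gamma>)\<close> near \<open>t\<close> with a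
  nowhere vanishing local section \<open>s\<close>, then \<open>c'(t) s + c(t) \<nabla>\<^bsub>\<gamma>'(t)\<^esub> s = 0\<close>.
\<close>

definition parallel_along ::
    "('x, 'e::euclidean_space) manifold \<Rightarrow> ('l, 'x, 'e) line_bundle \<Rightarrow> ('l, 'x) covariant_derivative
      \<Rightarrow> real set \<Rightarrow> (real \<Rightarrow> 'x) \<Rightarrow> (real \<Rightarrow> 'l) \<Rightarrow> bool" where
  "parallel_along X L D I \<gamma> \<sigma> \<longleftrightarrow>
     smooth_map (open_manifold UNIV) I X \<gamma> \<and> smooth_map (open_manifold UNIV) I (total L) \<sigma> \<and>
     (\<forall>t\<in>I. proj L (\<sigma> t) = \<gamma> t \<and>
        (\<forall>U s c c'. smooth_section X L U s \<and> \<gamma> t \<in> U \<and> (\<forall>x\<in>U. s x \<noteq> fscale L 0 (s x)) \<and>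
             (\<forall>\<^sub>F u in nhds t. \<sigma> u = fscale L (c u) (s (\<gamma> u))) \<and>
             (c has_vector_derivative c') (at t) \<longrightarrow>
           fadd L (fscale L c' (s (\<gamma> t))) (fscale L (c t) (D (\<gamma> t) (velocity X \<gamma> t) s))
             = fscale L 0 (s (\<gamma> t))))"

definition parallel_invariant ::
    "('x, 'e::euclidean_space) manifold \<Rightarrow> ('l, 'x, 'e) line_bundle \<Rightarrow> ('l, 'x) covariant_derivative
      \<Rightarrow> ('l \<Rightarrow> 'l \<Rightarrow> complex) \<Rightarrow> bool" where
  "parallel_invariant X L D H \<longleftrightarrow>
     (\<forall>a b \<gamma> \<sigma> \<sigma>'. parallel_along X L D {a<..<b} \<gamma> \<sigma> \<and> parallel_along X L D {a<..<b} \<gamma> \<sigma>' \<longrightarrow>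
        (\<forall>t \<in> {a<..<b}. \<forall>u \<in> {a<..<b}. H (\<sigma> t) (\<sigma>' t) = H (\<sigma> u) (\<sigma>' u)))"

definition circle_bundle ::
    "('l, 'x, 'e::euclidean_space) line_bundle \<Rightarrow> ('l \<Rightarrow> 'l \<Rightarrow> complex) \<Rightarrow> ('l, 'e \<times> real) manifold" where
  "circle_bundle L H = submanifold (total L) {q \<in> points (total L). H q q = 1}"

text \<open>
  The 1-form on the circle bundle determined by the connection: real, invariant under \<open>U(1)\<close>, equal
  to \<open>d\<theta>/2\<pi>\<close> on each fibre, and with \<open>\<nabla>\<^sub>\<xi> s = 2\<pi>i \<langle>s\<^sup>*\<alpha>, \<xi>\<rangle> s\<close> for local sections \<open>s\<close> of the
  circle bundle.
\<close>

definition connection_form ::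
    "('x, 'e::euclidean_space) manifold \<Rightarrow> ('l, 'x, 'e) line_bundle \<Rightarrow> ('l, 'x) covariant_derivative
      \<Rightarrow> ('l \<Rightarrow> 'l \<Rightarrow> complex) \<Rightarrow> 'l form1 \<Rightarrow> bool" where
  "connection_form X L D H \<alpha> \<longleftrightarrow>
     (let L1 = circle_bundle L H in
        one_form L1 (points L1) \<alpha> \<and>
        (\<forall>c. cmod c = 1 \<longrightarrow> (\<forall>q \<in> points L1. \<forall>v \<in> complex_tangent_space L1 q.
           pullback1 L1 (fscale L c) \<alpha> q v = \<alpha> q v)) \<and>
        (\<forall>q \<in> points L1. \<forall>t.
           \<alpha> (fscale L (cis t) q) (velocity L1 (\<lambda>\<theta>. fscale L (cis \<theta>) q) t) = complex_of_real (1 / (2 * pi))) \<and>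
        (\<forall>U s \<xi>. smooth_map X U L1 s \<and> (\<forall>x\<in>U. proj L (s x) = x) \<and> vector_field X U \<xi> \<longrightarrow>
           (\<forall>x\<in>U. D x (\<xi> x) s = fscale L (2 * pi * \<i> * pullback1 L1 s \<alpha> x (\<xi> x)) (s x))))"

text \<open>\<open>\<omega>\<close> is the curvature of the connection with connection form \<open>\<alpha>\<close>: \<open>d\<alpha> = \<tau>\<^sup>*\<omega>\<close>.\<close>

definition has_curvature ::
    "('x, 'e::euclidean_space) manifold \<Rightarrow> ('l, 'x, 'e) line_bundle
      \<Rightarrow> ('l \<Rightarrow> 'l \<Rightarrow> complex) \<Rightarrow> 'l form1 \<Rightarrow> 'x form2 \<Rightarrow> bool" where
  "has_curvature X L H \<alpha> \<omega> \<longleftrightarrow>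
     (let L1 = circle_bundle L H in
        is_exterior_derivative L1 (points L1) \<alpha> (pullback2 X (proj L) \<omega>))"

definition prequantization ::
    "('x, 'e::euclidean_space) manifold \<Rightarrow> 'x form2 \<Rightarrow> ('l, 'x, 'e) line_bundle
      \<Rightarrow> ('l, 'x) covariant_derivative \<Rightarrow> ('x \<Rightarrow> complex) \<Rightarrow> ('x \<Rightarrow> 'l) \<Rightarrow> 'x \<Rightarrow> 'l" where
  "prequantization X \<omega> L D \<phi> s =
     (\<lambda>x. fadd L (D x (hamiltonian_field X \<omega> \<phi> x) s) (fscale L (2 * pi * \<i> * \<phi> x) (s x)))"

section \<open>The induced symplectic manifold\<close>

definition induced_manifold ::
    "('l, 'x, 'e::euclidean_space) line_bundle \<Rightarrow> ('l \<Rightarrow> 'l \<Rightarrow> complex)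
      \<Rightarrow> ('l \<times> real, ('e \<times> real) \<times> real) manifold" where
  "induced_manifold L H = prod_manifold (circle_bundle L H) (open_manifold {0<..})"

definition induced_form ::
    "('x, 'e::euclidean_space) manifold \<Rightarrow> 'x form2 \<Rightarrow> ('l, 'x, 'e) line_bundle
      \<Rightarrow> ('l \<Rightarrow> 'l \<Rightarrow> complex) \<Rightarrow> 'l form1 \<Rightarrow> ('l \<times> real) form2" where
  "induced_form X \<omega> L H \<alpha> =
     (let L1 = circle_bundle L H; r = (\<lambda>z. complex_of_real (snd z)) in
        (\<lambda>z v w. wedge (differential r) (pullback1 L1 fst \<alpha>) z v w
          + r z * pullback2 L1 fst (pullback2 X (proj L) \<omega>) z v w))"

definition on_induced ::
    "('l, 'x, 'e::euclidean_space) line_bundle \<Rightarrow> ('l \<Rightarrow> 'l \<Rightarrow> complex)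
      \<Rightarrow> ('l \<times> real \<Rightarrow> complex) \<Rightarrow> 'l \<times> real \<Rightarrow> complex" where
  "on_induced L H f = (\<lambda>z. if z \<in> points (induced_manifold L H) then f z else 0)"

definition function_lift ::
    "('l, 'x, 'e::euclidean_space) line_bundle \<Rightarrow> ('l \<Rightarrow> 'l \<Rightarrow> complex)
      \<Rightarrow> ('x \<Rightarrow> complex) \<Rightarrow> 'l \<times> real \<Rightarrow> complex" where
  "function_lift L H \<phi> = on_induced L H (\<lambda>(q, t). complex_of_real t * \<phi> (proj L q))"

definition section_lift ::
    "('l, 'x, 'e::euclidean_space) line_bundle \<Rightarrow> ('l \<Rightarrow> 'l \<Rightarrow> complex)
      \<Rightarrow> ('x \<Rightarrow> 'l) \<Rightarrow> 'l \<times> real \<Rightarrow> complex" where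
  "section_lift L H s = on_induced L H (\<lambda>(q, t). THE c. s (proj L q) = fscale L c q)"

end

theory Submission
  imports Defs "HOL-Complex_Analysis.Complex_Analysis" "Jordan_Normal_Form.Determinant"
begin

text \<open>
  At a point of the induced manifold a tangent vector is determined by its radial component and its
  image in the circle bundle, and the latter by its value under \<open>\<alpha>\<close> and its image in \<open>X\<close>: along a
  unit section \<open>u\<close>, every \<open>v\<close> is \<open>u\<^sub>*\<tau>\<^sub>*v\<close> plus a multiple of the generator of the circle action.
  Testing \<open>\<Omega>(\<xi>, \<eta>) = \<eta>(r\<phi>)\<close> against the radial field, the generator and lifts of vectors of \<open>X\<close>
  shows that the Hamiltonian field \<open>\<xi>\<close> of the lift of \<open>\<phi>\<close> satisfies \<open>\<xi>r = 0\<close>, \<open>\<alpha>(\<xi>) = -\<phi>\<close> and projects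
  to \<open>\<xi>\<^sub>\<phi>\<close>. Hence it sends the lift of \<open>\<psi>\<close> to that of \<open>\<xi>\<^sub>\<phi>\<psi>\<close>. On an equivariant function the generator
  acts as multiplication by \<open>-\<i>\<close>, so the vertical part of \<open>\<xi>\<close> produces the connection term of \<open>\<nabla>\<close> together
  with \<open>2\<pi>\<i>\<phi>\<close>. The existence of smooth Hamiltonian fields is Cramer's rule in a chart.
\<close>

text \<open>\<open>hamiltonian_field\<close> is a definite description over fields on the whole
  manifold, so nothing is known about its value at a point before one smooth solution exists and is
  unique. Nondegeneracy does both: it makes the system in a chart solvable, and it makes the
  solutions of different charts agree on overlaps, so that they form one field without a partition
  of unity. Since functions are complex, this takes place in complexified tangent spaces, described
  by complex coefficients in a single chart. That the circle bundle is a manifold must be proved as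
  well: its atlas consists of all submanifold charts, and an angular chart around a unit section
  shows that they cover. The constants: the radial pairing is
  \<open>- \<alpha>(\<xi>) = \<phi>\<close>, which sets the sign. If \<open>\<xi>\<close> projects
  to the push of \<open>\<xi>\<^sub>\<phi>\<close> along a unit section \<open>u\<close> plus
  \<open>c\<close> times the generator, the value \<open>1/(2 pi)\<close> of \<open>\<alpha>\<close>
  on the generator forces
  \<open>c = - 2 pi (u\<^sup>*\<alpha>(\<xi>\<^sub>\<phi>) + \<phi>)\<close>, and the factor
  \<open>-\<i>\<close> turns this into the \<open>2 pi \<i>\<close> that occurs in the covariant
  derivative of \<open>u\<close> and in prequantization.\<close>

no_notation scalar_prod (infix "\<bullet>" 70)


section \<open>Calculus of smooth maps\<close>

lemma has_derivative_cong_open: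
  assumes "open S" "x \<in> S" "\<And>y. y \<in> S \<Longrightarrow> f y = g y"
  shows "(f has_derivative D) (at x) \<longleftrightarrow> (g has_derivative D) (at x)"
  using assms has_derivative_transform_within_open[of f D x UNIV S g]
    has_derivative_transform_within_open[of g D x UNIV S f] by auto

lemma frechet_derivative_cong_open:
  assumes "open S" "x \<in> S" "\<And>y. y \<in> S \<Longrightarrow> f y = g y"
  shows "frechet_derivative f (at x) = frechet_derivative g (at x)"
  unfolding frechet_derivative_def using has_derivative_cong_open[OF assms] by simp

lemma differentiable_cong_open:
  assumes "open S" "x \<in> S" "\<And>y. y \<in> S \<Longrightarrow> f y = g y"
  shows "f differentiable (at x) \<longleftrightarrow> g differentiable (at x)"
  unfolding differentiable_def using has_derivative_cong_open[OF assms] by simp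

lemma Ck_cong:
  assumes "open S" "\<And>x. x \<in> S \<Longrightarrow> f x = g x"
  shows "Ck k S f \<longleftrightarrow> Ck k S g"
  using assms(2)
proof (induction k arbitrary: f g)
  case 0
  then show ?case by (simp cong: continuous_on_cong)
next
  case (Suc k)
  have "Ck k S (\<lambda>x. frechet_derivative f (at x) v) \<longleftrightarrow> Ck k S (\<lambda>x. frechet_derivative g (at x) v)" for v
    using Suc.prems frechet_derivative_cong_open[OF assms(1), of _ f g] by (intro Suc.IH) simp
  then show ?case
    using differentiable_cong_open[OF assms(1), of _ f g] Suc.prems by simp
qed

lemma Ck_subset: "Ck k S f \<Longrightarrow> T \<subseteq> S \<Longrightarrow> Ck k T f"
proof (induction k arbitrary: f)
  case 0
  then show ?case by (auto intro: continuous_on_subset)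
qed auto

text \<open>\<open>Ck (Suc k)\<close> asserts nothing explicit about lower orders: continuity comes
  from differentiability at the bottom of the recursion, and the step applies the claim to each
  directional derivative.\<close>

lemma Ck_SucD: "Ck (Suc k) S f \<Longrightarrow> Ck k S f"
proof (induction k arbitrary: f)
  case 0
  then show ?case
    by (auto intro!: continuous_at_imp_continuous_on differentiable_imp_continuous_within)
next
  case (Suc k)
  have "f differentiable at x" if "x \<in> S" for x
    using Suc.prems that by simp
  moreover have "Ck k S (\<lambda>x. frechet_derivative f (at x) v)" for v
    by (rule Suc.IH) (rule Suc.prems[unfolded Ck.simps(2)[of "Suc k"], THEN conjunct2, THEN spec])
  ultimately show ?case by simp
qed

lemma Ck_local:
  assumes "\<And>x. x \<in> S \<Longrightarrow> \<exists>T. open T \<and> x \<in> T \<and> Ck k T f"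
  shows "Ck k S f"
  using assms
proof (induction k arbitrary: f)
  case 0
  have "isCont f x" if "x \<in> S" for x
    using 0[OF that] continuous_on_eq_continuous_at by auto
  then show ?case by (simp add: continuous_at_imp_continuous_on)
next
  case (Suc k)
  have "Ck k S (\<lambda>x. frechet_derivative f (at x) v)" for v
    using Suc.prems by (intro Suc.IH) fastforce
  moreover have "f differentiable at x" if "x \<in> S" for x
    using Suc.prems[OF that] by auto
  ultimately show ?case by simp
qed

text \<open>Derivatives are unique, so any formula \<open>f'\<close> may replace the chosen
  \<open>frechet_derivative\<close>. Most closure rules below are inductions on \<open>k\<close>
  that supply such a formula.\<close>

lemma Ck_SucI:
  assumes "open S" "\<And>x. x \<in> S \<Longrightarrow> (f has_derivative f' x) (at x)" "\<And>v. Ck k S (\<lambda>x. f' x v)"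
  shows "Ck (Suc k) S f"
proof -
  have "frechet_derivative f (at x) = f' x" if "x \<in> S" for x
    using assms(2)[OF that] frechet_derivative_at by metis
  then have "Ck k S (\<lambda>x. frechet_derivative f (at x) v) \<longleftrightarrow> Ck k S (\<lambda>x. f' x v)" for v
    using assms(1) by (intro Ck_cong) auto
  then show ?thesis using assms by (auto simp: differentiable_def)
qed

lemma Ck_SucE:
  assumes "Ck (Suc k) S f" "x \<in> S"
  shows "(f has_derivative frechet_derivative f (at x)) (at x)"
  using assms frechet_derivative_works by auto

lemma Ck_const [simp]: "Ck k S (\<lambda>x. c)"
  by (induction k arbitrary: c) (auto simp: frechet_derivative_const)

lemma Ck_bounded_linear_compose:
  assumes "open S" "bounded_linear h" "Ck k S f"
  shows "Ck k S (\<lambda>x. h (f x))"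
  using assms(3)
proof (induction k arbitrary: f)
  case 0
  then show ?case
    using assms(2) by (auto intro: bounded_linear.continuous_on)
next
  case (Suc k)
  show ?case
  proof (rule Ck_SucI[OF assms(1)])
    show "((\<lambda>x. h (f x)) has_derivative (\<lambda>v. h (frechet_derivative f (at x) v))) (at x)"
      if "x \<in> S" for x
      by (rule bounded_linear.has_derivative[OF assms(2) Ck_SucE[OF Suc.prems that]])
    show "Ck k S (\<lambda>x. h (frechet_derivative f (at x) v))" for v
      using Suc.prems by (intro Suc.IH) simp
  qed
qed

lemma Ck_add:
  assumes "open S" "Ck k S f" "Ck k S g"
  shows "Ck k S (\<lambda>x. f x + g x)"
  using assms(2,3)
proof (induction k arbitrary: f g)
  case 0
  then show ?case by (auto intro: continuous_on_add)
next
  case (Suc k)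
  show ?case
  proof (rule Ck_SucI[OF assms(1)])
    show "((\<lambda>x. f x + g x) has_derivative
        (\<lambda>v. frechet_derivative f (at x) v + frechet_derivative g (at x) v)) (at x)"
      if "x \<in> S" for x
      by (rule has_derivative_add[OF Ck_SucE[OF Suc.prems(1) that] Ck_SucE[OF Suc.prems(2) that]])
    show "Ck k S (\<lambda>x. frechet_derivative f (at x) v + frechet_derivative g (at x) v)" for v
      using Suc.prems by (intro Suc.IH) simp_all
  qed
qed

lemma Ck_sum:
  assumes "open S" "\<And>i. i \<in> I \<Longrightarrow> Ck k S (f i)"
  shows "Ck k S (\<lambda>x. \<Sum>i\<in>I. f i x)"
  using assms(2) by (induction I rule: infinite_finite_induct) (auto intro: Ck_add[OF assms(1)])

lemma Ck_bilinear:
  assumes "open S" "bounded_bilinear h" "Ck k S f" "Ck k S g"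
  shows "Ck k S (\<lambda>x. h (f x) (g x))"
  using assms(3,4)
proof (induction k arbitrary: f g)
  case 0
  then show ?case using assms(2) by (auto intro: bounded_bilinear.continuous_on)
next
  case (Suc k)
  \<comment> \<open>The product rule leaves \<open>f\<close> and \<open>g\<close> undifferentiated
    next to a derivative, so both are also needed at order \<open>k\<close>.\<close>
  have *: "Ck k S f" "Ck k S g" using Suc.prems Ck_SucD by auto
  show ?case
  proof (rule Ck_SucI[OF assms(1)])
    show "((\<lambda>x. h (f x) (g x)) has_derivative (\<lambda>v.
        h (f x) (frechet_derivative g (at x) v) + h (frechet_derivative f (at x) v) (g x))) (at x)"
      if "x \<in> S" for x
      by (rule bounded_bilinear.FDERIV[OF assms(2) Ck_SucE[OF Suc.prems(1) that]
            Ck_SucE[OF Suc.prems(2) that]])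
    show "Ck k S (\<lambda>x.
        h (f x) (frechet_derivative g (at x) v) + h (frechet_derivative f (at x) v) (g x))" for v
      using Suc.prems * by (intro Ck_add[OF assms(1)] Suc.IH) simp_all
  qed
qed

lemma linear_eq_sum_Basis:
  fixes F :: "'a::euclidean_space \<Rightarrow> 'b::real_vector"
  assumes "linear F"
  shows "F w = (\<Sum>b\<in>Basis. (w \<bullet> b) *\<^sub>R F b)"
proof -
  have "F w = F (\<Sum>b\<in>Basis. (w \<bullet> b) *\<^sub>R b)"
    by (simp add: euclidean_representation)
  also have "\<dots> = (\<Sum>b\<in>Basis. (w \<bullet> b) *\<^sub>R F b)"
    by (simp add: linear_sum[OF assms] linear_scale[OF assms])
  finally show ?thesis .
qed

text \<open>\<open>Ck\<close> controls derivatives along a fixed direction, whereas the chain rule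
  evaluates the derivative of \<open>f\<close> at a vector that moves with \<open>x\<close>.
  Expanding that vector in \<open>Basis\<close> gives a finite sum of scalar functions times
  derivatives of \<open>f\<close> in fixed directions, composed with \<open>g\<close>, to which the
  induction hypothesis applies.\<close>

lemma Ck_compose:
  fixes g :: "'a::euclidean_space \<Rightarrow> 'c::euclidean_space"
  assumes "open S" "open T" "g ` S \<subseteq> T" "Ck k S g" "Ck k T f"
  shows "Ck k S (\<lambda>x. f (g x))"
  using assms(4,5)
proof (induction k arbitrary: f)
  case 0
  then show ?case using assms(3) by (auto intro: continuous_on_compose2)
next
  case (Suc k)
  have df: "(f has_derivative frechet_derivative f (at (g x))) (at (g x))" if "x \<in> S" for x
    using Suc.prems(2) that assms(3) by (intro Ck_SucE) auto
  show ?case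
  proof (rule Ck_SucI[OF assms(1), where f' = "\<lambda>x v. \<Sum>b\<in>Basis.
        (frechet_derivative g (at x) v \<bullet> b) *\<^sub>R frechet_derivative f (at (g x)) b"])
    fix x assume x: "x \<in> S"
    have "linear (frechet_derivative f (at (g x)))"
      using df[OF x] has_derivative_linear by blast
    then have "frechet_derivative f (at (g x)) (frechet_derivative g (at x) v) = (\<Sum>b\<in>Basis.
        (frechet_derivative g (at x) v \<bullet> b) *\<^sub>R frechet_derivative f (at (g x)) b)" for v
      by (rule linear_eq_sum_Basis)
    moreover have "((\<lambda>x. f (g x)) has_derivative
        (\<lambda>v. frechet_derivative f (at (g x)) (frechet_derivative g (at x) v))) (at x)"
      by (rule has_derivative_compose[OF Ck_SucE[OF Suc.prems(1) x] df[OF x]])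
    ultimately show "((\<lambda>x. f (g x)) has_derivative (\<lambda>v. \<Sum>b\<in>Basis.
        (frechet_derivative g (at x) v \<bullet> b) *\<^sub>R frechet_derivative f (at (g x)) b)) (at x)"
      by simp
  next
    fix v
    have "Ck k S (\<lambda>x. frechet_derivative f (at (g x)) b)" for b
      using Suc.prems Ck_SucD by (intro Suc.IH) auto
    moreover have "Ck k S (\<lambda>x. frechet_derivative g (at x) v \<bullet> b)" for b
      using Suc.prems by (intro Ck_bounded_linear_compose[OF assms(1) bounded_linear_inner_left]) auto
    ultimately show "Ck k S (\<lambda>x. \<Sum>b\<in>Basis.
        (frechet_derivative g (at x) v \<bullet> b) *\<^sub>R frechet_derivative f (at (g x)) b)"
      by (intro Ck_sum Ck_bilinear[OF assms(1) bounded_bilinear_scaleR] assms(1))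
  qed
qed

lemma Ck_ident: "open S \<Longrightarrow> Ck k S (\<lambda>x. x)"
  by (cases k) (auto intro!: Ck_SucI[where f' = "\<lambda>x v. v"])

section \<open>Smoothness of all orders\<close>

lemma smooth_cong:
  "open S \<Longrightarrow> (\<And>x. x \<in> S \<Longrightarrow> f x = g x) \<Longrightarrow> smooth S f \<longleftrightarrow> smooth S g"
  unfolding smooth_def using Ck_cong by blast

lemma smooth_subset: "smooth S f \<Longrightarrow> T \<subseteq> S \<Longrightarrow> smooth T f"
  unfolding smooth_def using Ck_subset by blast

lemma smooth_local:
  assumes "\<And>x. x \<in> S \<Longrightarrow> \<exists>T. open T \<and> x \<in> T \<and> smooth T f"
  shows "smooth S f"
  unfolding smooth_def
proof (intro allI Ck_local)
  fix k x assume "x \<in> S"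
  then show "\<exists>T. open T \<and> x \<in> T \<and> Ck k T f"
    using assms unfolding smooth_def by blast
qed

lemma smooth_const [simp]: "smooth S (\<lambda>x. c)"
  by (simp add: smooth_def)

lemma smooth_ident: "open S \<Longrightarrow> smooth S (\<lambda>x. x)"
  by (simp add: smooth_def Ck_ident)

lemma smooth_add: "open S \<Longrightarrow> smooth S f \<Longrightarrow> smooth S g \<Longrightarrow> smooth S (\<lambda>x. f x + g x)"
  unfolding smooth_def using Ck_add by blast

lemma smooth_bilinear:
  "open S \<Longrightarrow> bounded_bilinear h \<Longrightarrow> smooth S f \<Longrightarrow> smooth S g \<Longrightarrow> smooth S (\<lambda>x. h (f x) (g x))"
  unfolding smooth_def using Ck_bilinear by blast

lemma smooth_bounded_linear_compose:
  "open S \<Longrightarrow> bounded_linear h \<Longrightarrow> smooth S f \<Longrightarrow> smooth S (\<lambda>x. h (f x))"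
  unfolding smooth_def using Ck_bounded_linear_compose by blast

lemma smooth_bounded_linear: "open S \<Longrightarrow> bounded_linear h \<Longrightarrow> smooth S h"
  using smooth_bounded_linear_compose[OF _ _ smooth_ident] by blast

lemma smooth_compose:
  fixes g :: "'a::euclidean_space \<Rightarrow> 'c::euclidean_space"
  shows "open S \<Longrightarrow> open T \<Longrightarrow> g ` S \<subseteq> T \<Longrightarrow> smooth S g \<Longrightarrow> smooth T f \<Longrightarrow> smooth S (\<lambda>x. f (g x))"
  unfolding smooth_def using Ck_compose by blast

text \<open>A pair is the sum of its images under the two linear inclusions of the factors.\<close>

lemma smooth_Pair:
  assumes "open S" "smooth S f" "smooth S g"
  shows "smooth S (\<lambda>x. (f x, g x))"
proof -
  have "smooth S (\<lambda>x. (f x, 0) + (0, g x))"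
    using assms by (intro smooth_add smooth_bounded_linear_compose[of S "\<lambda>x. (x, 0)"]
        smooth_bounded_linear_compose[of S "\<lambda>x. (0, x)"] bounded_linear_intros) 
      auto
  then show ?thesis by simp
qed

lemma smooth_continuous_on: "smooth S f \<Longrightarrow> continuous_on S f"
  unfolding smooth_def by (metis Ck.simps(1))

lemma smooth_has_derivative:
  "smooth S f \<Longrightarrow> x \<in> S \<Longrightarrow> (f has_derivative frechet_derivative f (at x)) (at x)"
  unfolding smooth_def using Ck_SucE by blast

lemma smooth_frechet_derivative:
  "smooth S f \<Longrightarrow> smooth S (\<lambda>x. frechet_derivative f (at x) v)"
  unfolding smooth_def by (metis Ck.simps(2))

text \<open>The real derivative of a holomorphic function is multiplication by
  \<open>deriv f\<close>, which is holomorphic again, so the induction never leaves the class. This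
  is the source of smoothness for \<open>inverse\<close>, \<open>exp\<close> and
  \<open>Ln\<close>.\<close>

lemma smooth_holomorphic:
  assumes "open S" "f holomorphic_on S"
  shows "smooth S f"
proof -
  have "Ck k S f" for k
    using assms(2)
  proof (induction k arbitrary: f)
    case 0
    then show ?case by (simp add: holomorphic_on_imp_continuous_on)
  next
    case (Suc k)
    show ?case
    proof (rule Ck_SucI[OF assms(1), where f' = "\<lambda>x v. deriv f x * v"])
      show "(f has_derivative (\<lambda>v. deriv f x * v)) (at x)" if "x \<in> S" for x
        using holomorphic_derivI[OF Suc.prems assms(1) that] by (simp add: has_field_derivative_def)
      show "Ck k S (\<lambda>x. deriv f x * v)" for v
        using Ck_bounded_linear_compose[OF assms(1) bounded_linear_mult_left Suc.IH]
          holomorphic_deriv[OF Suc.prems assms(1)] by blast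
    qed
  qed
  then show ?thesis by (simp add: smooth_def)
qed

section \<open>Smooth functions and maps on manifolds\<close>

lemma chart_openin: "smooth_manifold M \<Longrightarrow> (U, \<phi>) \<in> atlas M \<Longrightarrow> openin (mtop M) U"
  unfolding smooth_manifold_def by blast

lemma chart_homeomorphic:
  "smooth_manifold M \<Longrightarrow> (U, \<phi>) \<in> atlas M \<Longrightarrow>
    homeomorphic_map (subtopology (mtop M) U) (top_of_set (\<phi> ` U)) \<phi>"
  unfolding smooth_manifold_def by blast

lemma chart_image_open: "smooth_manifold M \<Longrightarrow> (U, \<phi>) \<in> atlas M \<Longrightarrow> open (\<phi> ` U)"
  unfolding smooth_manifold_def by blast

lemma chart_cover:
  assumes "smooth_manifold M" "p \<in> points M"
  obtains U \<phi> where "(U, \<phi>) \<in> atlas M" "p \<in> U"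
proof -
  have "p \<in> \<Union> (fst ` atlas M)"
    using assms unfolding smooth_manifold_def by blast
  then show thesis using that by auto
qed

lemma chart_subset: "smooth_manifold M \<Longrightarrow> (U, \<phi>) \<in> atlas M \<Longrightarrow> U \<subseteq> points M"
  using chart_openin openin_subset by blast

lemma chart_inj: "smooth_manifold M \<Longrightarrow> (U, \<phi>) \<in> atlas M \<Longrightarrow> inj_on \<phi> U"
  using homeomorphic_imp_injective_map[OF chart_homeomorphic] chart_subset
  by (metis inf.absorb_iff2 topspace_subtopology)

lemma chart_inv:
  "smooth_manifold M \<Longrightarrow> (U, \<phi>) \<in> atlas M \<Longrightarrow> p \<in> U \<Longrightarrow> inv_into U \<phi> (\<phi> p) = p"
  using chart_inj inv_into_f_f by metis

lemma chart_open_image: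
  assumes "smooth_manifold M" "(U, \<phi>) \<in> atlas M" "openin (mtop M) W" "W \<subseteq> U"
  shows "open (\<phi> ` W)"
proof -
  have "openin (subtopology (mtop M) U) W"
    using assms by (simp add: openin_open_subtopology chart_openin)
  then have "openin (top_of_set (\<phi> ` U)) (\<phi> ` W)"
    using homeomorphic_map_openness[OF chart_homeomorphic[OF assms(1,2)], of W] openin_subset
    by blast
  then show ?thesis
    using chart_image_open[OF assms(1,2)] openin_open_trans by blast
qed

lemma chart_openin_vimage:
  assumes "smooth_manifold M" "(U, \<phi>) \<in> atlas M" "open T"
  shows "openin (mtop M) (U \<inter> \<phi> -` T)"
proof -
  have "continuous_map (subtopology (mtop M) U) (top_of_set (\<phi> ` U)) \<phi>"
    using chart_homeomorphic[OF assms(1,2)] homeomorphic_imp_continuous_map by blast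
  then have "continuous_map (subtopology (mtop M) U) euclidean \<phi>"
    using continuous_map_into_fulltopology by blast
  then have "openin (subtopology (mtop M) U) {x \<in> topspace (subtopology (mtop M) U). \<phi> x \<in> T}"
    using assms(3) by (intro openin_continuous_map_preimage) auto
  moreover have "{x \<in> topspace (subtopology (mtop M) U). \<phi> x \<in> T} = U \<inter> \<phi> -` T"
    using chart_subset[OF assms(1,2)] by auto
  ultimately show ?thesis
    by (metis openin_trans_full chart_openin assms(1,2))
qed

lemma smooth_fun_openin: "smooth_fun M U f \<Longrightarrow> openin (mtop M) U"
  by (simp add: smooth_fun_def)

lemma smooth_fun_chartD:
  "smooth_fun M U f \<Longrightarrow> (V, \<phi>) \<in> atlas M \<Longrightarrow> smooth (\<phi> ` (U \<inter> V)) (f \<circ> inv_into V \<phi>)"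
  unfolding smooth_fun_def by blast

lemma smooth_fun_cong:
  assumes "smooth_manifold M" "\<And>p. p \<in> U \<Longrightarrow> f p = g p"
  shows "smooth_fun M U f \<longleftrightarrow> smooth_fun M U g"
proof -
  have "smooth (\<phi> ` (U \<inter> V)) (f \<circ> inv_into V \<phi>) \<longleftrightarrow> smooth (\<phi> ` (U \<inter> V)) (g \<circ> inv_into V \<phi>)"
    if "openin (mtop M) U" "(V, \<phi>) \<in> atlas M" for V \<phi>
    using that assms chart_openin[OF assms(1)]
    by (intro smooth_cong chart_open_image[OF assms(1) that(2)]) (auto simp: openin_Int chart_inv[OF assms(1) that(2)])
  then show ?thesis
    unfolding smooth_fun_def by blast
qed

lemma smooth_fun_subset:
  assumes "smooth_fun M U f" "openin (mtop M) W" "W \<subseteq> U"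
  shows "smooth_fun M W f"
  using assms unfolding smooth_fun_def
  by (auto intro: smooth_subset[OF _ image_mono[OF Int_mono[OF _ subset_refl]]])

text \<open>Later smoothness claims are checked through this on neighbourhoods where a chart or a
  trivialisation is available.\<close>

lemma smooth_fun_local:
  assumes "smooth_manifold M" "openin (mtop M) U"
    and "\<And>p. p \<in> U \<Longrightarrow> \<exists>W. p \<in> W \<and> smooth_fun M W f"
  shows "smooth_fun M U f"
proof -
  have "smooth (\<phi> ` (U \<inter> V)) (f \<circ> inv_into V \<phi>)" if V: "(V, \<phi>) \<in> atlas M" for V \<phi>
  proof (rule smooth_local)
    fix y assume "y \<in> \<phi> ` (U \<inter> V)"
    then obtain p where p: "p \<in> U" "p \<in> V" "y = \<phi> p" by auto
    then obtain W where W: "p \<in> W" "smooth_fun M W f" using assms(3) by blast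
    have "open (\<phi> ` (W \<inter> V))"
      using W smooth_fun_openin chart_openin[OF assms(1) V]
      by (intro chart_open_image[OF assms(1) V]) auto
    then show "\<exists>T. open T \<and> y \<in> T \<and> smooth T (f \<circ> inv_into V \<phi>)"
      using smooth_fun_chartD[OF W(2) V] p W(1) by blast
  qed
  then show ?thesis
    unfolding smooth_fun_def using assms(2) by blast
qed

text \<open>The compatibility clause of the atlas, read with one chart as the function and the other
  as the coordinate.\<close>

lemma chart_smooth_fun: "smooth_manifold M \<Longrightarrow> (U, \<phi>) \<in> atlas M \<Longrightarrow> smooth_fun M U \<phi>"
  unfolding smooth_manifold_def smooth_fun_def by (fastforce simp: Int_commute)

lemma smooth_fun_open_image:
  assumes "smooth_manifold M" "smooth_fun M U f" "(V, \<phi>) \<in> atlas M"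
  shows "open (\<phi> ` (U \<inter> V))"
  using openin_Int[OF smooth_fun_openin[OF assms(2)] chart_openin[OF assms(1,3)]]
  by (intro chart_open_image[OF assms(1,3)]) auto

lemma smooth_fun_compose_smooth:
  fixes g :: "'m \<Rightarrow> 'c::euclidean_space"
  assumes "smooth_manifold M" "smooth_fun M U g" "open T" "g ` U \<subseteq> T" "smooth T h"
  shows "smooth_fun M U (\<lambda>p. h (g p))"
proof -
  have "smooth (\<phi> ` (U \<inter> V)) (\<lambda>y. h ((g \<circ> inv_into V \<phi>) y))" if V: "(V, \<phi>) \<in> atlas M" for V \<phi>
    using assms V
    by (intro smooth_compose[OF _ assms(3) _ _ assms(5)] smooth_fun_chartD
        smooth_fun_open_image[OF assms(1,2)]) (auto simp: chart_inv[OF assms(1) V])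
  then show ?thesis
    using assms(2) unfolding smooth_fun_def o_def by blast
qed

lemma smooth_fun_const: "openin (mtop M) U \<Longrightarrow> smooth_fun M U (\<lambda>p. c)"
  unfolding smooth_fun_def o_def by simp

lemma smooth_fun_bounded_linear:
  assumes "smooth_manifold M" "bounded_linear h" "smooth_fun M U f"
  shows "smooth_fun M U (\<lambda>p. h (f p))"
proof -
  have "smooth (\<phi> ` (U \<inter> V)) (\<lambda>y. h ((f \<circ> inv_into V \<phi>) y))" if V: "(V, \<phi>) \<in> atlas M" for V \<phi>
    using smooth_bounded_linear_compose[OF smooth_fun_open_image[OF assms(1,3) V] assms(2)]
      smooth_fun_chartD[OF assms(3) V] by blast
  then show ?thesis
    using assms(3) unfolding smooth_fun_def o_def by blast
qed

lemma smooth_fun_bilinear: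
  assumes "smooth_manifold M" "bounded_bilinear h" "smooth_fun M U f" "smooth_fun M U g"
  shows "smooth_fun M U (\<lambda>p. h (f p) (g p))"
proof -
  have "smooth (\<phi> ` (U \<inter> V)) (\<lambda>y. h ((f \<circ> inv_into V \<phi>) y) ((g \<circ> inv_into V \<phi>) y))"
    if V: "(V, \<phi>) \<in> atlas M" for V \<phi>
    using smooth_bilinear[OF smooth_fun_open_image[OF assms(1,3) V] assms(2)]
      smooth_fun_chartD[OF assms(3) V] smooth_fun_chartD[OF assms(4) V] by blast
  then show ?thesis
    using assms(3) unfolding smooth_fun_def o_def by blast
qed

lemma smooth_fun_mult:
  fixes f g :: "'m \<Rightarrow> 'a::real_normed_algebra"
  shows "smooth_manifold M \<Longrightarrow> smooth_fun M U f \<Longrightarrow> smooth_fun M U g \<Longrightarrow>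
    smooth_fun M U (\<lambda>p. f p * g p)"
  using smooth_fun_bilinear[OF _ bounded_bilinear_mult] by blast

lemma smooth_fun_add:
  assumes "smooth_manifold M" "smooth_fun M U f" "smooth_fun M U g"
  shows "smooth_fun M U (\<lambda>p. f p + g p)"
proof -
  have "smooth (\<phi> ` (U \<inter> V)) (\<lambda>y. (f \<circ> inv_into V \<phi>) y + (g \<circ> inv_into V \<phi>) y)"
    if V: "(V, \<phi>) \<in> atlas M" for V \<phi>
    using smooth_add[OF smooth_fun_open_image[OF assms(1,2) V]]
      smooth_fun_chartD[OF assms(2) V] smooth_fun_chartD[OF assms(3) V] by blast
  then show ?thesis
    using assms(2) unfolding smooth_fun_def o_def by blast
qed

lemma smooth_fun_sum:
  assumes "smooth_manifold M" "openin (mtop M) U" "\<And>i. i \<in> I \<Longrightarrow> smooth_fun M U (f i)"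
  shows "smooth_fun M U (\<lambda>p. \<Sum>i\<in>I. f i p)"
  using assms(3) by (induction I rule: infinite_finite_induct)
    (auto intro: smooth_fun_add[OF assms(1)] smooth_fun_const[OF assms(2)])

text \<open>Together with sums this covers the Leibniz formula for determinants.\<close>

lemma smooth_fun_prod:
  fixes f :: "'i \<Rightarrow> 'm \<Rightarrow> 'a::{real_normed_algebra, comm_ring_1}"
  assumes "smooth_manifold M" "openin (mtop M) U" "\<And>i. i \<in> I \<Longrightarrow> smooth_fun M U (f i)"
  shows "smooth_fun M U (\<lambda>p. \<Prod>i\<in>I. f i p)"
  using assms(3) by (induction I rule: infinite_finite_induct)
    (auto intro: smooth_fun_mult[OF assms(1)] smooth_fun_const[OF assms(2)])

lemma smooth_fun_diff:
  assumes "smooth_manifold M" "smooth_fun M U f" "smooth_fun M U g"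
  shows "smooth_fun M U (\<lambda>p. f p - g p)"
  using smooth_fun_add[OF assms(1,2) smooth_fun_bounded_linear[OF assms(1) _ assms(3)], of uminus]
  by (simp add: bounded_linear_minus bounded_linear_ident)

lemma smooth_fun_Pair:
  assumes "smooth_manifold M" "smooth_fun M U f" "smooth_fun M U g"
  shows "smooth_fun M U (\<lambda>p. (f p, g p))"
proof -
  have "smooth (\<phi> ` (U \<inter> V)) (\<lambda>y. ((f \<circ> inv_into V \<phi>) y, (g \<circ> inv_into V \<phi>) y))"
    if V: "(V, \<phi>) \<in> atlas M" for V \<phi>
    using smooth_Pair[OF smooth_fun_open_image[OF assms(1,2) V]]
      smooth_fun_chartD[OF assms(2) V] smooth_fun_chartD[OF assms(3) V] by blast
  then show ?thesis
    using assms(2) unfolding smooth_fun_def o_def by blast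
qed

lemma smooth_fun_holomorphic:
  assumes "smooth_manifold M" "smooth_fun M U f" "open T" "f ` U \<subseteq> T" "h holomorphic_on T"
  shows "smooth_fun M U (\<lambda>p. h (f p))"
  using smooth_fun_compose_smooth[OF assms(1-4) smooth_holomorphic[OF assms(3,5)]] .

lemma smooth_fun_divide:
  fixes f g :: "'m \<Rightarrow> complex"
  assumes "smooth_manifold M" "smooth_fun M U f" "smooth_fun M U g" "\<And>p. p \<in> U \<Longrightarrow> g p \<noteq> 0"
  shows "smooth_fun M U (\<lambda>p. f p / g p)"
proof -
  have "smooth_fun M U (\<lambda>p. inverse (g p))"
    using assms(4) by (intro smooth_fun_holomorphic[OF assms(1,3), of "- {0}"])
      (auto intro!: holomorphic_intros)
  then show ?thesis
    using smooth_fun_mult[OF assms(1,2)] by (simp add: divide_inverse)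
qed

lemma smooth_fun_in_chart:
  assumes "smooth_manifold M" "(U, \<phi>) \<in> atlas M" "openin (mtop M) W" "W \<subseteq> U"
    and "smooth (\<phi> ` W) h" "\<And>p. p \<in> W \<Longrightarrow> f p = h (\<phi> p)"
  shows "smooth_fun M W f"
proof -
  have "smooth_fun M W (\<lambda>p. h (\<phi> p))"
    using smooth_fun_subset[OF chart_smooth_fun[OF assms(1,2)] assms(3,4)]
      chart_open_image[OF assms(1-4)] assms(5)
    by (intro smooth_fun_compose_smooth[OF assms(1), of W \<phi> "\<phi> ` W" h]) auto
  moreover have "smooth_fun M W f \<longleftrightarrow> smooth_fun M W (\<lambda>p. h (\<phi> p))"
    using assms(6) by (rule smooth_fun_cong[OF assms(1)])
  ultimately show ?thesis by simp
qed

text \<open>Continuity of a smooth function is available only in coordinates, so the neighbourhood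
  of each point is pulled back through a chart from an open set of the model space.\<close>

lemma smooth_fun_openin_vimage:
  assumes "smooth_manifold M" "smooth_fun M U f" "open T"
  shows "openin (mtop M) (U \<inter> f -` T)"
proof (subst openin_subopen, intro ballI)
  fix p assume p: "p \<in> U \<inter> f -` T"
  then have "p \<in> points M"
    using smooth_fun_openin[OF assms(2)] openin_subset by blast
  then obtain V \<phi> where V: "(V, \<phi>) \<in> atlas M" "p \<in> V"
    using chart_cover[OF assms(1)] by blast
  let ?S = "\<phi> ` (U \<inter> V) \<inter> (f \<circ> inv_into V \<phi>) -` T"
  have "open ?S"
    using continuous_open_preimage[OF smooth_continuous_on[OF smooth_fun_chartD[OF assms(2) V(1)]]
        smooth_fun_open_image[OF assms(1,2) V(1)] assms(3)] .
  then have "openin (mtop M) (V \<inter> \<phi> -` ?S)"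
    by (rule chart_openin_vimage[OF assms(1) V(1)])
  moreover have "p \<in> V \<inter> \<phi> -` ?S"
    using p V by (auto simp: chart_inv[OF assms(1) V(1)])
  moreover have "V \<inter> \<phi> -` ?S \<subseteq> U \<inter> f -` T"
    using inj_onD[OF chart_inj[OF assms(1) V(1)]] by (auto simp: chart_inv[OF assms(1) V(1)]) metis
  ultimately show "\<exists>S. openin (mtop M) S \<and> p \<in> S \<and> S \<subseteq> U \<inter> f -` T"
    by blast
qed

section \<open>Smooth maps between manifolds\<close>

lemma smooth_map_openin: "smooth_map M U N F \<Longrightarrow> openin (mtop M) U"
  by (simp add: smooth_map_def)

lemma smooth_map_image: "smooth_map M U N F \<Longrightarrow> p \<in> U \<Longrightarrow> F p \<in> points N"
  by (auto simp: smooth_map_def)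

lemma smooth_map_chartD:
  "smooth_map M U N F \<Longrightarrow> (V, \<psi>) \<in> atlas N \<Longrightarrow> smooth_fun M (U \<inter> F -` V) (\<lambda>p. \<psi> (F p))"
  unfolding smooth_map_def o_def by blast

text \<open>Continuity is not a clause of \<open>smooth_map\<close>. It follows because
  \<open>\<psi>\<close> after \<open>F\<close> is smooth on the preimage of a chart domain and
  \<open>\<psi>\<close> carries \<open>V \<inter> T\<close> to an open set.\<close>

lemma smooth_map_openin_vimage:
  assumes "smooth_manifold M" "smooth_manifold N" "smooth_map M U N F" "openin (mtop N) T"
  shows "openin (mtop M) (U \<inter> F -` T)"
proof (subst openin_subopen, intro ballI)
  fix p assume p: "p \<in> U \<inter> F -` T"
  obtain V \<psi> where V: "(V, \<psi>) \<in> atlas N" "F p \<in> V"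
    using chart_cover[OF assms(2) smooth_map_image[OF assms(3)]] p by blast
  let ?W = "(U \<inter> F -` V) \<inter> (\<lambda>p. \<psi> (F p)) -` \<psi> ` (V \<inter> T)"
  have "open (\<psi> ` (V \<inter> T))"
    using assms chart_openin[OF assms(2) V(1)] by (intro chart_open_image[OF assms(2) V(1)]) auto
  then have "openin (mtop M) ?W"
    by (rule smooth_fun_openin_vimage[OF assms(1) smooth_map_chartD[OF assms(3) V(1)]])
  moreover have "p \<in> ?W" using p V by auto
  moreover have "?W \<subseteq> U \<inter> F -` T"
    using inj_onD[OF chart_inj[OF assms(2) V(1)]] by auto
  ultimately show "\<exists>S. openin (mtop M) S \<and> p \<in> S \<and> S \<subseteq> U \<inter> F -` T"
    by blast
qed

lemma smooth_map_chart_openin: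
  "smooth_manifold M \<Longrightarrow> smooth_manifold N \<Longrightarrow> smooth_map M U N F \<Longrightarrow> (V, \<psi>) \<in> atlas N \<Longrightarrow>
    openin (mtop M) (U \<inter> F -` V)"
  using smooth_map_openin_vimage chart_openin by metis

text \<open>Near a point, \<open>g\<close> factors through a chart of \<open>N\<close> and its
  coordinate expression there, and the chart after \<open>F\<close> is smooth by definition.\<close>

lemma smooth_fun_compose:
  assumes "smooth_manifold M" "smooth_manifold N" "smooth_map M U N F" "smooth_fun N T g"
  shows "smooth_fun M (U \<inter> F -` T) (\<lambda>p. g (F p))"
proof (rule smooth_fun_local[OF assms(1)])
  show "openin (mtop M) (U \<inter> F -` T)"
    by (rule smooth_map_openin_vimage[OF assms(1-3) smooth_fun_openin[OF assms(4)]])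
  fix p assume p: "p \<in> U \<inter> F -` T"
  obtain V \<psi> where V: "(V, \<psi>) \<in> atlas N" "F p \<in> V"
    using chart_cover[OF assms(2) smooth_map_image[OF assms(3)]] p by blast
  let ?W = "U \<inter> F -` (T \<inter> V)"
  have W: "openin (mtop M) ?W"
    using smooth_fun_openin[OF assms(4)] chart_openin[OF assms(2) V(1)]
    by (intro smooth_map_openin_vimage[OF assms(1-3)]) auto
  have "smooth_fun M ?W (\<lambda>p. (g \<circ> inv_into V \<psi>) (\<psi> (F p)))"
    using smooth_fun_subset[OF smooth_map_chartD[OF assms(3) V(1)] W]
    by (intro smooth_fun_compose_smooth[OF assms(1) _ smooth_fun_open_image[OF assms(2,4) V(1)]
          _ smooth_fun_chartD[OF assms(4) V(1)]]) auto
  moreover have "smooth_fun M ?W (\<lambda>p. (g \<circ> inv_into V \<psi>) (\<psi> (F p))) \<longleftrightarrow>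
      smooth_fun M ?W (\<lambda>p. g (F p))"
    by (rule smooth_fun_cong[OF assms(1)]) (simp add: chart_inv[OF assms(2) V(1)])
  ultimately have "smooth_fun M ?W (\<lambda>p. g (F p))" by simp
  then show "\<exists>W. p \<in> W \<and> smooth_fun M W (\<lambda>p. g (F p))"
    using p V by (intro exI[of _ ?W]) simp
qed

text \<open>\<open>smooth_map\<close> quantifies over all charts of the target. One chart around
  each image point is enough, since any other representative differs from it by a transition
  map.\<close>

lemma smooth_mapI:
  assumes "smooth_manifold M" "smooth_manifold N"
    and "\<And>p. p \<in> U \<Longrightarrow> \<exists>V \<psi> W. (V, \<psi>) \<in> atlas N \<and> p \<in> W \<and> W \<subseteq> U \<and> F ` W \<subseteq> V \<and>
      smooth_fun M W (\<lambda>p. \<psi> (F p))"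
  shows "smooth_map M U N F"
proof -
  have "\<exists>W. openin (mtop M) W \<and> p \<in> W \<and> W \<subseteq> U" if "p \<in> U" for p
    using assms(3)[OF that] smooth_fun_openin by blast
  then have U: "openin (mtop M) U"
    by (subst openin_subopen) blast
  have img: "F ` U \<subseteq> points N"
    using assms(3) chart_subset[OF assms(2)] by blast
  have loc: "\<exists>W. p \<in> W \<and> W \<subseteq> U \<inter> F -` V \<and> smooth_fun M W (\<lambda>p. \<psi> (F p))"
    if V: "(V, \<psi>) \<in> atlas N" and p: "p \<in> U \<inter> F -` V" for V \<psi> p
  proof -
    obtain V' \<psi>' W where W: "(V', \<psi>') \<in> atlas N" "p \<in> W" "W \<subseteq> U" "F ` W \<subseteq> V'"
      "smooth_fun M W (\<lambda>p. \<psi>' (F p))"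
      using assms(3)[of p] p by blast
    \<comment> \<open>On \<open>?W\<close> the image stays in both chart domains, where the
      transition from \<open>\<psi>'\<close> to \<open>\<psi>\<close> is defined.\<close>
    let ?T = "\<psi>' ` (V \<inter> V')"
    let ?W = "W \<inter> (\<lambda>p. \<psi>' (F p)) -` ?T"
    have T: "open ?T"
      by (rule smooth_fun_open_image[OF assms(2) chart_smooth_fun[OF assms(2) V] W(1)])
    have W': "openin (mtop M) ?W"
      by (rule smooth_fun_openin_vimage[OF assms(1) W(5) T])
    have FV: "F q \<in> V" if "q \<in> ?W" for q
      using that inj_onD[OF chart_inj[OF assms(2) W(1)]] W(4) by auto
    have "smooth_fun M ?W (\<lambda>p. (\<psi> \<circ> inv_into V' \<psi>') (\<psi>' (F p)))"
      using smooth_fun_subset[OF W(5) W']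
      by (intro smooth_fun_compose_smooth[OF assms(1) _ T _
          smooth_fun_chartD[OF chart_smooth_fun[OF assms(2) V] W(1)]]) auto
    moreover have "smooth_fun M ?W (\<lambda>p. (\<psi> \<circ> inv_into V' \<psi>') (\<psi>' (F p))) \<longleftrightarrow>
        smooth_fun M ?W (\<lambda>p. \<psi> (F p))"
      using W(4) by (intro smooth_fun_cong[OF assms(1)]) (simp add: chart_inv[OF assms(2) W(1)] image_subset_iff)
    moreover have "p \<in> ?W" using p W by auto
    moreover have "?W \<subseteq> U \<inter> F -` V" using FV W(3) by auto
    ultimately show ?thesis by (intro exI[of _ ?W]) simp
  qed
  have "smooth_fun M (U \<inter> F -` V) (\<lambda>p. \<psi> (F p))" if V: "(V, \<psi>) \<in> atlas N" for V \<psi>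
  proof (rule smooth_fun_local[OF assms(1)])
    show "openin (mtop M) (U \<inter> F -` V)"
    proof (subst openin_subopen, intro ballI)
      fix p assume "p \<in> U \<inter> F -` V"
      from loc[OF V this] obtain W where "p \<in> W" "W \<subseteq> U \<inter> F -` V"
        "smooth_fun M W (\<lambda>p. \<psi> (F p))" by auto
      then show "\<exists>W. openin (mtop M) W \<and> p \<in> W \<and> W \<subseteq> U \<inter> F -` V"
        using smooth_fun_openin by (intro exI[of _ W]) simp
    qed
    fix p assume "p \<in> U \<inter> F -` V"
    from loc[OF V this] show "\<exists>W. p \<in> W \<and> smooth_fun M W (\<lambda>p. \<psi> (F p))" by auto
  qed
  then show ?thesis
    using U img unfolding smooth_map_def o_def by blast
qed

lemma smooth_map_cong:
  assumes "smooth_manifold M" "\<And>p. p \<in> U \<Longrightarrow> F p = G p"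
  shows "smooth_map M U N F \<longleftrightarrow> smooth_map M U N G"
proof -
  have "U \<inter> F -` V = U \<inter> G -` V" for V
    using assms(2) by auto
  moreover have "smooth_fun M (U \<inter> G -` V) (\<psi> \<circ> F) \<longleftrightarrow> smooth_fun M (U \<inter> G -` V) (\<psi> \<circ> G)"
    if "(V, \<psi>) \<in> atlas N" for V \<psi>
    using assms by (intro smooth_fun_cong) auto
  moreover have "F ` U = G ` U"
    using assms(2) by auto
  ultimately show ?thesis
    unfolding smooth_map_def by (simp add: split_def cong: ball_cong)
qed

lemma smooth_map_subset:
  assumes "smooth_map M U N F" "openin (mtop M) W" "W \<subseteq> U"
  shows "smooth_map M W N F"
proof -
  have "smooth_fun M (W \<inter> F -` V) (\<psi> \<circ> F)" if "(V, \<psi>) \<in> atlas N" for V \<psi>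
  proof (rule smooth_fun_subset)
    show *: "smooth_fun M (U \<inter> F -` V) (\<psi> \<circ> F)"
      using assms(1) that unfolding smooth_map_def by blast
    have "W \<inter> F -` V = W \<inter> (U \<inter> F -` V)" using assms(3) by blast
    then show "openin (mtop M) (W \<inter> F -` V)"
      using smooth_fun_openin[OF *] assms(2) by (metis openin_Int)
  qed (use assms(3) in blast)
  then show ?thesis
    using assms unfolding smooth_map_def by blast
qed

lemma smooth_map_compose:
  assumes "smooth_manifold M" "smooth_manifold N" "smooth_map M U N F" "smooth_map N V K G"
  shows "smooth_map M (U \<inter> F -` V) K (\<lambda>p. G (F p))"
proof -
  have "smooth_fun M (U \<inter> F -` V \<inter> (\<lambda>p. G (F p)) -` T) (\<lambda>p. \<psi> (G (F p)))"
    if "(T, \<psi>) \<in> atlas K" for T \<psi>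
  proof -
    have "U \<inter> F -` V \<inter> (\<lambda>p. G (F p)) -` T = U \<inter> F -` (V \<inter> G -` T)" by auto
    then show ?thesis
      using smooth_fun_compose[OF assms(1-3) smooth_map_chartD[OF assms(4) that]] by simp
  qed
  then show ?thesis
    using smooth_map_openin_vimage[OF assms(1-3)] smooth_map_openin[OF assms(4)]
      smooth_map_image[OF assms(4)]
    unfolding smooth_map_def o_def by auto
qed

lemma smooth_fun_compose_total:
  assumes "smooth_manifold M" "smooth_manifold N" "smooth_map M U N F" "smooth_fun N T g" "F ` U \<subseteq> T"
  shows "smooth_fun M U (\<lambda>p. g (F p))"
proof -
  have "U \<inter> F -` T = U" using assms(5) by auto
  then show ?thesis using smooth_fun_compose[OF assms(1-4)] by simp
qed

lemma smooth_map_compose_total: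
  assumes "smooth_manifold M" "smooth_manifold N" "smooth_map M U N F" "smooth_map N T K G" "F ` U \<subseteq> T"
  shows "smooth_map M U K (\<lambda>p. G (F p))"
proof -
  have "U \<inter> F -` T = U" using assms(5) by auto
  then show ?thesis using smooth_map_compose[OF assms(1-4)] by simp
qed

section \<open>Open sets, products and submanifolds\<close>

lemma points_open_manifold [simp]: "points (open_manifold S) = S"
  by (simp add: open_manifold_def)

lemma mtop_open_manifold [simp]: "mtop (open_manifold S) = top_of_set S"
  by (simp add: open_manifold_def)

lemma atlas_open_manifold [simp]: "atlas (open_manifold S) = {(S, \<lambda>x. x)}"
  by (simp add: open_manifold_def)

lemma inv_into_ident: "x \<in> S \<Longrightarrow> inv_into S (\<lambda>x. x) x = x"
  using inv_into_f_f[of "\<lambda>x. x" S x] by (simp add: inj_on_def)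

lemma second_countable_euclidean:
  "second_countable (euclidean :: 'a::second_countable_topology topology)"
proof -
  obtain B :: "'a set set" where "countable B" "\<And>C. C \<in> B \<Longrightarrow> open C"
    "\<And>S. open S \<Longrightarrow> \<exists>U. U \<subseteq> B \<and> S = \<Union>U"
    using univ_second_countable by metis
  then have "countable B \<and> (\<forall>V\<in>B. openin euclidean V) \<and>
    (\<forall>U x. openin euclidean U \<and> x \<in> U \<longrightarrow> (\<exists>V\<in>B. x \<in> V \<and> V \<subseteq> U))"
    by (metis UnionE Union_upper open_openin subset_iff)
  then show ?thesis
    unfolding second_countable_def by blast
qed

lemma smooth_manifold_open_manifold:
  fixes S :: "'e::euclidean_space set"
  assumes "open S"
  shows "smooth_manifold (open_manifold S)"
proof -
  have "smooth S ((\<lambda>x. x) \<circ> inv_into S (\<lambda>x. x)) \<longleftrightarrow> smooth S (\<lambda>x. x)"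
    using assms by (intro smooth_cong) (auto simp: inv_into_ident)
  then have "smooth S ((\<lambda>x. x) \<circ> inv_into S (\<lambda>x. x))"
    using smooth_ident[OF assms] by simp
  moreover have "homeomorphic_map (top_of_set S) (top_of_set S) (\<lambda>x. x)"
    using homeomorphic_map_id[of "top_of_set S" "top_of_set S"] by (simp add: id_def)
  ultimately show ?thesis
    using assms second_countable_subtopology[OF second_countable_euclidean]
    by (simp add: smooth_manifold_def subtopology_subtopology Hausdorff_space_subtopology)
qed

lemma smooth_fun_open_manifold:
  assumes "open S"
  shows "smooth_fun (open_manifold S) U f \<longleftrightarrow> open U \<and> U \<subseteq> S \<and> smooth U f"
proof -
  have "smooth (U \<inter> S) (f \<circ> inv_into S (\<lambda>x. x)) \<longleftrightarrow> smooth U f" if "open U" "U \<subseteq> S"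
  proof -
    have "U \<inter> S = U" using that by blast
    then show ?thesis
      using that by (simp, intro smooth_cong) (auto simp: inv_into_ident subset_iff)
  qed
  moreover have "openin (top_of_set S) U \<longleftrightarrow> open U \<and> U \<subseteq> S"
    using assms by (simp add: openin_open_eq)
  ultimately show ?thesis
    unfolding smooth_fun_def by auto
qed

lemma smooth_map_into_open_manifold:
  "smooth_map M U (open_manifold S) f \<longleftrightarrow> smooth_fun M U f \<and> f ` U \<subseteq> S"
proof -
  have "U \<inter> f -` S = U" if "f ` U \<subseteq> S" using that by blast
  then show ?thesis
    unfolding smooth_map_def by (auto simp: o_def smooth_fun_openin)
qed

text \<open>Read in the chart itself, the inverse chart is the identity.\<close>

lemma chart_inv_smooth_map:
  assumes "smooth_manifold M" "(U, \<phi>) \<in> atlas M"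
  shows "smooth_map (open_manifold (\<phi> ` U)) (\<phi> ` U) M (inv_into U \<phi>)"
proof (rule smooth_mapI[OF _ assms(1)])
  have op: "open (\<phi> ` U)" by (rule chart_image_open[OF assms])
  show "smooth_manifold (open_manifold (\<phi> ` U))"
    by (rule smooth_manifold_open_manifold[OF op])
  have "smooth (\<phi> ` U) (\<lambda>y. \<phi> (inv_into U \<phi> y)) \<longleftrightarrow> smooth (\<phi> ` U) (\<lambda>y. y)"
    using op by (intro smooth_cong) (auto simp: f_inv_into_f)
  then have "smooth_fun (open_manifold (\<phi> ` U)) (\<phi> ` U) (\<lambda>y. \<phi> (inv_into U \<phi> y))"
    using smooth_ident[OF op] op by (simp add: smooth_fun_open_manifold)
  moreover have "inv_into U \<phi> ` \<phi> ` U \<subseteq> U"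
    by (auto intro: inv_into_into)
  ultimately show "\<exists>V \<psi> W. (V, \<psi>) \<in> atlas M \<and> y \<in> W \<and> W \<subseteq> \<phi> ` U \<and> inv_into U \<phi> ` W \<subseteq> V \<and>
      smooth_fun (open_manifold (\<phi> ` U)) W (\<lambda>y. \<psi> (inv_into U \<phi> y))" if "y \<in> \<phi> ` U" for y
    using assms(2) that by (intro exI[of _ U] exI[of _ \<phi>] exI[of _ "\<phi> ` U"]) simp
qed

section \<open>Products of manifolds\<close>

lemma mtop_prod_manifold [simp]: "mtop (prod_manifold M N) = prod_topology (mtop M) (mtop N)"
  by (simp add: prod_manifold_def)

lemma atlas_prod_manifold:
  "atlas (prod_manifold M N) =
    {(U \<times> V, map_prod \<phi> \<psi>) | U V \<phi> \<psi>. (U, \<phi>) \<in> atlas M \<and> (V, \<psi>) \<in> atlas N}"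
  by (simp add: prod_manifold_def)

lemma second_countable_prod_topology:
  assumes "second_countable X" "second_countable Y"
  shows "second_countable (prod_topology X Y)"
proof -
  obtain B where B: "countable B" "\<And>V. V \<in> B \<Longrightarrow> openin X V"
    "\<And>U x. openin X U \<Longrightarrow> x \<in> U \<Longrightarrow> \<exists>V\<in>B. x \<in> V \<and> V \<subseteq> U"
    using assms(1) unfolding second_countable_def by metis
  obtain C where C: "countable C" "\<And>V. V \<in> C \<Longrightarrow> openin Y V"
    "\<And>U x. openin Y U \<Longrightarrow> x \<in> U \<Longrightarrow> \<exists>V\<in>C. x \<in> V \<and> V \<subseteq> U"
    using assms(2) unfolding second_countable_def by metis
  let ?D = "(\<lambda>(V, W). V \<times> W) ` (B \<times> C)"
  have "countable ?D" using B(1) C(1) by blast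
  moreover have "\<forall>V\<in>?D. openin (prod_topology X Y) V"
    using B(2) C(2) by (auto simp: openin_prod_Times_iff)
  moreover have "\<exists>V\<in>?D. z \<in> V \<and> V \<subseteq> U" if U: "openin (prod_topology X Y) U" "z \<in> U" for U z
  proof -
    obtain x y where z: "z = (x, y)" by fastforce
    obtain S T where ST: "openin X S" "openin Y T" "x \<in> S" "y \<in> T" "S \<times> T \<subseteq> U"
      using U unfolding z openin_prod_topology_alt by metis
    obtain S' T' where "S' \<in> B" "x \<in> S'" "S' \<subseteq> S" "T' \<in> C" "y \<in> T'" "T' \<subseteq> T"
      using B(3)[OF ST(1,3)] C(3)[OF ST(2,4)] by metis
    then show ?thesis
      using ST(5) by (intro bexI[of _ "S' \<times> T'"]) (auto simp: z)
  qed
  ultimately show ?thesis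
    unfolding second_countable_def by (intro exI[of _ ?D]) auto
qed

lemma inv_into_map_prod:
  assumes "inj_on f A" "inj_on g B" "x \<in> f ` A" "y \<in> g ` B"
  shows "inv_into (A \<times> B) (map_prod f g) (x, y) = (inv_into A f x, inv_into B g y)"
  using assms by (intro inv_into_f_eq)
    (auto simp: inj_on_def map_prod_inj_on inv_into_into f_inv_into_f)

lemma homeomorphic_map_prod:
  assumes "homeomorphic_map X X' f" "homeomorphic_map Y Y' g"
  shows "homeomorphic_map (prod_topology X Y) (prod_topology X' Y') (map_prod f g)"
proof -
  obtain f' g' where "homeomorphic_maps X X' f f'" "homeomorphic_maps Y Y' g g'"
    using assms homeomorphic_map_maps by metis
  then have "homeomorphic_maps (prod_topology X Y) (prod_topology X' Y')
      (\<lambda>(x, y). (f x, g y)) (\<lambda>(x, y). (f' x, g' y))"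
    by (simp add: homeomorphic_maps_prod)
  then show ?thesis
    using homeomorphic_map_maps by (auto simp: map_prod_def)
qed

text \<open>A transition map between product charts is the pair of the two transition maps, each
  after a linear projection; the topological clauses hold factor by factor.\<close>

lemma smooth_manifold_prod_manifold:
  assumes "smooth_manifold M" "smooth_manifold N"
  shows "smooth_manifold (prod_manifold M N)"
proof -
  have cover: "\<Union> (fst ` atlas (prod_manifold M N)) = points (prod_manifold M N)"
  proof
    show "\<Union> (fst ` atlas (prod_manifold M N)) \<subseteq> points (prod_manifold M N)"
      using chart_subset[OF assms(1)] chart_subset[OF assms(2)]
      by (fastforce simp: atlas_prod_manifold)
    show "points (prod_manifold M N) \<subseteq> \<Union> (fst ` atlas (prod_manifold M N))"
    proof
      fix z assume "z \<in> points (prod_manifold M N)"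
      then have "fst z \<in> points M" "snd z \<in> points N" by auto
      then obtain U \<phi> V \<psi> where UV: "(U, \<phi>) \<in> atlas M" "fst z \<in> U" "(V, \<psi>) \<in> atlas N" "snd z \<in> V"
        using chart_cover[OF assms(1)] chart_cover[OF assms(2)] by metis
      then have "(U \<times> V, map_prod \<phi> \<psi>) \<in> atlas (prod_manifold M N)"
        by (auto simp: atlas_prod_manifold)
      then have "U \<times> V \<in> fst ` atlas (prod_manifold M N)" by force
      moreover have "z \<in> U \<times> V" using UV by (simp add: mem_Times_iff)
      ultimately show "z \<in> \<Union> (fst ` atlas (prod_manifold M N))" by blast
    qed
  qed
  have chart: "openin (mtop (prod_manifold M N)) (U \<times> V) \<and> open (map_prod \<phi> \<psi> ` (U \<times> V)) \<and>
      homeomorphic_map (subtopology (mtop (prod_manifold M N)) (U \<times> V))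
        (top_of_set (map_prod \<phi> \<psi> ` (U \<times> V))) (map_prod \<phi> \<psi>)"
    if U: "(U, \<phi>) \<in> atlas M" and V: "(V, \<psi>) \<in> atlas N" for U \<phi> V \<psi>
    using homeomorphic_map_prod[OF chart_homeomorphic[OF assms(1) U] chart_homeomorphic[OF assms(2) V]]
      chart_openin[OF assms(1) U] chart_openin[OF assms(2) V]
      chart_image_open[OF assms(1) U] chart_image_open[OF assms(2) V]
    by (simp add: openin_prod_Times_iff map_prod_surj_on[OF refl refl] open_Times subtopology_Times)
  have compat: "smooth (map_prod \<phi> \<psi> ` (U \<times> V \<inter> U' \<times> V'))
      (map_prod \<phi>' \<psi>' \<circ> inv_into (U \<times> V) (map_prod \<phi> \<psi>))"
    if U: "(U, \<phi>) \<in> atlas M" and V: "(V, \<psi>) \<in> atlas N"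
      and U': "(U', \<phi>') \<in> atlas M" and V': "(V', \<psi>') \<in> atlas N" for U \<phi> V \<psi> U' \<phi>' V' \<psi>'
  proof -
    have s: "smooth (\<phi> ` (U' \<inter> U)) (\<phi>' \<circ> inv_into U \<phi>)" "smooth (\<psi> ` (V' \<inter> V)) (\<psi>' \<circ> inv_into V \<psi>)"
      using smooth_fun_chartD[OF chart_smooth_fun[OF assms(1) U'] U]
        smooth_fun_chartD[OF chart_smooth_fun[OF assms(2) V'] V] by auto
    have o: "open (\<phi> ` (U' \<inter> U))" "open (\<psi> ` (V' \<inter> V))"
      using smooth_fun_open_image[OF assms(1) chart_smooth_fun[OF assms(1) U'] U]
        smooth_fun_open_image[OF assms(2) chart_smooth_fun[OF assms(2) V'] V] by auto
    let ?S = "\<phi> ` (U' \<inter> U) \<times> \<psi> ` (V' \<inter> V)"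
    have S: "open ?S" using o by (rule open_Times)
    have "smooth ?S (\<lambda>z. (\<phi>' \<circ> inv_into U \<phi>) (fst z))"
      by (rule smooth_compose[OF S o(1) _ smooth_bounded_linear[OF S bounded_linear_fst] s(1)]) auto
    moreover have "smooth ?S (\<lambda>z. (\<psi>' \<circ> inv_into V \<psi>) (snd z))"
      by (rule smooth_compose[OF S o(2) _ smooth_bounded_linear[OF S bounded_linear_snd] s(2)]) auto
    ultimately have "smooth ?S (\<lambda>z. ((\<phi>' \<circ> inv_into U \<phi>) (fst z), (\<psi>' \<circ> inv_into V \<psi>) (snd z)))"
      by (rule smooth_Pair[OF S])
    also have "?this \<longleftrightarrow> smooth ?S (map_prod \<phi>' \<psi>' \<circ> inv_into (U \<times> V) (map_prod \<phi> \<psi>))"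
    proof (rule smooth_cong[OF S])
      fix z assume "z \<in> ?S"
      then obtain x y where "z = (x, y)" "x \<in> \<phi> ` U" "y \<in> \<psi> ` V" by blast
      then show "((\<phi>' \<circ> inv_into U \<phi>) (fst z), (\<psi>' \<circ> inv_into V \<psi>) (snd z)) =
          (map_prod \<phi>' \<psi>' \<circ> inv_into (U \<times> V) (map_prod \<phi> \<psi>)) z"
        by (simp add: inv_into_map_prod[OF chart_inj[OF assms(1) U] chart_inj[OF assms(2) V]])
    qed
    finally show ?thesis
      by (simp add: Times_Int_Times map_prod_surj_on[OF refl refl] Int_commute)
  qed
  have "Hausdorff_space (mtop M)" "Hausdorff_space (mtop N)"
    "second_countable (mtop M)" "second_countable (mtop N)"
    using assms unfolding smooth_manifold_def by auto
  then have "Hausdorff_space (mtop (prod_manifold M N)) \<and> second_countable (mtop (prod_manifold M N))"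
    by (simp add: Hausdorff_space_prod_topology second_countable_prod_topology)
  then show ?thesis
    unfolding smooth_manifold_def
  proof (intro conjI cover)
    show "\<forall>(A, \<kappa>)\<in>atlas (prod_manifold M N). openin (mtop (prod_manifold M N)) A \<and> open (\<kappa> ` A) \<and>
        homeomorphic_map (subtopology (mtop (prod_manifold M N)) A) (top_of_set (\<kappa> ` A)) \<kappa>"
      using chart unfolding atlas_prod_manifold by auto
    show "\<forall>(A, \<kappa>)\<in>atlas (prod_manifold M N). \<forall>(A', \<kappa>')\<in>atlas (prod_manifold M N).
        smooth (\<kappa> ` (A \<inter> A')) (\<kappa>' \<circ> inv_into A \<kappa>)"
      using compat unfolding atlas_prod_manifold by auto
  qed auto
qed

lemma prod_chart_smooth_fun:
  assumes "smooth_manifold M" "smooth_manifold N" "(U, \<phi>) \<in> atlas M" "(V, \<psi>) \<in> atlas N"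
  shows "smooth_fun (prod_manifold M N) (U \<times> V) (map_prod \<phi> \<psi>)"
  using assms
  by (intro chart_smooth_fun smooth_manifold_prod_manifold) (auto simp: atlas_prod_manifold)

lemma smooth_map_fst:
  assumes "smooth_manifold M" "smooth_manifold N"
  shows "smooth_map (prod_manifold M N) (points (prod_manifold M N)) M fst"
proof (rule smooth_mapI[OF smooth_manifold_prod_manifold[OF assms] assms(1)])
  fix z assume "z \<in> points (prod_manifold M N)"
  then have "fst z \<in> points M" "snd z \<in> points N" by auto
  then obtain U \<phi> V \<psi> where UV: "(U, \<phi>) \<in> atlas M" "fst z \<in> U" "(V, \<psi>) \<in> atlas N" "snd z \<in> V"
    using chart_cover[OF assms(1)] chart_cover[OF assms(2)] by metis
  have "smooth_fun (prod_manifold M N) (U \<times> V) (\<lambda>z. fst (map_prod \<phi> \<psi> z))"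
    using smooth_fun_bounded_linear[OF smooth_manifold_prod_manifold[OF assms] bounded_linear_fst]
      prod_chart_smooth_fun[OF assms UV(1,3)] by blast
  then show "\<exists>V \<psi> W. (V, \<psi>) \<in> atlas M \<and> z \<in> W \<and> W \<subseteq> points (prod_manifold M N) \<and> fst ` W \<subseteq> V \<and>
      smooth_fun (prod_manifold M N) W (\<lambda>p. \<psi> (fst p))"
    using UV chart_subset[OF assms(1) UV(1)] chart_subset[OF assms(2) UV(3)]
    by (intro exI[of _ U] exI[of _ \<phi>] exI[of _ "U \<times> V"]) (auto simp: mem_Times_iff)
qed

lemma smooth_map_snd:
  assumes "smooth_manifold M" "smooth_manifold N"
  shows "smooth_map (prod_manifold M N) (points (prod_manifold M N)) N snd"
proof (rule smooth_mapI[OF smooth_manifold_prod_manifold[OF assms] assms(2)])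
  fix z assume "z \<in> points (prod_manifold M N)"
  then have "fst z \<in> points M" "snd z \<in> points N" by auto
  then obtain U \<phi> V \<psi> where UV: "(U, \<phi>) \<in> atlas M" "fst z \<in> U" "(V, \<psi>) \<in> atlas N" "snd z \<in> V"
    using chart_cover[OF assms(1)] chart_cover[OF assms(2)] by metis
  have "smooth_fun (prod_manifold M N) (U \<times> V) (\<lambda>z. snd (map_prod \<phi> \<psi> z))"
    using smooth_fun_bounded_linear[OF smooth_manifold_prod_manifold[OF assms] bounded_linear_snd]
      prod_chart_smooth_fun[OF assms UV(1,3)] by blast
  then show "\<exists>V \<psi> W. (V, \<psi>) \<in> atlas N \<and> z \<in> W \<and> W \<subseteq> points (prod_manifold M N) \<and> snd ` W \<subseteq> V \<and>
      smooth_fun (prod_manifold M N) W (\<lambda>p. \<psi> (snd p))"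
    using UV chart_subset[OF assms(1) UV(1)] chart_subset[OF assms(2) UV(3)]
    by (intro exI[of _ V] exI[of _ \<psi>] exI[of _ "U \<times> V"]) (auto simp: mem_Times_iff)
qed

lemma smooth_map_Pair:
  assumes "smooth_manifold K" "smooth_manifold M" "smooth_manifold N"
    and "smooth_map K U M f" "smooth_map K U N g"
  shows "smooth_map K U (prod_manifold M N) (\<lambda>p. (f p, g p))"
proof (rule smooth_mapI[OF assms(1) smooth_manifold_prod_manifold[OF assms(2,3)]])
  fix p assume p: "p \<in> U"
  obtain A \<phi> B \<psi> where AB: "(A, \<phi>) \<in> atlas M" "f p \<in> A" "(B, \<psi>) \<in> atlas N" "g p \<in> B"
    using chart_cover[OF assms(2) smooth_map_image[OF assms(4) p]]
      chart_cover[OF assms(3) smooth_map_image[OF assms(5) p]] by metis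
  let ?W = "(U \<inter> f -` A) \<inter> (U \<inter> g -` B)"
  have s: "smooth_fun K (U \<inter> f -` A) (\<lambda>p. \<phi> (f p))" "smooth_fun K (U \<inter> g -` B) (\<lambda>p. \<psi> (g p))"
    using smooth_map_chartD[OF assms(4) AB(1)] smooth_map_chartD[OF assms(5) AB(3)] by auto
  have W: "openin (mtop K) ?W"
    by (rule openin_Int[OF smooth_fun_openin[OF s(1)] smooth_fun_openin[OF s(2)]])
  have "smooth_fun K ?W (\<lambda>p. (\<phi> (f p), \<psi> (g p)))"
    using smooth_fun_subset[OF s(1) W] smooth_fun_subset[OF s(2) W]
    by (intro smooth_fun_Pair[OF assms(1)]) auto
  then show "\<exists>V \<psi> W. (V, \<psi>) \<in> atlas (prod_manifold M N) \<and> p \<in> W \<and> W \<subseteq> U \<and>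
      (\<lambda>p. (f p, g p)) ` W \<subseteq> V \<and> smooth_fun K W (\<lambda>p. \<psi> (f p, g p))"
    using p AB by (intro exI[of _ "A \<times> B"] exI[of _ "map_prod \<phi> \<psi>"] exI[of _ ?W])
      (auto simp: atlas_prod_manifold)
qed

lemma smooth_map_ident:
  assumes "smooth_manifold M"
  shows "smooth_map M (points M) M (\<lambda>p. p)"
  using chart_smooth_fun[OF assms] chart_subset[OF assms]
  by (auto simp: smooth_map_def o_def Int_absorb1)

lemma smooth_map_const:
  assumes "smooth_manifold M" "openin (mtop M) U" "q \<in> points N"
  shows "smooth_map M U N (\<lambda>p. q)"
proof -
  have "smooth_fun M (U \<inter> (\<lambda>p. q) -` V) (\<lambda>p. \<psi> q)" for V and \<psi> :: "'c \<Rightarrow> 'd"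
    using assms(2) by (intro smooth_fun_const) (cases "q \<in> V"; simp)
  then show ?thesis
    using assms unfolding smooth_map_def o_def by auto
qed

section \<open>Embedded submanifolds\<close>

lemma points_submanifold [simp]: "points (submanifold M S) = points M \<inter> S"
  by (simp add: submanifold_def)

lemma mtop_submanifold [simp]: "mtop (submanifold M S) = subtopology (mtop M) S"
  by (simp add: submanifold_def)

lemma submanifold_chartD:
  assumes "(V, \<psi>) \<in> atlas (submanifold M S)"
  shows "openin (subtopology (mtop M) S) V" "open (\<psi> ` V)"
    "homeomorphic_map (subtopology (mtop M) V) (top_of_set (\<psi> ` V)) \<psi>"
    "\<And>p. p \<in> V \<Longrightarrow> \<exists>W g. p \<in> W \<and> smooth_fun M W g \<and> (\<forall>q \<in> W \<inter> V. g q = \<psi> q)"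
    "smooth_map (open_manifold (\<psi> ` V)) (\<psi> ` V) M (inv_into V \<psi>)"
  using assms by (auto simp: submanifold_def)

lemma submanifold_chart_inj:
  assumes "(V, \<psi>) \<in> atlas (submanifold M S)"
  shows "inj_on \<psi> V" "V \<subseteq> points M \<inter> S"
proof -
  show V: "V \<subseteq> points M \<inter> S"
    using openin_subset[OF submanifold_chartD(1)[OF assms]] by simp
  show "inj_on \<psi> V"
    using homeomorphic_imp_injective_map[OF submanifold_chartD(3)[OF assms]] V
    by (simp add: inf.absorb2 le_inf_iff)
qed

lemma submanifold_chart_smooth:
  assumes "smooth_manifold M" "(V, \<psi>) \<in> atlas (submanifold M S)" "smooth_fun M W g"
  shows "open (\<psi> ` V \<inter> inv_into V \<psi> -` W)"
    and "smooth (\<psi> ` V \<inter> inv_into V \<psi> -` W) (\<lambda>y. g (inv_into V \<psi> y))"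
  using smooth_fun_compose[OF smooth_manifold_open_manifold[OF submanifold_chartD(2)[OF assms(2)]]
      assms(1) submanifold_chartD(5)[OF assms(2)] assms(3)]
  by (auto simp: smooth_fun_open_manifold[OF submanifold_chartD(2)[OF assms(2)]])

text \<open>Every clause except covering follows from the definition of the charts. For
  compatibility, \<open>\<psi>'\<close> agrees near a point with a function \<open>g\<close> that is
  smooth on \<open>M\<close>, and \<open>g\<close> after the smooth inverse of \<open>\<psi>\<close>
  is smooth on an open set of the model space.\<close>

lemma smooth_manifold_submanifold:
  fixes M :: "('m, 'e::euclidean_space) manifold"
  assumes "smooth_manifold M"
    and cover: "\<And>p. p \<in> points M \<Longrightarrow> p \<in> S \<Longrightarrow>
      \<exists>V \<psi>. (V, \<psi>) \<in> atlas (submanifold M S :: ('m, 'f::euclidean_space) manifold) \<and> p \<in> V"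
  shows "smooth_manifold (submanifold M S :: ('m, 'f) manifold)" (is "smooth_manifold ?N")
proof -
  have compat: "smooth (\<psi> ` (V \<inter> V')) (\<psi>' \<circ> inv_into V \<psi>)"
    if V: "(V, \<psi>) \<in> atlas ?N" and V': "(V', \<psi>') \<in> atlas ?N"
    for V \<psi> V' \<psi>'
  proof (rule smooth_local)
    fix y assume "y \<in> \<psi> ` (V \<inter> V')"
    then obtain p where p: "p \<in> V" "p \<in> V'" "y = \<psi> p" by auto
    obtain W g where W: "p \<in> W" "smooth_fun M W g" "\<And>q. q \<in> W \<inter> V' \<Longrightarrow> g q = \<psi>' q"
      using submanifold_chartD(4)[OF V' p(2)] by blast
    obtain T where T: "openin (mtop M) T" "V' = T \<inter> S"
      using submanifold_chartD(1)[OF V'] by (auto simp: openin_subtopology)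
    \<comment> \<open>\<open>V'\<close> is cut out of \<open>S\<close> by an open \<open>T\<close>,
      so the overlap is relatively open in \<open>V\<close> and its image under
      \<open>\<psi>\<close> is open.\<close>
    have "V \<inter> V' = T \<inter> V"
      using T(2) submanifold_chart_inj(2)[OF V] by blast
    then have "openin (subtopology (mtop M) V) (V \<inter> V')"
      using T(1) by (auto simp: openin_subtopology)
    then have "openin (top_of_set (\<psi> ` V)) (\<psi> ` (V \<inter> V'))"
      using homeomorphic_map_openness[OF submanifold_chartD(3)[OF V], of "V \<inter> V'"] openin_subset
      by blast
    then have o: "open (\<psi> ` (V \<inter> V'))"
      using submanifold_chartD(2)[OF V] openin_open_trans by blast
    let ?T = "\<psi> ` (V \<inter> V') \<inter> (\<psi> ` V \<inter> inv_into V \<psi> -` W)"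
    have T': "open ?T"
      using o submanifold_chart_smooth(1)[OF assms(1) V W(2)] by (rule open_Int)
    have "smooth ?T (\<lambda>y. g (inv_into V \<psi> y))"
      using submanifold_chart_smooth(2)[OF assms(1) V W(2)] by (rule smooth_subset) (rule Int_lower2)
    also have "?this \<longleftrightarrow> smooth ?T (\<psi>' \<circ> inv_into V \<psi>)"
      using W(3) submanifold_chart_inj(1)[OF V]
      by (intro smooth_cong[OF T']) (auto dest!: inj_onD[OF submanifold_chart_inj(1)[OF V]])
    finally have "smooth ?T (\<psi>' \<circ> inv_into V \<psi>)" .
    moreover have "y \<in> ?T"
      using p W(1) submanifold_chart_inj(1)[OF V] by auto
    ultimately show "\<exists>T. open T \<and> y \<in> T \<and> smooth T (\<psi>' \<circ> inv_into V \<psi>)"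
      using T' by (intro exI[of _ ?T]) simp
  qed
  have chart: "openin (mtop ?N) V \<and> open (\<psi> ` V) \<and>
      homeomorphic_map (subtopology (mtop ?N) V) (top_of_set (\<psi> ` V)) \<psi>"
    if V: "(V, \<psi>) \<in> atlas ?N" for V \<psi>
  proof -
    have "S \<inter> V = V" using submanifold_chart_inj(2)[OF V] by blast
    then show ?thesis
      using submanifold_chartD[OF V] by (simp add: subtopology_subtopology)
  qed
  have "\<Union> (fst ` atlas ?N) = points ?N"
  proof
    show "\<Union> (fst ` atlas ?N) \<subseteq> points ?N"
      using submanifold_chart_inj(2) by fastforce
    show "points ?N \<subseteq> \<Union> (fst ` atlas ?N)"
    proof
      fix p assume "p \<in> points ?N"
      then obtain V \<psi> where "(V, \<psi>) \<in> atlas ?N" "p \<in> V"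
        using cover[of p] by auto
      then show "p \<in> \<Union> (fst ` atlas ?N)" by force
    qed
  qed
  moreover have "Hausdorff_space (mtop ?N)" "second_countable (mtop ?N)"
    using assms(1) unfolding smooth_manifold_def
    by (auto simp: Hausdorff_space_subtopology second_countable_subtopology)
  ultimately show ?thesis
    unfolding smooth_manifold_def using chart compat by auto
qed

lemma smooth_fun_submanifold:
  assumes "smooth_manifold M" "smooth_fun M W g"
  shows "smooth_fun (submanifold M S) (W \<inter> S) g"
proof -
  have "smooth (\<psi> ` (W \<inter> S \<inter> V)) (g \<circ> inv_into V \<psi>)"
    if V: "(V, \<psi>) \<in> atlas (submanifold M S)" for V \<psi>
    unfolding o_def using submanifold_chart_smooth(2)[OF assms(1) V assms(2)]
    by (rule smooth_subset) (use submanifold_chart_inj(1)[OF V] in auto)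
  moreover have "openin (mtop (submanifold M S)) (W \<inter> S)"
    using smooth_fun_openin[OF assms(2)] by (auto simp: openin_subtopology)
  ultimately show ?thesis
    unfolding smooth_fun_def by auto
qed

lemma smooth_map_submanifold_inclusion:
  assumes "smooth_manifold M"
  shows "smooth_map (submanifold M S) (points M \<inter> S) M (\<lambda>p. p)"
proof -
  have "smooth_fun (submanifold M S) (points M \<inter> S \<inter> V) \<phi>" if V: "(V, \<phi>) \<in> atlas M" for V \<phi>
  proof -
    have "points M \<inter> S \<inter> V = V \<inter> S" using chart_subset[OF assms V] by blast
    then show ?thesis
      using smooth_fun_submanifold[OF assms chart_smooth_fun[OF assms V]] by simp
  qed
  moreover have "openin (subtopology (mtop M) S) (points M \<inter> S)"
    by (metis openin_topspace topspace_subtopology)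
  ultimately show ?thesis
    unfolding smooth_map_def o_def by auto
qed

text \<open>Along \<open>F\<close> a chart may be replaced by its local extension to
  \<open>M\<close>, since \<open>F\<close> takes its values in \<open>S\<close>.\<close>

lemma smooth_map_into_submanifold:
  assumes "smooth_manifold N" "smooth_manifold M" "smooth_map N U M F" "F ` U \<subseteq> S"
  shows "smooth_map N U (submanifold M S) F"
proof -
  have "smooth_fun N (U \<inter> F -` V) (\<lambda>p. \<psi> (F p))" if V: "(V, \<psi>) \<in> atlas (submanifold M S)" for V \<psi>
  proof (rule smooth_fun_local[OF assms(1)])
    obtain T where T: "openin (mtop M) T" "V = T \<inter> S"
      using submanifold_chartD(1)[OF V] by (auto simp: openin_subtopology)
    have FV: "U \<inter> F -` V = U \<inter> F -` T"
      using T(2) assms(4) by blast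
    show o: "openin (mtop N) (U \<inter> F -` V)"
      unfolding FV by (rule smooth_map_openin_vimage[OF assms(1-3) T(1)])
    fix p assume p: "p \<in> U \<inter> F -` V"
    then obtain W g where W: "F p \<in> W" "smooth_fun M W g" "\<And>q. q \<in> W \<inter> V \<Longrightarrow> g q = \<psi> q"
      using submanifold_chartD(4)[OF V, of "F p"] by auto
    let ?W = "(U \<inter> F -` W) \<inter> (U \<inter> F -` V)"
    have g: "smooth_fun N (U \<inter> F -` W) (\<lambda>p. g (F p))"
      by (rule smooth_fun_compose[OF assms(1-3) W(2)])
    have "smooth_fun N ?W (\<lambda>p. g (F p))"
      using smooth_fun_subset[OF g openin_Int[OF smooth_fun_openin[OF g] o]] by blast
    also have "?this \<longleftrightarrow> smooth_fun N ?W (\<lambda>p. \<psi> (F p))"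
      using W(3) by (intro smooth_fun_cong[OF assms(1)]) auto
    finally show "\<exists>W. p \<in> W \<and> smooth_fun N W (\<lambda>p. \<psi> (F p))"
      using p W(1) by (intro exI[of _ ?W]) simp
  qed
  then show ?thesis
    using assms(3,4) unfolding smooth_map_def o_def by auto
qed

text \<open>The function \<open>\<kappa>\<close> is smooth on an open set of \<open>M\<close>, hence
  serves as its own local extension, and \<open>\<rho>\<close> is a smooth parametrisation inverse
  to it on \<open>S\<close>. Smoothness in \<open>M\<close> makes both continuous, which gives the
  homeomorphism.\<close>

lemma submanifold_chartI:
  fixes \<kappa> :: "'m \<Rightarrow> 'f::euclidean_space"
  assumes "smooth_manifold M" "smooth_fun M W \<kappa>" "open T"
    and "smooth_map (open_manifold T) T M \<rho>"
    and \<rho>: "\<And>y. y \<in> T \<Longrightarrow> \<rho> y \<in> W \<inter> S \<and> \<kappa> (\<rho> y) = y"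
    and \<kappa>: "\<And>p. p \<in> W \<inter> S \<Longrightarrow> \<kappa> p \<in> T \<and> \<rho> (\<kappa> p) = p"
  shows "(W \<inter> S, \<kappa>) \<in> atlas (submanifold M S)" "\<kappa> ` (W \<inter> S) = T"
    "\<And>y. y \<in> T \<Longrightarrow> inv_into (W \<inter> S) \<kappa> y = \<rho> y"
proof -
  have TM: "smooth_manifold (open_manifold T)"
    by (rule smooth_manifold_open_manifold[OF assms(3)])
  have W: "openin (mtop M) W" "W \<subseteq> points M"
    using smooth_fun_openin[OF assms(2)] openin_subset by auto
  show img: "\<kappa> ` (W \<inter> S) = T"
  proof
    show "T \<subseteq> \<kappa> ` (W \<inter> S)" using \<rho> by (metis image_eqI subsetI)
  qed (use \<kappa> in auto)
  have inj: "inj_on \<kappa> (W \<inter> S)"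
    using \<kappa> by (metis inj_onI)
  show inv: "inv_into (W \<inter> S) \<kappa> y = \<rho> y" if "y \<in> T" for y
    using inv_into_f_eq[OF inj] \<rho>[OF that] by blast
  have "smooth_map (open_manifold T) T M (inv_into (W \<inter> S) \<kappa>)"
    using smooth_map_cong[OF TM, of T "inv_into (W \<inter> S) \<kappa>" \<rho>] inv assms(4) by auto
  moreover have "homeomorphic_maps (subtopology (mtop M) (W \<inter> S)) (top_of_set T) \<kappa> \<rho>"
  proof -
    have top: "topspace (subtopology (mtop M) (W \<inter> S)) = W \<inter> S"
      using W(2) by auto
    have "openin (subtopology (mtop M) (W \<inter> S)) {x \<in> W \<inter> S. \<kappa> x \<in> A}" if "open A" for A
    proof -
      have "{x \<in> W \<inter> S. \<kappa> x \<in> A} = (W \<inter> \<kappa> -` A) \<inter> (W \<inter> S)" by blast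
      then show ?thesis
        using smooth_fun_openin_vimage[OF assms(1,2) that] by (auto simp: openin_subtopology)
    qed
    then have "continuous_map (subtopology (mtop M) (W \<inter> S)) euclidean \<kappa>"
      unfolding continuous_map_def top by auto
    then have "continuous_map (subtopology (mtop M) (W \<inter> S)) (top_of_set T) \<kappa>"
      using \<kappa> top by (auto simp: continuous_map_in_subtopology)
    moreover have "openin (top_of_set T) {y \<in> T. \<rho> y \<in> A}" if "openin (mtop M) A" for A
    proof -
      have "{y \<in> T. \<rho> y \<in> A} = T \<inter> \<rho> -` A" by blast
      then show ?thesis
        using smooth_map_openin_vimage[OF TM assms(1,4) that] by simp
    qed
    then have "continuous_map (top_of_set T) (mtop M) \<rho>"
      using smooth_map_image[OF assms(4)] unfolding continuous_map_def by auto
    then have "continuous_map (top_of_set T) (subtopology (mtop M) (W \<inter> S)) \<rho>"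
      using \<rho> by (auto simp: continuous_map_in_subtopology)
    ultimately show ?thesis
      using \<rho> \<kappa> top unfolding homeomorphic_maps_def by auto
  qed
  then have "homeomorphic_map (subtopology (mtop M) (W \<inter> S)) (top_of_set T) \<kappa>"
    using homeomorphic_map_maps by blast
  moreover have "openin (subtopology (mtop M) S) (W \<inter> S)"
    using W(1) by (auto simp: openin_subtopology)
  ultimately show "(W \<inter> S, \<kappa>) \<in> atlas (submanifold M S)"
    using assms(2,3) by (auto simp: submanifold_def img)
qed

section \<open>Complex tangent vectors\<close>

text \<open>The operator of \<open>tangent_space\<close> for a direction with complex coefficients:
  \<open>a b\<close> replaces the component \<open>w \<bullet> b\<close>, since a complex direction
  is not an element of \<open>'e\<close>. The guard \<open>smooth_near\<close> is kept, so that
  equality of operators remains equality of vectors.\<close>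

definition chart_vector ::
    "('m, 'e::euclidean_space) manifold \<Rightarrow> 'm set \<Rightarrow> ('m \<Rightarrow> 'e) \<Rightarrow> 'm \<Rightarrow> ('e \<Rightarrow> complex) \<Rightarrow> 'm tvec" where
  "chart_vector M U \<phi> p a = (\<lambda>f. if smooth_near M p f
     then \<Sum>b\<in>Basis. a b * frechet_derivative (f \<circ> inv_into U \<phi>) (at (\<phi> p)) b else 0)"

lemma smooth_nearI: "smooth_fun M W f \<Longrightarrow> p \<in> W \<Longrightarrow> smooth_near M p f"
  unfolding smooth_near_def by blast

lemma smooth_nearE:
  assumes "smooth_near M p f"
  obtains W where "p \<in> W" "smooth_fun M W f"
  using assms unfolding smooth_near_def by blast

lemma smooth_fun_has_derivative_chart:
  assumes "smooth_fun M W f" "p \<in> W" "(U, \<phi>) \<in> atlas M" "p \<in> U"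
  shows "((f \<circ> inv_into U \<phi>) has_derivative frechet_derivative (f \<circ> inv_into U \<phi>) (at (\<phi> p))) (at (\<phi> p))"
  using smooth_fun_chartD[OF assms(1,3)] by (rule smooth_has_derivative) (use assms in auto)

lemma chart_vector_apply:
  "smooth_fun M W f \<Longrightarrow> p \<in> W \<Longrightarrow> chart_vector M U \<phi> p a f =
    (\<Sum>b\<in>Basis. a b * frechet_derivative (f \<circ> inv_into U \<phi>) (at (\<phi> p)) b)"
  using smooth_nearI unfolding chart_vector_def by metis

lemma chart_vector_cong:
  assumes "smooth_manifold M" "(U, \<phi>) \<in> atlas M" "p \<in> U"
    and "smooth_fun M W f" "p \<in> W" "\<And>q. q \<in> W \<Longrightarrow> f q = g q"
  shows "chart_vector M U \<phi> p a f = chart_vector M U \<phi> p a g"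
proof -
  have g: "smooth_fun M W g"
    using smooth_fun_cong[OF assms(1), of W f g] assms(4,6) by simp
  have "frechet_derivative (f \<circ> inv_into U \<phi>) (at (\<phi> p)) = frechet_derivative (g \<circ> inv_into U \<phi>) (at (\<phi> p))"
    using assms(3,5,6) by (intro frechet_derivative_cong_open[OF smooth_fun_open_image[OF assms(1,4,2)]])
      (auto simp: chart_inv[OF assms(1,2)])
  then show ?thesis
    using chart_vector_apply[OF assms(4,5)] chart_vector_apply[OF g assms(5)] by simp
qed

text \<open>The Euclidean chain rule in a basis, with two finite sums exchanged. Change of chart
  (\<open>g\<close> a second chart) and the formula for a pushforward (\<open>g\<close> a chart
  after the map) are both instances.\<close>

lemma chart_vector_chain:
  fixes g :: "'m \<Rightarrow> 'c::euclidean_space"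
  assumes "smooth_manifold M" "(U, \<phi>) \<in> atlas M" "p \<in> U"
    and "smooth_fun M W g" "p \<in> W" "open T" "g ` W \<subseteq> T" "smooth T h"
  shows "chart_vector M U \<phi> p a (\<lambda>q. h (g q)) =
    (\<Sum>c\<in>Basis. chart_vector M U \<phi> p a (\<lambda>q. complex_of_real (g q \<bullet> c)) * frechet_derivative h (at (g p)) c)"
proof -
  let ?G = "frechet_derivative (g \<circ> inv_into U \<phi>) (at (\<phi> p))"
  let ?H = "frechet_derivative h (at (g p))"
  have p: "g (inv_into U \<phi> (\<phi> p)) = g p" by (simp add: chart_inv[OF assms(1-3)])
  have dg: "((\<lambda>y. g (inv_into U \<phi> y)) has_derivative ?G) (at (\<phi> p))"
    using smooth_fun_has_derivative_chart[OF assms(4,5,2,3)] by (simp add: o_def)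
  have dh: "(h has_derivative ?H) (at (g (inv_into U \<phi> (\<phi> p))))"
    unfolding p using assms(5,7) by (intro smooth_has_derivative[OF assms(8)]) auto
  have d1: "frechet_derivative (\<lambda>y. h (g (inv_into U \<phi> y))) (at (\<phi> p)) b =
      (\<Sum>c\<in>Basis. (?G b \<bullet> c) *\<^sub>R ?H c)" for b
  proof -
    have "((\<lambda>y. h (g (inv_into U \<phi> y))) has_derivative (\<lambda>b. ?H (?G b))) (at (\<phi> p))"
      by (rule has_derivative_compose[OF dg dh])
    then have "frechet_derivative (\<lambda>y. h (g (inv_into U \<phi> y))) (at (\<phi> p)) b = ?H (?G b)"
      by (simp only: frechet_derivative_at[symmetric])
    then show ?thesis
      by (simp only: linear_eq_sum_Basis[OF has_derivative_linear[OF dh], symmetric])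
  qed
  have d2: "frechet_derivative (\<lambda>y. complex_of_real (g (inv_into U \<phi> y) \<bullet> c)) (at (\<phi> p)) b =
      complex_of_real (?G b \<bullet> c)" for b c
  proof -
    have "bounded_linear (\<lambda>z. complex_of_real (z \<bullet> c))"
      using bounded_linear_compose[OF bounded_linear_of_real bounded_linear_inner_left] .
    then have "((\<lambda>y. complex_of_real (g (inv_into U \<phi> y) \<bullet> c)) has_derivative
        (\<lambda>b. complex_of_real (?G b \<bullet> c))) (at (\<phi> p))"
      using bounded_linear.has_derivative[OF _ dg] by blast
    then show ?thesis
      by (simp only: frechet_derivative_at[symmetric])
  qed
  have "(\<lambda>q. h (g q)) \<circ> inv_into U \<phi> = (\<lambda>y. h (g (inv_into U \<phi> y)))" by auto
  then have L: "chart_vector M U \<phi> p a (\<lambda>q. h (g q)) =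
      (\<Sum>b\<in>Basis. a b * (\<Sum>c\<in>Basis. complex_of_real (?G b \<bullet> c) * ?H c))"
    by (simp only: chart_vector_apply[OF smooth_fun_compose_smooth[OF assms(1,4,6-8)] assms(5)]
        d1 scaleR_conv_of_real)
  have R: "chart_vector M U \<phi> p a (\<lambda>q. complex_of_real (g q \<bullet> c)) =
      (\<Sum>b\<in>Basis. a b * complex_of_real (?G b \<bullet> c))" for c
  proof -
    have "smooth_fun M W (\<lambda>q. complex_of_real (g q \<bullet> c))"
      using smooth_fun_bounded_linear[OF assms(1) bounded_linear_compose[OF bounded_linear_of_real
          bounded_linear_inner_left] assms(4)] .
    moreover have "(\<lambda>q. complex_of_real (g q \<bullet> c)) \<circ> inv_into U \<phi> =
        (\<lambda>y. complex_of_real (g (inv_into U \<phi> y) \<bullet> c))" by auto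
    ultimately show ?thesis
      using assms(5) by (simp only: chart_vector_apply[of M W] d2)
  qed
  show ?thesis
    unfolding L R sum_distrib_left sum_distrib_right mult.assoc by (rule sum.swap)
qed

text \<open>Near \<open>p\<close> the function \<open>f\<close> is its expression in
  \<open>\<psi>\<close> after \<open>\<psi>\<close>, so the chain rule yields coefficients that are
  the values on the coordinates of \<open>\<psi>\<close>. Where \<open>f\<close> is not smooth near
  \<open>p\<close>, both guards give \<open>0\<close>.\<close>

lemma chart_vector_change:
  assumes "smooth_manifold M" "(U, \<phi>) \<in> atlas M" "p \<in> U" "(V, \<psi>) \<in> atlas M" "p \<in> V"
  shows "chart_vector M U \<phi> p a =
    chart_vector M V \<psi> p (\<lambda>b. chart_vector M U \<phi> p a (\<lambda>q. complex_of_real (\<psi> q \<bullet> b)))"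
proof
  fix f
  show "chart_vector M U \<phi> p a f =
    chart_vector M V \<psi> p (\<lambda>b. chart_vector M U \<phi> p a (\<lambda>q. complex_of_real (\<psi> q \<bullet> b))) f"
  proof (cases "smooth_near M p f")
    case False
    then show ?thesis by (simp add: chart_vector_def)
  next
    case True
    then obtain W where W: "p \<in> W" "smooth_fun M W f" by (rule smooth_nearE)
    have o: "openin (mtop M) (W \<inter> V)"
      using smooth_fun_openin[OF W(2)] chart_openin[OF assms(1,4)] by (rule openin_Int)
    have f: "smooth_fun M (W \<inter> V) f"
      using smooth_fun_subset[OF W(2) o] by simp
    have \<psi>: "smooth_fun M (W \<inter> V) \<psi>"
      using smooth_fun_subset[OF chart_smooth_fun[OF assms(1,4)] o] by simp
    have "chart_vector M U \<phi> p a f = chart_vector M U \<phi> p a (\<lambda>q. (f \<circ> inv_into V \<psi>) (\<psi> q))"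
      using W(1) assms(5)
      by (intro chart_vector_cong[OF assms(1-3) f]) (auto simp: chart_inv[OF assms(1,4)])
    also have "\<dots> = (\<Sum>c\<in>Basis. chart_vector M U \<phi> p a (\<lambda>q. complex_of_real (\<psi> q \<bullet> c)) *
        frechet_derivative (f \<circ> inv_into V \<psi>) (at (\<psi> p)) c)"
      using W(1) assms(5)
      by (intro chart_vector_chain[OF assms(1-3) \<psi> _ smooth_fun_open_image[OF assms(1) W(2) assms(4)]
            _ smooth_fun_chartD[OF W(2) assms(4)]]) auto
    finally show ?thesis
      by (simp add: chart_vector_apply[OF W(2,1)])
  qed
qed

lemma chart_vector_coefficients:
  "(\<And>b. b \<in> Basis \<Longrightarrow> a b = a' b) \<Longrightarrow> chart_vector M U \<phi> p a = chart_vector M U \<phi> p a'"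
  unfolding chart_vector_def by (intro ext) (simp cong: sum.cong)

lemma chart_vector_add:
  "(\<lambda>f. chart_vector M U \<phi> p a f + chart_vector M U \<phi> p a' f) = chart_vector M U \<phi> p (\<lambda>b. a b + a' b)"
  by (auto simp: chart_vector_def distrib_right sum.distrib)

lemma chart_vector_scale:
  "(\<lambda>f. c * chart_vector M U \<phi> p a f) = chart_vector M U \<phi> p (\<lambda>b. c * a b)"
  by (auto simp: chart_vector_def sum_distrib_left mult.assoc)

lemma chart_vector_combine:
  "(\<lambda>f. chart_vector M U \<phi> p a f + c * chart_vector M U \<phi> p a' f) =
    chart_vector M U \<phi> p (\<lambda>b. a b + c * a' b)"
  unfolding chart_vector_scale[of c M U \<phi> p a', symmetric] chart_vector_add[symmetric] by simp

lemma chart_vector_zero: "chart_vector M U \<phi> p (\<lambda>b. 0) = (\<lambda>f. 0)"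
  by (auto simp: chart_vector_def)

lemma chart_vector_real:
  assumes "(U, \<phi>) \<in> atlas M" "p \<in> U"
  shows "(\<lambda>f. if smooth_near M p f then frechet_derivative (f \<circ> inv_into U \<phi>) (at (\<phi> p)) w else 0) =
    chart_vector M U \<phi> p (\<lambda>b. complex_of_real (w \<bullet> b))"
proof
  fix f
  show "(if smooth_near M p f then frechet_derivative (f \<circ> inv_into U \<phi>) (at (\<phi> p)) w else 0) =
    chart_vector M U \<phi> p (\<lambda>b. complex_of_real (w \<bullet> b)) f"
  proof (cases "smooth_near M p f")
    case True
    then obtain W where W: "p \<in> W" "smooth_fun M W f" by (rule smooth_nearE)
    then have "linear (frechet_derivative (f \<circ> inv_into U \<phi>) (at (\<phi> p)))"
      using smooth_fun_has_derivative_chart[OF W(2,1) assms] has_derivative_linear by blast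
    from linear_eq_sum_Basis[OF this, of w] show ?thesis
      using True by (simp add: chart_vector_def scaleR_conv_of_real)
  qed (simp add: chart_vector_def)
qed

lemma tangent_space_eq:
  "tangent_space M p =
    {chart_vector M U \<phi> p (\<lambda>b. complex_of_real (w \<bullet> b)) |U \<phi> w. (U, \<phi>) \<in> atlas M \<and> p \<in> U}"
  unfolding tangent_space_def using chart_vector_real by (fastforce intro!: Collect_cong)

text \<open>The definition lets the real and the imaginary part come from different charts; change
  of chart brings both into the given one. Conversely the real and imaginary parts of the
  coefficients are two real vectors. Every later computation can thus choose its own chart.\<close>

lemma complex_tangent_space_eq:
  fixes M :: "('m, 'e::euclidean_space) manifold"
  assumes "smooth_manifold M" "(U, \<phi>) \<in> atlas M" "p \<in> U"
  shows "complex_tangent_space M p = range (chart_vector M U \<phi> p)"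
proof
  have real: "\<exists>a. v = chart_vector M U \<phi> p a" if "v \<in> tangent_space M p" for v
    using that chart_vector_change[OF assms(1) _ _ assms(2,3)] unfolding tangent_space_eq by blast
  show "complex_tangent_space M p \<subseteq> range (chart_vector M U \<phi> p)"
  proof
    fix x assume "x \<in> complex_tangent_space M p"
    then obtain u v where "x = (\<lambda>f. u f + \<i> * v f)" "u \<in> tangent_space M p" "v \<in> tangent_space M p"
      unfolding complex_tangent_space_def by blast
    moreover then obtain a a' where "u = chart_vector M U \<phi> p a" "v = chart_vector M U \<phi> p a'"
      using real by blast
    ultimately show "x \<in> range (chart_vector M U \<phi> p)"
      by (simp only: chart_vector_combine rangeI)
  qed
  show "range (chart_vector M U \<phi> p) \<subseteq> complex_tangent_space M p"
  proof clarify
    fix a :: "'e \<Rightarrow> complex"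
    \<comment> \<open>The real and imaginary parts of the coefficient family, as directions in the
      model space.\<close>
    define u where "u = (\<Sum>b\<in>Basis. Re (a b) *\<^sub>R b)"
    define v where "v = (\<Sum>b\<in>Basis. Im (a b) *\<^sub>R b)"
    have "chart_vector M U \<phi> p a =
        (\<lambda>f. chart_vector M U \<phi> p (\<lambda>b. complex_of_real (u \<bullet> b)) f +
          \<i> * chart_vector M U \<phi> p (\<lambda>b. complex_of_real (v \<bullet> b)) f)"
      unfolding chart_vector_combine
      by (rule chart_vector_coefficients) (simp add: u_def v_def complex_eq)
    moreover have "chart_vector M U \<phi> p (\<lambda>b. complex_of_real (w \<bullet> b)) \<in> tangent_space M p" for w
      unfolding tangent_space_eq using assms(2,3) by blast
    ultimately show "chart_vector M U \<phi> p a \<in> complex_tangent_space M p"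
      unfolding complex_tangent_space_def by blast
  qed
qed

lemma tangent_space_subset:
  assumes "smooth_manifold M"
  shows "tangent_space M p \<subseteq> complex_tangent_space M p"
proof
  fix v assume "v \<in> tangent_space M p"
  then obtain U \<phi> w where "(U, \<phi>) \<in> atlas M" "p \<in> U"
    "v = chart_vector M U \<phi> p (\<lambda>b. complex_of_real (w \<bullet> b))"
    unfolding tangent_space_eq by blast
  then show "v \<in> complex_tangent_space M p"
    using complex_tangent_space_eq[OF assms] by blast
qed

lemma complex_tangent_chart:
  assumes "smooth_manifold M" "p \<in> points M" "v \<in> complex_tangent_space M p"
  obtains U \<phi> a where "(U, \<phi>) \<in> atlas M" "p \<in> U" "v = chart_vector M U \<phi> p a"
proof -
  obtain U \<phi> where U: "(U, \<phi>) \<in> atlas M" "p \<in> U"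
    using chart_cover[OF assms(1,2)] .
  then show thesis
    using complex_tangent_space_eq[OF assms(1) U] assms(3) that by blast
qed

lemma complex_tangent_add:
  assumes "smooth_manifold M" "p \<in> points M" "u \<in> complex_tangent_space M p" "v \<in> complex_tangent_space M p"
  shows "(\<lambda>f. u f + v f) \<in> complex_tangent_space M p"
proof -
  obtain U \<phi> where U: "(U, \<phi>) \<in> atlas M" "p \<in> U"
    using chart_cover[OF assms(1,2)] .
  obtain a a' where "u = chart_vector M U \<phi> p a" "v = chart_vector M U \<phi> p a'"
    using assms(3,4) unfolding complex_tangent_space_eq[OF assms(1) U] by blast
  then show ?thesis
    by (simp add: chart_vector_add complex_tangent_space_eq[OF assms(1) U])
qed

lemma complex_tangent_scale:
  assumes "smooth_manifold M" "p \<in> points M" "v \<in> complex_tangent_space M p"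
  shows "(\<lambda>f. c * v f) \<in> complex_tangent_space M p"
proof -
  obtain U \<phi> a where U: "(U, \<phi>) \<in> atlas M" "p \<in> U" "v = chart_vector M U \<phi> p a"
    using complex_tangent_chart[OF assms] .
  show ?thesis
    unfolding U(3) chart_vector_scale complex_tangent_space_eq[OF assms(1) U(1,2)] by (rule rangeI)
qed

lemma complex_tangent_zero:
  assumes "smooth_manifold M" "p \<in> points M"
  shows "(\<lambda>f. 0) \<in> complex_tangent_space M p"
proof -
  obtain U \<phi> where U: "(U, \<phi>) \<in> atlas M" "p \<in> U"
    using chart_cover[OF assms] .
  show ?thesis
    unfolding chart_vector_zero[of M U \<phi> p, symmetric] complex_tangent_space_eq[OF assms(1) U]
    by (rule rangeI)
qed

lemma complex_tangent_not_smooth: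
  assumes "smooth_manifold M" "p \<in> points M" "v \<in> complex_tangent_space M p" "\<not> smooth_near M p f"
  shows "v f = 0"
proof -
  obtain U \<phi> a where "v = chart_vector M U \<phi> p a"
    using complex_tangent_chart[OF assms(1-3)] .
  then show ?thesis using assms(4) by (simp add: chart_vector_def)
qed

text \<open>A tangent vector sees only the germ at \<open>p\<close>; smoothness of \<open>g\<close>
  is inherited from \<open>f\<close>, so both pass the guard.\<close>

lemma complex_tangent_cong:
  assumes "smooth_manifold M" "p \<in> points M" "v \<in> complex_tangent_space M p"
    and "smooth_fun M W f" "p \<in> W" "\<And>q. q \<in> W \<Longrightarrow> f q = g q"
  shows "v f = v g"
proof -
  obtain U \<phi> a where "(U, \<phi>) \<in> atlas M" "p \<in> U" "v = chart_vector M U \<phi> p a"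
    using complex_tangent_chart[OF assms(1-3)] .
  then show ?thesis
    using chart_vector_cong[OF assms(1) _ _ assms(4-6)] by simp
qed

lemma complex_tangent_const:
  assumes "smooth_manifold M" "p \<in> points M" "v \<in> complex_tangent_space M p"
  shows "v (\<lambda>q. c) = 0"
proof -
  obtain U \<phi> a where "v = chart_vector M U \<phi> p a"
    using complex_tangent_chart[OF assms] .
  then show ?thesis by (simp add: chart_vector_def o_def)
qed

lemma complex_tangent_mult:
  assumes "smooth_manifold M" "p \<in> points M" "v \<in> complex_tangent_space M p"
    and "smooth_fun M W f" "smooth_fun M W g" "p \<in> W"
  shows "v (\<lambda>q. f q * g q) = v f * g p + f p * v g"
proof -
  obtain U \<phi> a where U: "(U, \<phi>) \<in> atlas M" "p \<in> U" and v: "v = chart_vector M U \<phi> p a"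
    using complex_tangent_chart[OF assms(1-3)] .
  let ?f = "f \<circ> inv_into U \<phi>" and ?g = "g \<circ> inv_into U \<phi>"
  have p: "?f (\<phi> p) = f p" "?g (\<phi> p) = g p"
    by (simp_all add: chart_inv[OF assms(1) U])
  have "((\<lambda>y. ?f y * ?g y) has_derivative (\<lambda>w. ?f (\<phi> p) * frechet_derivative ?g (at (\<phi> p)) w +
      frechet_derivative ?f (at (\<phi> p)) w * ?g (\<phi> p))) (at (\<phi> p))"
    by (rule has_derivative_mult[OF smooth_fun_has_derivative_chart[OF assms(4,6) U]
          smooth_fun_has_derivative_chart[OF assms(5,6) U]])
  then have "frechet_derivative (\<lambda>y. ?f y * ?g y) (at (\<phi> p)) = (\<lambda>w. f p * frechet_derivative ?g (at (\<phi> p)) w +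
      frechet_derivative ?f (at (\<phi> p)) w * g p)"
    unfolding p by (rule frechet_derivative_at[symmetric])
  moreover have "(\<lambda>q. f q * g q) \<circ> inv_into U \<phi> = (\<lambda>y. ?f y * ?g y)" by auto
  moreover have "smooth_fun M W (\<lambda>q. f q * g q)"
    by (rule smooth_fun_mult[OF assms(1,4,5)])
  ultimately show ?thesis
    unfolding v chart_vector_apply[OF assms(4,6)] chart_vector_apply[OF assms(5,6)]
    using assms(6)
    by (simp add: chart_vector_apply[of M W] sum.distrib sum_distrib_left sum_distrib_right algebra_simps)
qed

text \<open>Change of chart from a chart to itself identifies the coefficients with the values on
  the coordinate functions.\<close>

lemma complex_tangent_expand:
  assumes "smooth_manifold M" "v \<in> complex_tangent_space M p" "(U, \<phi>) \<in> atlas M" "p \<in> U"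
  shows "v = chart_vector M U \<phi> p (\<lambda>b. v (\<lambda>q. complex_of_real (\<phi> q \<bullet> b)))"
proof -
  obtain a where "v = chart_vector M U \<phi> p a"
    using assms(2) complex_tangent_space_eq[OF assms(1,3,4)] by blast
  then show ?thesis
    using chart_vector_change[OF assms(1,3,4,3,4)] by simp
qed

lemma complex_tangent_eqI:
  assumes "smooth_manifold M" "u \<in> complex_tangent_space M p" "v \<in> complex_tangent_space M p"
    and "(U, \<phi>) \<in> atlas M" "p \<in> U"
    and "\<And>b. b \<in> Basis \<Longrightarrow> u (\<lambda>q. complex_of_real (\<phi> q \<bullet> b)) = v (\<lambda>q. complex_of_real (\<phi> q \<bullet> b))"
  shows "u = v"
proof -
  have "u = chart_vector M U \<phi> p (\<lambda>b. u (\<lambda>q. complex_of_real (\<phi> q \<bullet> b)))"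
    by (rule complex_tangent_expand[OF assms(1,2,4,5)])
  also have "\<dots> = chart_vector M U \<phi> p (\<lambda>b. v (\<lambda>q. complex_of_real (\<phi> q \<bullet> b)))"
    by (rule chart_vector_coefficients) (rule assms(6))
  also have "\<dots> = v"
    by (rule complex_tangent_expand[OF assms(1,3,4,5), symmetric])
  finally show ?thesis .
qed

section \<open>Pushforward and velocity\<close>

lemma pushforward_apply:
  "smooth_near N (F p) g \<Longrightarrow> pushforward N F p v g = v (\<lambda>q. g (F q))"
  by (simp add: pushforward_def o_def)

text \<open>The chain rule with \<open>\<psi>\<close> after \<open>F\<close> as the inner map. It
  shows at once that the pushforward is a tangent vector of \<open>N\<close>.\<close>

lemma pushforward_expand:
  assumes "smooth_manifold M" "smooth_manifold N" "smooth_map M U N F" "p \<in> U"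
    and "v \<in> complex_tangent_space M p" "(V, \<psi>) \<in> atlas N" "F p \<in> V"
  shows "pushforward N F p v = chart_vector N V \<psi> (F p) (\<lambda>b. v (\<lambda>q. complex_of_real (\<psi> (F q) \<bullet> b)))"
proof
  fix g
  have p: "p \<in> points M"
    using openin_subset[OF smooth_map_openin[OF assms(3)]] assms(4) by blast
  obtain A \<phi> a where A: "(A, \<phi>) \<in> atlas M" "p \<in> A" and v: "v = chart_vector M A \<phi> p a"
    using complex_tangent_chart[OF assms(1) p assms(5)] .
  show "pushforward N F p v g =
      chart_vector N V \<psi> (F p) (\<lambda>b. v (\<lambda>q. complex_of_real (\<psi> (F q) \<bullet> b))) g"
  proof (cases "smooth_near N (F p) g")
    case True
    then obtain W where W: "F p \<in> W" "smooth_fun N W g" by (rule smooth_nearE)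
    have o: "openin (mtop N) (W \<inter> V)"
      using smooth_fun_openin[OF W(2)] chart_openin[OF assms(2,6)] by (rule openin_Int)
    let ?W = "U \<inter> F -` (W \<inter> V)"
    have g: "smooth_fun M ?W (\<lambda>q. g (F q))"
      by (rule smooth_fun_compose[OF assms(1-3) smooth_fun_subset[OF W(2) o]]) simp
    have \<psi>: "smooth_fun M ?W (\<lambda>q. \<psi> (F q))"
      by (rule smooth_fun_compose[OF assms(1-3) smooth_fun_subset[OF chart_smooth_fun[OF assms(2,6)] o]]) simp
    have "pushforward N F p v g = v (\<lambda>q. g (F q))"
      by (rule pushforward_apply) (rule True)
    also have "\<dots> = v (\<lambda>q. (g \<circ> inv_into V \<psi>) (\<psi> (F q)))"
      using W(1) assms(4,7)
      by (intro complex_tangent_cong[OF assms(1) p assms(5) g]) (auto simp: chart_inv[OF assms(2,6)])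
    also have "\<dots> = (\<Sum>c\<in>Basis. v (\<lambda>q. complex_of_real (\<psi> (F q) \<bullet> c)) *
        frechet_derivative (g \<circ> inv_into V \<psi>) (at (\<psi> (F p))) c)"
      unfolding v using W(1) assms(4,7)
      by (intro chart_vector_chain[OF assms(1) A \<psi> _ smooth_fun_open_image[OF assms(2) W(2) assms(6)]
            _ smooth_fun_chartD[OF W(2) assms(6)]]) auto
    finally show ?thesis
      by (simp add: chart_vector_apply[OF W(2,1)])
  qed (simp add: pushforward_def chart_vector_def)
qed

lemma pushforward_in_tangent:
  assumes "smooth_manifold M" "smooth_manifold N" "smooth_map M U N F" "p \<in> U"
    and "v \<in> complex_tangent_space M p"
  shows "pushforward N F p v \<in> complex_tangent_space N (F p)"
proof -
  obtain V \<psi> where V: "(V, \<psi>) \<in> atlas N" "F p \<in> V"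
    using chart_cover[OF assms(2) smooth_map_image[OF assms(3,4)]] .
  show ?thesis
    using pushforward_expand[OF assms V] complex_tangent_space_eq[OF assms(2) V] by blast
qed

text \<open>The guards match: if \<open>g\<close> is smooth near \<open>G (F p)\<close>, then
  \<open>g\<close> after \<open>G\<close> is smooth near \<open>F p\<close>; otherwise both sides
  are \<open>0\<close>.\<close>

lemma pushforward_compose:
  assumes "smooth_manifold M" "smooth_manifold N" "smooth_manifold K"
    and "smooth_map M U N F" "p \<in> U" "smooth_map N V K G" "F p \<in> V"
  shows "pushforward K G (F p) (pushforward N F p v) = pushforward K (\<lambda>q. G (F q)) p v"
proof
  fix g
  show "pushforward K G (F p) (pushforward N F p v) g = pushforward K (\<lambda>q. G (F q)) p v g"
  proof (cases "smooth_near K (G (F p)) g")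
    case True
    then obtain W where W: "G (F p) \<in> W" "smooth_fun K W g" by (rule smooth_nearE)
    have "smooth_near N (F p) (\<lambda>q. g (G q))"
      using smooth_fun_compose[OF assms(2,3,6) W(2)] by (rule smooth_nearI) (use W assms in auto)
    then show ?thesis
      using True by (simp add: pushforward_apply)
  qed (simp add: pushforward_def)
qed

lemma pushforward_cong:
  assumes "smooth_manifold M" "smooth_manifold N" "smooth_map M U N F" "p \<in> U"
    and "v \<in> complex_tangent_space M p" "\<And>q. q \<in> U \<Longrightarrow> F q = G q"
  shows "pushforward N F p v = pushforward N G p v"
proof
  fix g
  have p: "p \<in> points M"
    using openin_subset[OF smooth_map_openin[OF assms(3)]] assms(4) by blast
  have Fp: "F p = G p" using assms(4,6) by blast
  show "pushforward N F p v g = pushforward N G p v g"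
  proof (cases "smooth_near N (F p) g")
    case True
    then obtain W where W: "F p \<in> W" "smooth_fun N W g" by (rule smooth_nearE)
    have "v (\<lambda>q. g (F q)) = v (\<lambda>q. g (G q))"
      using W(1) assms(4,6)
      by (intro complex_tangent_cong[OF assms(1) p assms(5) smooth_fun_compose[OF assms(1-3) W(2)]]) auto
    then show ?thesis
      using True Fp by (simp add: pushforward_apply)
  qed (simp add: pushforward_def Fp)
qed

lemma pushforward_ident:
  assumes "smooth_manifold M" "p \<in> points M" "v \<in> complex_tangent_space M p"
  shows "pushforward M (\<lambda>q. q) p v = v"
  using complex_tangent_not_smooth[OF assms] by (auto simp: pushforward_def o_def)

lemma pushforward_const:
  assumes "smooth_manifold M" "p \<in> points M" "v \<in> complex_tangent_space M p"
  shows "pushforward N (\<lambda>q. c) p v = (\<lambda>f. 0)"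
  using complex_tangent_const[OF assms] by (auto simp: pushforward_def o_def)

lemma pushforward_add:
  "pushforward N F p (\<lambda>f. u f + v f) = (\<lambda>g. pushforward N F p u g + pushforward N F p v g)"
  by (auto simp: pushforward_def)

lemma pushforward_scale: "pushforward N F p (\<lambda>f. c * v f) = (\<lambda>g. c * pushforward N F p v g)"
  by (auto simp: pushforward_def)

text \<open>\<open>velocity\<close> is given by a derivative in the parameter. As the pushforward of
  the unit vector of the line, whose single coefficient is \<open>1\<close>, it falls under the
  general facts about tangent vectors.\<close>

lemma velocity_eq_pushforward:
  assumes "smooth_manifold M" "smooth_map (open_manifold UNIV) UNIV M \<gamma>"
  shows "velocity M \<gamma> t = pushforward M \<gamma> t (chart_vector (open_manifold UNIV) UNIV (\<lambda>x. x) t (\<lambda>b. 1))"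
proof
  fix g
  have R: "smooth_manifold (open_manifold (UNIV :: real set))"
    by (rule smooth_manifold_open_manifold) simp
  show "velocity M \<gamma> t g =
      pushforward M \<gamma> t (chart_vector (open_manifold UNIV) UNIV (\<lambda>x. x) t (\<lambda>b. 1)) g"
  proof (cases "smooth_near M (\<gamma> t) g")
    case True
    then obtain W where W: "\<gamma> t \<in> W" "smooth_fun M W g" by (rule smooth_nearE)
    have s: "smooth_fun (open_manifold UNIV) (UNIV \<inter> \<gamma> -` W) (\<lambda>x. g (\<gamma> x))"
      by (rule smooth_fun_compose[OF R assms(1,2) W(2)])
    then have "smooth (\<gamma> -` W) (\<lambda>x. g (\<gamma> x))"
      by (simp add: smooth_fun_open_manifold)
    then have d: "((\<lambda>x. g (\<gamma> x)) has_derivative frechet_derivative (\<lambda>x. g (\<gamma> x)) (at t)) (at t)"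
      using W(1) by (intro smooth_has_derivative[of "\<gamma> -` W"]) auto
    then have "vector_derivative (\<lambda>x. g (\<gamma> x)) (at t) = frechet_derivative (\<lambda>x. g (\<gamma> x)) (at t) 1"
      using frechet_derivative_eq_vector_derivative[OF differentiableI[OF d]] by simp
    moreover have "(\<lambda>x. g (\<gamma> x)) \<circ> inv_into UNIV (\<lambda>x. x) = (\<lambda>x. g (\<gamma> x))"
      by (auto simp: inv_into_ident)
    ultimately show ?thesis
      using True s W(1)
      by (simp add: velocity_def pushforward_apply chart_vector_apply[OF s] o_def)
  qed (simp add: velocity_def pushforward_def)
qed

lemma velocity_in_tangent:
  assumes "smooth_manifold M" "smooth_map (open_manifold UNIV) UNIV M \<gamma>"
  shows "velocity M \<gamma> t \<in> complex_tangent_space M (\<gamma> t)"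
proof -
  have R: "smooth_manifold (open_manifold (UNIV :: real set))"
    by (rule smooth_manifold_open_manifold) simp
  show ?thesis
    unfolding velocity_eq_pushforward[OF assms]
    by (intro pushforward_in_tangent[OF R assms])
      (auto simp: complex_tangent_space_eq[OF R, of UNIV "\<lambda>x. x"])
qed

section \<open>Smooth tensors and Hamiltonian fields\<close>

text \<open>Complex forms: the reality clause of \<open>one_form\<close> is absent, so that
  \<open>differential f\<close> qualifies for every complex \<open>f\<close>.\<close>

definition smooth_linear_form :: "('m, 'e::euclidean_space) manifold \<Rightarrow> 'm form1 \<Rightarrow> bool" where
  "smooth_linear_form M a \<longleftrightarrow>
     (\<forall>p\<in>points M. complex_linear_on (complex_tangent_space M p) (a p)) \<and>
     (\<forall>W \<xi>. vector_field M W \<xi> \<longrightarrow> smooth_fun M W (\<lambda>p. a p (\<xi> p)))"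

text \<open>Linearity is stated for each slot separately because antisymmetry is not
  included.\<close>

definition smooth_bilinear_form :: "('m, 'e::euclidean_space) manifold \<Rightarrow> 'm form2 \<Rightarrow> bool" where
  "smooth_bilinear_form M b \<longleftrightarrow>
     (\<forall>p\<in>points M. \<forall>v\<in>complex_tangent_space M p.
        complex_linear_on (complex_tangent_space M p) (b p v) \<and>
        complex_linear_on (complex_tangent_space M p) (\<lambda>w. b p w v)) \<and>
     (\<forall>W \<xi> \<eta>. vector_field M W \<xi> \<and> vector_field M W \<eta> \<longrightarrow> smooth_fun M W (\<lambda>p. b p (\<xi> p) (\<eta> p)))"

lemma vector_field_openin: "vector_field M W \<xi> \<Longrightarrow> openin (mtop M) W"
  by (simp add: vector_field_def)

lemma vector_field_tangent: "vector_field M W \<xi> \<Longrightarrow> p \<in> W \<Longrightarrow> \<xi> p \<in> complex_tangent_space M p"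
  by (simp add: vector_field_def)

lemma vector_field_smooth: "vector_field M U \<xi> \<Longrightarrow> W \<subseteq> U \<Longrightarrow> smooth_fun M W f \<Longrightarrow> smooth_fun M W (\<lambda>p. \<xi> p f)"
  unfolding vector_field_def by blast

lemma vector_field_subset:
  "vector_field M U \<xi> \<Longrightarrow> openin (mtop M) W \<Longrightarrow> W \<subseteq> U \<Longrightarrow> vector_field M W \<xi>"
  unfolding vector_field_def by (meson subset_iff subset_trans)

lemma openin_points_subset: "openin (mtop M) W \<Longrightarrow> p \<in> W \<Longrightarrow> p \<in> points M"
  using openin_subset by blast

lemma complex_linear_on_add:
  "complex_linear_on T h \<Longrightarrow> u \<in> T \<Longrightarrow> v \<in> T \<Longrightarrow> h (\<lambda>f. u f + v f) = h u + h v"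
  unfolding complex_linear_on_def by blast

lemma complex_linear_on_scale:
  "complex_linear_on T h \<Longrightarrow> v \<in> T \<Longrightarrow> h (\<lambda>f. c * v f) = c * h v"
  unfolding complex_linear_on_def by blast

lemma complex_linear_on_zero:
  assumes "complex_linear_on T h" "(\<lambda>f. 0) \<in> T"
  shows "h (\<lambda>f. 0) = 0"
  using complex_linear_on_scale[OF assms, of 0] by simp

text \<open>Applied to a function, the field is a sum of smooth coefficients times partial
  derivatives, and the latter are smooth in the same chart.\<close>

lemma vector_field_chart:
  assumes "smooth_manifold M" "(U, \<phi>) \<in> atlas M" "openin (mtop M) W" "W \<subseteq> U"
    and "\<And>b. b \<in> Basis \<Longrightarrow> smooth_fun M W (a b)"
  shows "vector_field M W (\<lambda>p. chart_vector M U \<phi> p (\<lambda>b. a b p))"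
proof -
  have "smooth_fun M W' (\<lambda>p. chart_vector M U \<phi> p (\<lambda>b. a b p) f)"
    if W': "W' \<subseteq> W" and f: "smooth_fun M W' f" for W' f
  proof -
    have WU: "W' \<inter> U = W'" "W' \<subseteq> U" using W' assms(4) by auto
    note o = smooth_fun_openin[OF f]
    have "smooth_fun M W' (\<lambda>p. frechet_derivative (f \<circ> inv_into U \<phi>) (at (\<phi> p)) b)" for b
      using smooth_frechet_derivative[OF smooth_fun_chartD[OF f assms(2)], unfolded WU(1)]
      by (intro smooth_fun_in_chart[OF assms(1,2) o WU(2),
            where h = "\<lambda>y. frechet_derivative (f \<circ> inv_into U \<phi>) (at y) b"]) simp_all
    then have "smooth_fun M W' (\<lambda>p. \<Sum>b\<in>Basis. a b p * frechet_derivative (f \<circ> inv_into U \<phi>) (at (\<phi> p)) b)"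
      using smooth_fun_subset[OF assms(5) o W']
      by (intro smooth_fun_sum[OF assms(1) o] smooth_fun_mult[OF assms(1)]) auto
    also have "?this \<longleftrightarrow> ?thesis"
      by (rule smooth_fun_cong[OF assms(1)]) (simp add: chart_vector_apply[OF f])
    finally show ?thesis .
  qed
  moreover have "chart_vector M U \<phi> p (\<lambda>b. a b p) \<in> complex_tangent_space M p" if "p \<in> W" for p
    using complex_tangent_space_eq[OF assms(1,2), of p] that assms(4) by blast
  ultimately show ?thesis
    unfolding vector_field_def using assms(3) by auto
qed

text \<open>The partial derivative in the basis direction \<open>b\<close>. These fields are smooth
  on the whole chart domain, and the smoothness clauses of forms are put to use on them.\<close>

definition coordinate_vector ::
    "('m, 'e::euclidean_space) manifold \<Rightarrow> 'm set \<Rightarrow> ('m \<Rightarrow> 'e) \<Rightarrow> 'e \<Rightarrow> 'm \<Rightarrow> 'm tvec" where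
  "coordinate_vector M U \<phi> b p = chart_vector M U \<phi> p (\<lambda>c. if c = b then 1 else 0)"

lemma coordinate_vector_tangent:
  "smooth_manifold M \<Longrightarrow> (U, \<phi>) \<in> atlas M \<Longrightarrow> p \<in> U \<Longrightarrow>
    coordinate_vector M U \<phi> b p \<in> complex_tangent_space M p"
  by (simp add: coordinate_vector_def complex_tangent_space_eq)

lemma vector_field_coordinate:
  assumes "smooth_manifold M" "(U, \<phi>) \<in> atlas M"
  shows "vector_field M U (coordinate_vector M U \<phi> b)"
proof -
  note o = chart_openin[OF assms]
  have "vector_field M U (\<lambda>p. chart_vector M U \<phi> p (\<lambda>c. if c = b then 1 else 0))"
    by (rule vector_field_chart[OF assms o]) (simp_all add: smooth_fun_const[OF o])
  then show ?thesis
    unfolding coordinate_vector_def[abs_def] .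
qed

text \<open>\<open>complex_linear_on\<close> speaks of two summands only, so the expansion is an
  induction over finite sets of basis directions, with all other coefficients set to
  \<open>0\<close>.\<close>

lemma complex_linear_on_chart_vector:
  fixes M :: "('m, 'e::euclidean_space) manifold"
  assumes "smooth_manifold M" "(U, \<phi>) \<in> atlas M" "p \<in> U"
    and "complex_linear_on (complex_tangent_space M p) h"
  shows "h (chart_vector M U \<phi> p a) = (\<Sum>b\<in>Basis. a b * h (coordinate_vector M U \<phi> b p))"
proof -
  have p: "p \<in> points M" using chart_subset[OF assms(1,2)] assms(3) by blast
  have CT: "chart_vector M U \<phi> p a \<in> complex_tangent_space M p" for a
    unfolding complex_tangent_space_eq[OF assms(1-3)] by (rule rangeI)
  have "h (chart_vector M U \<phi> p (\<lambda>c. if c \<in> I then a c else 0)) =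
      (\<Sum>b\<in>I. a b * h (coordinate_vector M U \<phi> b p))" if "finite I" for I :: "'e set"
    using that
  proof (induction I)
    case empty
    then show ?case
      using complex_linear_on_zero[OF assms(4) complex_tangent_zero[OF assms(1) p]]
      by (simp add: chart_vector_zero)
  next
    case (insert b I)
    have "(\<lambda>c. if c \<in> insert b I then a c else 0) =
        (\<lambda>c. (if c \<in> I then a c else 0) + a b * (if c = b then 1 else 0))"
      using insert.hyps(2) by auto
    then have "h (chart_vector M U \<phi> p (\<lambda>c. if c \<in> insert b I then a c else 0)) =
        h (\<lambda>f. chart_vector M U \<phi> p (\<lambda>c. if c \<in> I then a c else 0) f + a b * coordinate_vector M U \<phi> b p f)"
      by (simp only: coordinate_vector_def chart_vector_combine)
    also have "\<dots> = h (chart_vector M U \<phi> p (\<lambda>c. if c \<in> I then a c else 0)) +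
        a b * h (coordinate_vector M U \<phi> b p)"
      unfolding complex_linear_on_add[OF assms(4) CT
          complex_tangent_scale[OF assms(1) p coordinate_vector_tangent[OF assms(1-3)]]]
        complex_linear_on_scale[OF assms(4) coordinate_vector_tangent[OF assms(1-3)]] by (rule refl)
    finally show ?case
      using insert by simp
  qed
  from this[of Basis] show ?thesis
    by (simp add: chart_vector_coefficients[of "\<lambda>c. if c \<in> Basis then a c else 0" a])
qed

lemma chart_vector_coordinate:
  assumes "smooth_manifold M" "(U, \<phi>) \<in> atlas M" "p \<in> U" "b \<in> Basis"
  shows "chart_vector M U \<phi> p a (\<lambda>q. complex_of_real (\<phi> q \<bullet> b)) = a b"
proof -
  have bl: "bounded_linear (\<lambda>y. complex_of_real (y \<bullet> b))"
    using bounded_linear_compose[OF bounded_linear_of_real bounded_linear_inner_left] .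
  have s: "smooth_fun M U (\<lambda>q. complex_of_real (\<phi> q \<bullet> b))"
    by (rule smooth_fun_bounded_linear[OF assms(1) bl chart_smooth_fun[OF assms(1,2)]])
  have "frechet_derivative ((\<lambda>q. complex_of_real (\<phi> q \<bullet> b)) \<circ> inv_into U \<phi>) (at (\<phi> p)) =
      frechet_derivative (\<lambda>y. complex_of_real (y \<bullet> b)) (at (\<phi> p))"
    using assms(3) by (intro frechet_derivative_cong_open[OF chart_image_open[OF assms(1,2)]])
      (auto simp: f_inv_into_f)
  also have "\<dots> = (\<lambda>y. complex_of_real (y \<bullet> b))"
    by (rule frechet_derivative_at[symmetric, OF bounded_linear_imp_has_derivative[OF bl]])
  finally show ?thesis
    using assms(4)
    by (simp add: chart_vector_apply[OF s assms(3)] inner_Basis if_distrib[of complex_of_real]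
        if_distrib[of "\<lambda>x. _ * x"] cong: if_cong)
qed

lemma smooth_linear_form_differential:
  assumes "smooth_fun M (points M) f"
  shows "smooth_linear_form M (differential f)"
proof -
  have "smooth_fun M W (\<lambda>p. \<xi> p f)" if "vector_field M W \<xi>" for W \<xi>
    using vector_field_openin[OF that] openin_subset
    by (intro vector_field_smooth[OF that] smooth_fun_subset[OF assms]) auto
  then show ?thesis
    by (simp add: smooth_linear_form_def differential_def complex_linear_on_def)
qed

lemma one_form_smooth_linear_form:
  "one_form M (points M) a \<Longrightarrow> smooth_linear_form M a"
  unfolding one_form_def smooth_linear_form_def using openin_subset vector_field_openin by metis

text \<open>Linearity in the first slot is linearity in the second, carried over by
  antisymmetry.\<close>

lemma two_form_smooth_bilinear_form:
  assumes "two_form M (points M) b" "smooth_manifold M"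
  shows "smooth_bilinear_form M b"
proof -
  have "complex_linear_on (complex_tangent_space M p) (\<lambda>w. b p w v)"
    if p: "p \<in> points M" and v: "v \<in> complex_tangent_space M p" for p v
  proof -
    have lin: "complex_linear_on (complex_tangent_space M p) (b p v)"
      and anti: "\<And>w. w \<in> complex_tangent_space M p \<Longrightarrow> b p w v = - b p v w"
      using assms(1) p v unfolding two_form_def by blast+
    show ?thesis
      unfolding complex_linear_on_def
      using complex_tangent_add[OF assms(2) p] complex_tangent_scale[OF assms(2) p]
      by (auto simp: anti complex_linear_on_add[OF lin] complex_linear_on_scale[OF lin])
  qed
  moreover have "smooth_fun M W (\<lambda>p. b p (\<xi> p) (\<eta> p))"
    if "vector_field M W \<xi>" "vector_field M W \<eta>" for W \<xi> \<eta>
    using assms(1) that openin_subset[OF vector_field_openin[OF that(1)]] unfolding two_form_def by blast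
  ultimately show ?thesis
    using assms(1) unfolding smooth_bilinear_form_def two_form_def by blast
qed

text \<open>
  A field along a map has smooth components in the charts of the target, so a pulled back tensor
  is locally a sum of products of such components with smooth functions composed with the map.
\<close>

lemma pushforward_components:
  assumes "smooth_manifold M" "smooth_manifold N" "smooth_map M (points M) N F"
    and "vector_field M W \<xi>" "(V, \<psi>) \<in> atlas N"
  shows "openin (mtop M) (W \<inter> F -` V)"
    and "smooth_fun M (W \<inter> F -` V) (\<lambda>p. \<xi> p (\<lambda>q. complex_of_real (\<psi> (F q) \<bullet> b)))"
    and "p \<in> W \<inter> F -` V \<Longrightarrow> pushforward N F p (\<xi> p) =
      chart_vector N V \<psi> (F p) (\<lambda>b. \<xi> p (\<lambda>q. complex_of_real (\<psi> (F q) \<bullet> b)))"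
proof -
  note W = vector_field_openin[OF assms(4)]
  have "W \<inter> F -` V = W \<inter> (points M \<inter> F -` V)"
    using openin_subset[OF W] by blast
  then show o: "openin (mtop M) (W \<inter> F -` V)"
    using smooth_map_chart_openin[OF assms(1-3,5)] W by (metis openin_Int)
  have "smooth_fun M (W \<inter> F -` V) (\<lambda>q. \<psi> (F q))"
    using smooth_fun_subset[OF smooth_map_chartD[OF assms(3,5)] o] openin_subset[OF W] by blast
  then have "smooth_fun M (W \<inter> F -` V) (\<lambda>q. complex_of_real (\<psi> (F q) \<bullet> b))"
    using smooth_fun_bounded_linear[OF assms(1) bounded_linear_compose[OF bounded_linear_of_real
          bounded_linear_inner_left]] by blast
  then show "smooth_fun M (W \<inter> F -` V) (\<lambda>p. \<xi> p (\<lambda>q. complex_of_real (\<psi> (F q) \<bullet> b)))"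
    by (rule vector_field_smooth[OF assms(4) Int_lower1])
  show "pushforward N F p (\<xi> p) =
      chart_vector N V \<psi> (F p) (\<lambda>b. \<xi> p (\<lambda>q. complex_of_real (\<psi> (F q) \<bullet> b)))"
    if "p \<in> W \<inter> F -` V"
    using that openin_points_subset[OF W] vector_field_tangent[OF assms(4)]
    by (intro pushforward_expand[OF assms(1-3) _ _ assms(5)]) auto
qed

lemma smooth_linear_form_pullback1:
  assumes "smooth_manifold M" "smooth_manifold N" "smooth_map M (points M) N F" "smooth_linear_form N a"
  shows "smooth_linear_form M (pullback1 N F a)"
proof -
  have lin: "complex_linear_on (complex_tangent_space N q) (a q)" if "q \<in> points N" for q
    using assms(4) that unfolding smooth_linear_form_def by blast
  have "complex_linear_on (complex_tangent_space M p) (pullback1 N F a p)" if p: "p \<in> points M" for p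
    using complex_linear_on_add[OF lin[OF smooth_map_image[OF assms(3) p]]]
      complex_linear_on_scale[OF lin[OF smooth_map_image[OF assms(3) p]]]
      pushforward_in_tangent[OF assms(1-3) p]
    by (simp add: complex_linear_on_def pullback1_def pushforward_add pushforward_scale)
  moreover have "smooth_fun M W (\<lambda>p. pullback1 N F a p (\<xi> p))" if \<xi>: "vector_field M W \<xi>" for W \<xi>
  proof (rule smooth_fun_local[OF assms(1) vector_field_openin[OF \<xi>]])
    fix p assume p: "p \<in> W"
    note Wp = openin_points_subset[OF vector_field_openin[OF \<xi>]]
    obtain V \<psi> where V: "(V, \<psi>) \<in> atlas N" "F p \<in> V"
      using chart_cover[OF assms(2) smooth_map_image[OF assms(3) Wp[OF p]]] .
    let ?W = "W \<inter> F -` V"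
    note c = pushforward_components[OF assms(1-3) \<xi> V(1)]
    \<comment> \<open>The pushed field is not a field on \<open>N\<close>, so the smoothness of
      \<open>a\<close> is applied to the coordinate frame of \<open>\<psi>\<close> and then composed
      with \<open>F\<close>.\<close>
    have "smooth_fun M ?W (\<lambda>q. a (F q) (coordinate_vector N V \<psi> b (F q)))" for b
    proof -
      have "smooth_fun N V (\<lambda>x. a x (coordinate_vector N V \<psi> b x))"
        using assms(4) vector_field_coordinate[OF assms(2) V(1)] unfolding smooth_linear_form_def by blast
      from smooth_fun_compose[OF assms(1-3) this] show ?thesis
        by (rule smooth_fun_subset[OF _ c(1)]) (use Wp in auto)
    qed
    then have "smooth_fun M ?W (\<lambda>q. \<Sum>b\<in>Basis. \<xi> q (\<lambda>q. complex_of_real (\<psi> (F q) \<bullet> b)) *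
        a (F q) (coordinate_vector N V \<psi> b (F q)))"
      by (intro smooth_fun_sum[OF assms(1) c(1)] smooth_fun_mult[OF assms(1) c(2)])
    also have "?this \<longleftrightarrow> smooth_fun M ?W (\<lambda>p. pullback1 N F a p (\<xi> p))"
    proof (rule smooth_fun_cong[OF assms(1)])
      fix q assume q: "q \<in> ?W"
      then have "F q \<in> V" "F q \<in> points N"
        using smooth_map_image[OF assms(3)] Wp by auto
      then show "(\<Sum>b\<in>Basis. \<xi> q (\<lambda>q. complex_of_real (\<psi> (F q) \<bullet> b)) *
          a (F q) (coordinate_vector N V \<psi> b (F q))) = pullback1 N F a q (\<xi> q)"
        unfolding pullback1_def c(3)[OF q]
        by (subst complex_linear_on_chart_vector[OF assms(2) V(1) _ lin]) simp_all
    qed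
    finally show "\<exists>W. p \<in> W \<and> smooth_fun M W (\<lambda>p. pullback1 N F a p (\<xi> p))"
      using p V(2) by (intro exI[of _ ?W]) simp
  qed
  ultimately show ?thesis
    unfolding smooth_linear_form_def by simp
qed

lemma smooth_bilinear_form_pullback2:
  assumes "smooth_manifold M" "smooth_manifold N" "smooth_map M (points M) N F" "smooth_bilinear_form N a"
  shows "smooth_bilinear_form M (pullback2 N F a)"
proof -
  have lin: "complex_linear_on (complex_tangent_space N q) (a q v)"
    "complex_linear_on (complex_tangent_space N q) (\<lambda>w. a q w v)"
    if "q \<in> points N" "v \<in> complex_tangent_space N q" for q v
    using assms(4) that unfolding smooth_bilinear_form_def by blast+
  have "complex_linear_on (complex_tangent_space M p) (pullback2 N F a p v) \<and>
      complex_linear_on (complex_tangent_space M p) (\<lambda>w. pullback2 N F a p w v)"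
    if p: "p \<in> points M" and v: "v \<in> complex_tangent_space M p" for p v
  proof -
    note l = lin[OF smooth_map_image[OF assms(3) p] pushforward_in_tangent[OF assms(1-3) p v]]
    show ?thesis
      using complex_linear_on_add[OF l(1)] complex_linear_on_scale[OF l(1)]
        complex_linear_on_add[OF l(2)] complex_linear_on_scale[OF l(2)]
        pushforward_in_tangent[OF assms(1-3) p]
      by (simp add: complex_linear_on_def pullback2_def pushforward_add pushforward_scale)
  qed
  moreover have "smooth_fun M W (\<lambda>p. pullback2 N F a p (\<xi> p) (\<eta> p))"
    if \<xi>: "vector_field M W \<xi>" and \<eta>: "vector_field M W \<eta>" for W \<xi> \<eta>
  proof (rule smooth_fun_local[OF assms(1) vector_field_openin[OF \<xi>]])
    fix p assume p: "p \<in> W"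
    note Wp = openin_points_subset[OF vector_field_openin[OF \<xi>]]
    obtain V \<psi> where V: "(V, \<psi>) \<in> atlas N" "F p \<in> V"
      using chart_cover[OF assms(2) smooth_map_image[OF assms(3) Wp[OF p]]] .
    let ?W = "W \<inter> F -` V"
    let ?c = "\<lambda>\<xi> b q. \<xi> q (\<lambda>q. complex_of_real (\<psi> (F q) \<bullet> b))"
    let ?a = "\<lambda>b c q. a (F q) (coordinate_vector N V \<psi> b (F q)) (coordinate_vector N V \<psi> c (F q))"
    note c = pushforward_components[OF assms(1-3) \<xi> V(1)]
    note c' = pushforward_components[OF assms(1-3) \<eta> V(1)]
    have "smooth_fun M ?W (?a b c)" for b c
    proof -
      have "smooth_fun N V (\<lambda>x. a x (coordinate_vector N V \<psi> b x) (coordinate_vector N V \<psi> c x))"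
        using assms(4) vector_field_coordinate[OF assms(2) V(1)] unfolding smooth_bilinear_form_def by blast
      from smooth_fun_compose[OF assms(1-3) this] show ?thesis
        by (rule smooth_fun_subset[OF _ c(1)]) (use Wp in auto)
    qed
    then have "smooth_fun M ?W (\<lambda>q. \<Sum>b\<in>Basis. ?c \<eta> b q * (\<Sum>c\<in>Basis. ?c \<xi> c q * ?a c b q))"
      by (intro smooth_fun_sum[OF assms(1) c(1)] smooth_fun_mult[OF assms(1) c(2)]
          smooth_fun_mult[OF assms(1) c'(2)])
    also have "?this \<longleftrightarrow> smooth_fun M ?W (\<lambda>p. pullback2 N F a p (\<xi> p) (\<eta> p))"
    proof (rule smooth_fun_cong[OF assms(1)])
      fix q assume q: "q \<in> ?W"
      then have Fq: "F q \<in> V" "F q \<in> points N"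
        using smooth_map_image[OF assms(3)] Wp by auto
      \<comment> \<open>The second slot is expanded with a pushed vector in the first; then the
        first slot, with a frame vector in the second.\<close>
      have "chart_vector N V \<psi> (F q) x \<in> complex_tangent_space N (F q)" for x
        unfolding complex_tangent_space_eq[OF assms(2) V(1) Fq(1)] by (rule rangeI)
      note l1 = complex_linear_on_chart_vector[OF assms(2) V(1) Fq(1) lin(1)[OF Fq(2) this]]
      note l2 = complex_linear_on_chart_vector[OF assms(2) V(1) Fq(1)
          lin(2)[OF Fq(2) coordinate_vector_tangent[OF assms(2) V(1) Fq(1)]]]
      show "(\<Sum>b\<in>Basis. ?c \<eta> b q * (\<Sum>c\<in>Basis. ?c \<xi> c q * ?a c b q)) =
          pullback2 N F a q (\<xi> q) (\<eta> q)"
        unfolding pullback2_def c(3)[OF q] c'(3)[OF q]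
        by (simp only: l1 l2)
    qed
    finally show "\<exists>W. p \<in> W \<and> smooth_fun M W (\<lambda>p. pullback2 N F a p (\<xi> p) (\<eta> p))"
      using p V(2) by (intro exI[of _ ?W]) simp
  qed
  ultimately show ?thesis
    unfolding smooth_bilinear_form_def by simp
qed

lemma smooth_bilinear_form_wedge:
  assumes "smooth_manifold M" "smooth_linear_form M a" "smooth_linear_form M b"
  shows "smooth_bilinear_form M (wedge a b)"
proof -
  have lin: "complex_linear_on (complex_tangent_space M p) (a p)"
    "complex_linear_on (complex_tangent_space M p) (b p)" if "p \<in> points M" for p
    using assms(2,3) that unfolding smooth_linear_form_def by blast+
  have "complex_linear_on (complex_tangent_space M p) (wedge a b p v) \<and>
      complex_linear_on (complex_tangent_space M p) (\<lambda>w. wedge a b p w v)" if "p \<in> points M" for p v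
    unfolding complex_linear_on_def wedge_def
    by (simp add: complex_linear_on_add[OF lin(1)[OF that]] complex_linear_on_add[OF lin(2)[OF that]]
        complex_linear_on_scale[OF lin(1)[OF that]] complex_linear_on_scale[OF lin(2)[OF that]]
        algebra_simps)
  moreover have "smooth_fun M W (\<lambda>p. wedge a b p (\<xi> p) (\<eta> p))"
    if "vector_field M W \<xi>" "vector_field M W \<eta>" for W \<xi> \<eta>
  proof -
    have "smooth_fun M W (\<lambda>p. a p (\<xi> p))" "smooth_fun M W (\<lambda>p. a p (\<eta> p))"
      "smooth_fun M W (\<lambda>p. b p (\<xi> p))" "smooth_fun M W (\<lambda>p. b p (\<eta> p))"
      using assms(2,3) that unfolding smooth_linear_form_def by auto
    then show ?thesis
      unfolding wedge_def by (intro smooth_fun_diff[OF assms(1)] smooth_fun_mult[OF assms(1)])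
  qed
  ultimately show ?thesis
    unfolding smooth_bilinear_form_def by simp
qed

text \<open>The shape of \<open>induced_form\<close>: \<open>a\<close> is the wedge of
  \<open>dr\<close> and \<open>\<alpha>\<close>, \<open>b\<close> the pulled back
  \<open>\<omega>\<close>, and \<open>r\<close> the radius.\<close>

lemma smooth_bilinear_form_add_mult:
  assumes "smooth_manifold M" "smooth_bilinear_form M a" "smooth_bilinear_form M b"
    and "smooth_fun M (points M) r"
  shows "smooth_bilinear_form M (\<lambda>p v w. a p v w + r p * b p v w)"
proof -
  have lin: "complex_linear_on (complex_tangent_space M p) (a p v)"
    "complex_linear_on (complex_tangent_space M p) (\<lambda>w. a p w v)"
    "complex_linear_on (complex_tangent_space M p) (b p v)"
    "complex_linear_on (complex_tangent_space M p) (\<lambda>w. b p w v)"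
    if "p \<in> points M" "v \<in> complex_tangent_space M p" for p v
    using assms(2,3) that unfolding smooth_bilinear_form_def by blast+
  have "complex_linear_on (complex_tangent_space M p) (\<lambda>w. a p v w + r p * b p v w) \<and>
      complex_linear_on (complex_tangent_space M p) (\<lambda>w. a p w v + r p * b p w v)"
    if "p \<in> points M" "v \<in> complex_tangent_space M p" for p v
    using lin[OF that] unfolding complex_linear_on_def by (simp add: algebra_simps)
  moreover have "smooth_fun M W (\<lambda>p. a p (\<xi> p) (\<eta> p) + r p * b p (\<xi> p) (\<eta> p))"
    if "vector_field M W \<xi>" "vector_field M W \<eta>" for W \<xi> \<eta>
  proof -
    have "smooth_fun M W (\<lambda>p. a p (\<xi> p) (\<eta> p))" "smooth_fun M W (\<lambda>p. b p (\<xi> p) (\<eta> p))"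
      using assms(2,3) that unfolding smooth_bilinear_form_def by auto
    moreover have "smooth_fun M W r"
      using vector_field_openin[OF that(1)] openin_subset by (intro smooth_fun_subset[OF assms(4)]) auto
    ultimately show ?thesis
      by (intro smooth_fun_add[OF assms(1)] smooth_fun_mult[OF assms(1)])
  qed
  ultimately show ?thesis
    unfolding smooth_bilinear_form_def by simp
qed

section \<open>Linear systems with smooth coefficients\<close>

lemma smooth_fun_det:
  fixes A :: "'m \<Rightarrow> complex mat"
  assumes "smooth_manifold M" "openin (mtop M) U" "\<And>p. A p \<in> carrier_mat n n"
    and "\<And>i j. i < n \<Longrightarrow> j < n \<Longrightarrow> smooth_fun M U (\<lambda>p. A p $$ (i, j))"
  shows "smooth_fun M U (\<lambda>p. Determinant.det (A p))"
proof -
  have "smooth_fun M U (\<lambda>p. A p $$ (i, \<pi> i))" if "\<pi> permutes {0..<n}" "i \<in> {0..<n}" for \<pi> i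
    using permutes_in_image[OF that(1), of i] that(2) assms(4) by simp
  then show ?thesis
    unfolding Determinant.det_def'[OF assms(3)]
    by (intro smooth_fun_sum[OF assms(1,2)] smooth_fun_mult[OF assms(1)] smooth_fun_const[OF assms(2)]
        smooth_fun_prod[OF assms(1,2)]) auto
qed

text \<open>Cramer's rule: the solution is the adjugate applied to the right hand side, over the determinant.\<close>

lemma smooth_fun_linear_solve:
  fixes A :: "nat \<Rightarrow> nat \<Rightarrow> 'm \<Rightarrow> complex"
  assumes "smooth_manifold M" "openin (mtop M) U"
    and A: "\<And>i j. i < n \<Longrightarrow> j < n \<Longrightarrow> smooth_fun M U (A i j)"
    and b: "\<And>j. j < n \<Longrightarrow> smooth_fun M U (b j)"
    and nondeg: "\<And>p c i. p \<in> U \<Longrightarrow> (\<And>j. j < n \<Longrightarrow> (\<Sum>i<n. c i * A i j p) = 0) \<Longrightarrow> i < n \<Longrightarrow> c i = 0"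
  shows "\<exists>a. (\<forall>i<n. smooth_fun M U (a i)) \<and> (\<forall>p\<in>U. \<forall>j<n. (\<Sum>i<n. a i p * A i j p) = b j p)"
proof -
  \<comment> \<open>The transpose, so that the unknown coefficients form a column vector on the
    right of \<open>m p\<close>.\<close>
  define m where "m p = Matrix.mat n n (\<lambda>(j, i). A i j p)" for p
  define a where "a i p = (\<Sum>k<n. adj_mat (m p) $$ (i, k) * b k p) / Determinant.det (m p)" for i p
  have m: "m p \<in> carrier_mat n n" for p by (simp add: m_def)
  have dims: "dim_row (m p) = n" "dim_col (m p) = n" for p by (simp_all add: m_def)
  have m_index: "m p $$ (j, i) = A i j p" if "i < n" "j < n" for p i j
    using that by (simp add: m_def)
  \<comment> \<open>A nonzero kernel vector of \<open>m p\<close> would be a nonzero solution of the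
    homogeneous system, against \<open>nondeg\<close>.\<close>
  have det: "Determinant.det (m p) \<noteq> 0" if p: "p \<in> U" for p
  proof
    assume "Determinant.det (m p) = 0"
    then obtain v where v: "v \<in> carrier_vec n" "v \<noteq> 0\<^sub>v n" "m p *\<^sub>v v = 0\<^sub>v n"
      using det_0_iff_vec_prod_zero_field[OF m] by blast
    have "(\<Sum>i<n. vec_index v i * A i j p) = 0" if j: "j < n" for j
    proof -
      have "vec_index (m p *\<^sub>v v) j = (\<Sum>i<n. A i j p * vec_index v i)"
        using j v(1) by (simp add: m_def scalar_prod_def atLeast0LessThan)
      then show ?thesis using v(3) j by (simp add: mult.commute)
    qed
    then have "vec_index v i = 0" if "i < n" for i
      using nondeg[OF p, of "\<lambda>i. vec_index v i"] that by blast
    then have "v = 0\<^sub>v n"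
      using v(1) by (intro eq_vecI) auto
    then show False using v(2) by simp
  qed
  have sm: "smooth_fun M U (\<lambda>p. m p $$ (i, j))" if "i < n" "j < n" for i j
    using A[OF that(2,1)] that by (simp add: m_index)
  have sdet: "smooth_fun M U (\<lambda>p. Determinant.det (m p))"
    by (rule smooth_fun_det[OF assms(1,2) m sm])
  have sadj: "smooth_fun M U (\<lambda>p. adj_mat (m p) $$ (i, k))" if "i < n" "k < n" for i k
  proof -
    \<comment> \<open>The entries of a minor are entries of \<open>m p\<close>, with indices shifted
      past the deleted row \<open>k\<close> and column \<open>i\<close>.\<close>
    have "smooth_fun M U (\<lambda>p. mat_delete (m p) k i $$ (i', j'))" if "i' < n - 1" "j' < n - 1" for i' j'
    proof -
      have "mat_delete (m p) k i $$ (i', j') =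
          m p $$ (if i' < k then i' else Suc i', if j' < i then j' else Suc j')" for p
        using that by (simp add: mat_delete_def dims)
      moreover have "smooth_fun M U (\<lambda>p. m p $$ (if i' < k then i' else Suc i', if j' < i then j' else Suc j'))"
        using that by (intro sm) auto
      ultimately show ?thesis by simp
    qed
    then have "smooth_fun M U (\<lambda>p. Determinant.det (mat_delete (m p) k i))"
      using m by (intro smooth_fun_det[OF assms(1,2), of _ "n - 1"] mat_delete_carrier) auto
    then show ?thesis
      using that
      by (simp add: adj_mat_def cofactor_def dims smooth_fun_mult[OF assms(1)] smooth_fun_const[OF assms(2)])
  qed
  show ?thesis
  proof (intro exI[of _ a] conjI allI ballI impI)
    show "smooth_fun M U (a i)" if "i < n" for i
      unfolding a_def[abs_def] using sadj[OF that] b det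
      by (intro smooth_fun_divide[OF assms(1) _ sdet] smooth_fun_sum[OF assms(1,2)]
          smooth_fun_mult[OF assms(1)]) auto
    show "(\<Sum>i<n. a i p * A i j p) = b j p" if p: "p \<in> U" and j: "j < n" for p j
    proof -
      \<comment> \<open>Row \<open>j\<close> of the identity that \<open>m p\<close> times its
        adjugate is the determinant times the unit matrix.\<close>
      have *: "(\<Sum>i<n. A i j p * adj_mat (m p) $$ (i, k)) = (if j = k then Determinant.det (m p) else 0)"
        if k: "k < n" for k
      proof -
        have "(m p * adj_mat (m p)) $$ (j, k) = (\<Sum>i<n. A i j p * adj_mat (m p) $$ (i, k))"
          using j k carrier_matD[OF adj_mat(1)[OF m[of p]]]
          by (simp add: times_mat_def scalar_prod_def atLeast0LessThan dims)
            (simp add: m_index dims Matrix.row_def Matrix.col_def)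
        then show ?thesis
          unfolding adj_mat(2)[OF m] using j k by (cases "j = k") simp_all
      qed
      have ad: "a i p * Determinant.det (m p) = (\<Sum>k<n. adj_mat (m p) $$ (i, k) * b k p)" for i
        using det[OF p] by (simp add: a_def)
      \<comment> \<open>The equation is proved after multiplication by the determinant, which clears
        the denominators and is cancelled at the end.\<close>
      have "(\<Sum>i<n. a i p * A i j p) * Determinant.det (m p) =
          (\<Sum>i<n. A i j p * (a i p * Determinant.det (m p)))"
        unfolding sum_distrib_right by (rule sum.cong) (simp_all add: mult.commute mult.left_commute)
      also have "\<dots> = (\<Sum>i<n. \<Sum>k<n. A i j p * adj_mat (m p) $$ (i, k) * b k p)"
        unfolding ad sum_distrib_left mult.assoc by (rule refl)
      also have "\<dots> = (\<Sum>k<n. (\<Sum>i<n. A i j p * adj_mat (m p) $$ (i, k)) * b k p)"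
        unfolding sum_distrib_right by (rule sum.swap)
      also have "\<dots> = (\<Sum>k<n. (if j = k then Determinant.det (m p) else 0) * b k p)"
        using * by simp
      also have "\<dots> = (\<Sum>k<n. if j = k then Determinant.det (m p) * b k p else 0)"
        by (rule sum.cong) auto
      also have "\<dots> = b j p * Determinant.det (m p)"
        using j by simp
      finally show ?thesis using det[OF p] by simp
    qed
  qed
qed

text \<open>In a chart the condition on \<open>\<xi>\<close> is a square linear system for its
  coefficients, with one equation for each frame vector in the second slot. Nondegeneracy at each
  point says that the homogeneous system has only the zero solution, so the smooth solver applies on
  the whole chart domain.\<close>

lemma hamiltonian_field_local:
  fixes M :: "('m, 'e::euclidean_space) manifold"
  assumes "smooth_manifold M" "smooth_bilinear_form M \<Omega>"
    and nondeg: "\<And>p v. p \<in> points M \<Longrightarrow> v \<in> complex_tangent_space M p \<Longrightarrow>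
      (\<And>w. w \<in> complex_tangent_space M p \<Longrightarrow> \<Omega> p v w = 0) \<Longrightarrow> v = (\<lambda>f. 0)"
    and f: "smooth_fun M (points M) f" and p0: "p0 \<in> points M"
  obtains W \<xi> where "p0 \<in> W" "vector_field M W \<xi>"
    "\<forall>p\<in>W. \<forall>\<eta>\<in>complex_tangent_space M p. \<Omega> p (\<xi> p) \<eta> = \<eta> f"
proof -
  obtain U \<phi> where U: "(U, \<phi>) \<in> atlas M" "p0 \<in> U"
    using chart_cover[OF assms(1) p0] .
  note oU = chart_openin[OF assms(1) U(1)]
  define n where "n = card (Basis :: 'e set)"
  \<comment> \<open>Numbers the basis directions, since the solver uses indices below
    \<open>n\<close>; \<open>ix\<close> is the way back.\<close>
  obtain e :: "nat \<Rightarrow> 'e" where e: "bij_betw e {..<n} Basis"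
    using ex_bij_betw_nat_finite[of "Basis :: 'e set"] by (auto simp: n_def atLeast0LessThan)
  define ix where "ix = inv_into {..<n} e"
  have ix: "ix (e i) = i" if "i < n" for i
    using that bij_betw_inv_into_left[OF e] by (simp add: ix_def)
  have ix_less: "ix b < n" if "b \<in> Basis" for b
    using that bij_betw_inv_into[OF e] bij_betwE unfolding ix_def by fastforce
  define d where "d i = coordinate_vector M U \<phi> (e i)" for i
  have d: "d i p \<in> complex_tangent_space M p" if "p \<in> U" for i p
    unfolding d_def using coordinate_vector_tangent[OF assms(1) U(1) that] .
  have dfield: "vector_field M U (d i)" for i
    unfolding d_def by (rule vector_field_coordinate[OF assms(1) U(1)])
  have lin: "complex_linear_on (complex_tangent_space M p) (\<Omega> p v)"
    "complex_linear_on (complex_tangent_space M p) (\<lambda>w. \<Omega> p w v)"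
    if "p \<in> U" "v \<in> complex_tangent_space M p" for p v
    using assms(2) openin_points_subset[OF oU that(1)] that(2)
    unfolding smooth_bilinear_form_def by blast+
  have expand: "h (chart_vector M U \<phi> p x) = (\<Sum>i<n. x (e i) * h (d i p))"
    if "p \<in> U" "complex_linear_on (complex_tangent_space M p) h" for p h x
    unfolding complex_linear_on_chart_vector[OF assms(1) U(1) that] d_def
    by (rule sum.reindex_bij_betw[OF e, symmetric])
  have CT: "chart_vector M U \<phi> p x \<in> complex_tangent_space M p" if "p \<in> U" for p x
    unfolding complex_tangent_space_eq[OF assms(1) U(1) that] by (rule rangeI)
  \<comment> \<open>Linear functionals that agree on the frame agree on the tangent space. This
    serves both the homogeneous and the inhomogeneous system.\<close>
  have agree: "h \<eta> = h' \<eta>" if p: "p \<in> U" and \<eta>: "\<eta> \<in> complex_tangent_space M p"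
    and "complex_linear_on (complex_tangent_space M p) h" "complex_linear_on (complex_tangent_space M p) h'"
    and "\<And>i. i < n \<Longrightarrow> h (d i p) = h' (d i p)" for p \<eta> and h h' :: "'m tvec \<Rightarrow> complex"
  proof -
    obtain x where "\<eta> = chart_vector M U \<phi> p x"
      using \<eta> unfolding complex_tangent_space_eq[OF assms(1) U(1) p] by blast
    then show ?thesis
      using that(5) by (simp add: expand[OF p that(3)] expand[OF p that(4)])
  qed
  have "\<exists>a. (\<forall>i<n. smooth_fun M U (a i)) \<and>
      (\<forall>p\<in>U. \<forall>j<n. (\<Sum>i<n. a i p * \<Omega> p (d i p) (d j p)) = d j p f)"
  proof (rule smooth_fun_linear_solve[OF assms(1) oU, of n "\<lambda>i j p. \<Omega> p (d i p) (d j p)" "\<lambda>j p. d j p f"])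
    show "smooth_fun M U (\<lambda>p. \<Omega> p (d i p) (d j p))" for i j
      using assms(2) dfield unfolding smooth_bilinear_form_def by blast
    show "smooth_fun M U (\<lambda>p. d j p f)" for j
      using vector_field_smooth[OF dfield subset_refl smooth_fun_subset[OF f oU openin_subset[OF oU]]] .
    fix p c i
    assume p: "p \<in> U" and c: "\<And>j. j < n \<Longrightarrow> (\<Sum>i<n. c i * \<Omega> p (d i p) (d j p)) = 0" and i: "i < n"
    \<comment> \<open>A homogeneous solution read as a tangent vector: it pairs to \<open>0\<close>
      with the whole tangent space.\<close>
    let ?v = "chart_vector M U \<phi> p (\<lambda>b. c (ix b))"
    have *: "\<Omega> p ?v (d j p) = 0" if "j < n" for j
      using c[OF that] by (simp add: expand[OF p lin(2)[OF p d[OF p]]] ix)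
    have "\<Omega> p ?v w = 0" if "w \<in> complex_tangent_space M p" for w
      by (rule agree[where h = "\<Omega> p ?v" and h' = "\<lambda>w. 0", OF p that lin(1)[OF p CT[OF p]]])
        (simp_all add: complex_linear_on_def *)
    then have v0: "?v = (\<lambda>f. 0)"
      by (intro nondeg[OF openin_points_subset[OF oU p] CT[OF p]])
    \<comment> \<open>Evaluating the zero vector on the coordinate along \<open>e i\<close> returns
      the coefficient \<open>c i\<close>.\<close>
    have "e i \<in> Basis" using e i bij_betwE by fastforce
    from chart_vector_coordinate[OF assms(1) U(1) p this, of "\<lambda>b. c (ix b)"]
    show "c i = 0" unfolding v0 using ix[OF i] by simp
  qed
  then obtain a where a: "\<And>i. i < n \<Longrightarrow> smooth_fun M U (a i)"
    "\<And>p j. p \<in> U \<Longrightarrow> j < n \<Longrightarrow> (\<Sum>i<n. a i p * \<Omega> p (d i p) (d j p)) = d j p f"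
    by auto
  let ?\<xi> = "\<lambda>p. chart_vector M U \<phi> p (\<lambda>b. a (ix b) p)"
  show thesis
  proof (rule that)
    show "p0 \<in> U" by (rule U(2))
    show "vector_field M U ?\<xi>"
      using a(1) ix_less by (intro vector_field_chart[OF assms(1) U(1) oU subset_refl]) auto
    show "\<forall>p\<in>U. \<forall>\<eta>\<in>complex_tangent_space M p. \<Omega> p (?\<xi> p) \<eta> = \<eta> f"
    proof (intro ballI)
      fix p \<eta> assume p: "p \<in> U" and \<eta>: "\<eta> \<in> complex_tangent_space M p"
      have "complex_linear_on (complex_tangent_space M p) (\<lambda>\<eta>. \<eta> f)"
        by (simp add: complex_linear_on_def)
      moreover have "\<Omega> p (?\<xi> p) (d j p) = d j p f" if "j < n" for j
        using a(2)[OF p that] by (simp add: expand[OF p lin(2)[OF p d[OF p]]] ix)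
      ultimately show "\<Omega> p (?\<xi> p) \<eta> = \<eta> f"
        by (rule agree[where h = "\<Omega> p (?\<xi> p)" and h' = "\<lambda>\<eta>. \<eta> f", OF p \<eta> lin(1)[OF p CT[OF p]]])
    qed
  qed
qed

lemma nondegenerate_eqI:
  assumes "smooth_manifold M" "smooth_bilinear_form M \<Omega>" "p \<in> points M"
    and nondeg: "\<And>v. v \<in> complex_tangent_space M p \<Longrightarrow>
      (\<And>w. w \<in> complex_tangent_space M p \<Longrightarrow> \<Omega> p v w = 0) \<Longrightarrow> v = (\<lambda>f. 0)"
    and u: "u \<in> complex_tangent_space M p" and v: "v \<in> complex_tangent_space M p"
    and eq: "\<And>w. w \<in> complex_tangent_space M p \<Longrightarrow> \<Omega> p u w = \<Omega> p v w"
  shows "u = v"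
proof -
  \<comment> \<open>The difference is written with the factor \<open>-1\<close>, the form that
    \<open>complex_linear_on\<close> can split.\<close>
  let ?d = "\<lambda>g. u g + (-1) * v g"
  have v': "(\<lambda>g. (-1) * v g) \<in> complex_tangent_space M p"
    by (rule complex_tangent_scale[OF assms(1,3) v])
  have d: "?d \<in> complex_tangent_space M p"
    by (rule complex_tangent_add[OF assms(1,3) u v'])
  have "\<Omega> p ?d w = 0" if w: "w \<in> complex_tangent_space M p" for w
  proof -
    have lin: "complex_linear_on (complex_tangent_space M p) (\<lambda>v. \<Omega> p v w)"
      using assms(2,3) w unfolding smooth_bilinear_form_def by blast
    have "\<Omega> p ?d w = \<Omega> p u w + (-1) * \<Omega> p v w"
      using complex_linear_on_add[OF lin u v'] complex_linear_on_scale[OF lin v, of "-1"] by simp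
    then show ?thesis using eq[OF w] by simp
  qed
  from nondeg[OF d this] have "u g + (-1) * v g = 0" for g by (rule fun_cong)
  then show ?thesis by (intro ext) simp
qed

text \<open>Evaluates the definite description. By nondegeneracy at most one vector at each point
  satisfies the equation, so a pointwise choice coincides with every local smooth solution and is
  itself smooth; uniqueness of the whole field follows point by point.\<close>

lemma hamiltonian_field:
  fixes M :: "('m, 'e::euclidean_space) manifold"
  assumes "smooth_manifold M" "smooth_bilinear_form M \<Omega>"
    and nondeg: "\<And>p v. p \<in> points M \<Longrightarrow> v \<in> complex_tangent_space M p \<Longrightarrow>
      (\<And>w. w \<in> complex_tangent_space M p \<Longrightarrow> \<Omega> p v w = 0) \<Longrightarrow> v = (\<lambda>f. 0)"
    and f: "smooth_fun M (points M) f"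
  shows "vector_field M (points M) (hamiltonian_field M \<Omega> f)"
    and "\<And>p \<eta>. p \<in> points M \<Longrightarrow> \<eta> \<in> complex_tangent_space M p \<Longrightarrow>
      \<Omega> p (hamiltonian_field M \<Omega> f p) \<eta> = \<eta> f"
    and "\<And>p. p \<notin> points M \<Longrightarrow> hamiltonian_field M \<Omega> f p = (\<lambda>g. 0)"
proof -
  let ?P = "\<lambda>p v. v \<in> complex_tangent_space M p \<and> (\<forall>\<eta>\<in>complex_tangent_space M p. \<Omega> p v \<eta> = \<eta> f)"
  have unique: "u = v" if "p \<in> points M" "?P p u" "?P p v" for p u v
    by (rule nondegenerate_eqI[OF assms(1,2) that(1) nondeg[OF that(1)]]) (use that in auto)
  have "\<exists>v. ?P p v" if p: "p \<in> points M" for p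
  proof -
    obtain W \<xi> where "p \<in> W" "vector_field M W \<xi>"
      "\<forall>p\<in>W. \<forall>\<eta>\<in>complex_tangent_space M p. \<Omega> p (\<xi> p) \<eta> = \<eta> f"
      using hamiltonian_field_local[OF assms(1-4) p] .
    then show ?thesis using vector_field_tangent by (intro exI[of _ "\<xi> p"]) auto
  qed
  then obtain Y where Y: "\<And>p. p \<in> points M \<Longrightarrow> ?P p (Y p)" by metis
  \<comment> \<open>Outside the manifold the value is the zero operator, as the description
    demands.\<close>
  define Z where "Z p = (if p \<in> points M then Y p else (\<lambda>g. 0))" for p
  have Z: "?P p (Z p)" if "p \<in> points M" for p
    using Y[OF that] that by (simp add: Z_def)
  have "smooth_fun M W (\<lambda>p. Z p g)" if g: "smooth_fun M W g" for W g
  proof (rule smooth_fun_local[OF assms(1) smooth_fun_openin[OF g]])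
    fix p assume p: "p \<in> W"
    note Wp = openin_points_subset[OF smooth_fun_openin[OF g]]
    obtain V \<xi> where V: "p \<in> V" "vector_field M V \<xi>"
      "\<forall>p\<in>V. \<forall>\<eta>\<in>complex_tangent_space M p. \<Omega> p (\<xi> p) \<eta> = \<eta> f"
      using hamiltonian_field_local[OF assms(1-4) Wp[OF p]] .
    have o: "openin (mtop M) (W \<inter> V)"
      using smooth_fun_openin[OF g] vector_field_openin[OF V(2)] by (rule openin_Int)
    have "smooth_fun M (W \<inter> V) (\<lambda>p. \<xi> p g)"
      by (rule vector_field_smooth[OF V(2) Int_lower2 smooth_fun_subset[OF g o Int_lower1]])
    also have "?this \<longleftrightarrow> smooth_fun M (W \<inter> V) (\<lambda>p. Z p g)"
    proof (rule smooth_fun_cong[OF assms(1)])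
      fix q assume q: "q \<in> W \<inter> V"
      have "\<xi> q = Z q"
        by (rule unique[of q]) (use q Wp Z V(3) vector_field_tangent[OF V(2)] in auto)
      then show "\<xi> q g = Z q g" by simp
    qed
    finally show "\<exists>W. p \<in> W \<and> smooth_fun M W (\<lambda>p. Z p g)"
      using p V(1) by (intro exI[of _ "W \<inter> V"]) simp
  qed
  then have Zfield: "vector_field M (points M) Z"
    using Z unfolding vector_field_def by simp
  have "hamiltonian_field M \<Omega> f = Z"
    unfolding hamiltonian_field_def
  proof (rule the_equality)
    show "vector_field M (points M) Z \<and>
        (\<forall>p\<in>points M. \<forall>\<eta>\<in>complex_tangent_space M p. \<Omega> p (Z p) \<eta> = \<eta> f) \<and>
        (\<forall>p. p \<notin> points M \<longrightarrow> Z p = (\<lambda>g. 0))"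
      using Zfield Z by (simp add: Z_def)
    fix \<xi>
    assume \<xi>: "vector_field M (points M) \<xi> \<and>
        (\<forall>p\<in>points M. \<forall>\<eta>\<in>complex_tangent_space M p. \<Omega> p (\<xi> p) \<eta> = \<eta> f) \<and>
        (\<forall>p. p \<notin> points M \<longrightarrow> \<xi> p = (\<lambda>g. 0))"
    show "\<xi> = Z"
    proof
      fix p
      show "\<xi> p = Z p"
      proof (cases "p \<in> points M")
        case True
        then show ?thesis
          using \<xi> vector_field_tangent[of M "points M" \<xi> p] Z by (intro unique[of p]) auto
      next
        case False
        then show ?thesis using \<xi> by (simp add: Z_def)
      qed
    qed
  qed
  then show "vector_field M (points M) (hamiltonian_field M \<Omega> f)"
    and "\<And>p \<eta>. p \<in> points M \<Longrightarrow> \<eta> \<in> complex_tangent_space M p \<Longrightarrow>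
      \<Omega> p (hamiltonian_field M \<Omega> f p) \<eta> = \<eta> f"
    and "\<And>p. p \<notin> points M \<Longrightarrow> hamiltonian_field M \<Omega> f p = (\<lambda>g. 0)"
    using Zfield Z by (auto simp: Z_def)
qed

text \<open>\<open>symplectic_manifold\<close> states nondegeneracy for real vectors. Split
  \<open>v\<close> as \<open>a + \<i> b\<close>: against a real \<open>w\<close> both values of
  \<open>\<Omega>\<close> are real, so the vanishing of their complex combination makes each of them
  vanish.\<close>

lemma symplectic_nondegenerate:
  assumes "symplectic_manifold M \<Omega>" "p \<in> points M" "v \<in> complex_tangent_space M p"
    and "\<And>w. w \<in> complex_tangent_space M p \<Longrightarrow> \<Omega> p v w = 0"
  shows "v = (\<lambda>f. 0)"
proof -
  have M: "smooth_manifold M" and two: "two_form M (points M) \<Omega>"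
    and nd: "\<And>v. v \<in> tangent_space M p \<Longrightarrow> (\<And>w. w \<in> tangent_space M p \<Longrightarrow> \<Omega> p v w = 0) \<Longrightarrow> v = (\<lambda>f. 0)"
    using assms(1,2) unfolding symplectic_manifold_def by blast+
  note sub = subsetD[OF tangent_space_subset[OF M]]
  obtain a b where ab: "v = (\<lambda>f. a f + \<i> * b f)" "a \<in> tangent_space M p" "b \<in> tangent_space M p"
    using assms(3) unfolding complex_tangent_space_def by blast
  have "\<Omega> p a w = 0 \<and> \<Omega> p b w = 0" if w: "w \<in> tangent_space M p" for w
  proof -
    have lin: "complex_linear_on (complex_tangent_space M p) (\<lambda>v. \<Omega> p v w)"
      using two_form_smooth_bilinear_form[OF two M] assms(2) sub[OF w]
      unfolding smooth_bilinear_form_def by blast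
    have "\<Omega> p v w = \<Omega> p a w + \<i> * \<Omega> p b w"
      unfolding ab(1) using complex_linear_on_scale[OF lin sub[OF ab(3)], of \<i>]
        complex_linear_on_add[OF lin sub[OF ab(2)] complex_tangent_scale[OF M assms(2) sub[OF ab(3)]], of \<i>]
      by simp
    then have "\<Omega> p a w + \<i> * \<Omega> p b w = 0"
      using assms(4)[OF sub[OF w]] by simp
    moreover have "\<Omega> p a w \<in> \<real>" "\<Omega> p b w \<in> \<real>"
      using two ab(2,3) w assms(2) unfolding two_form_def by blast+
    ultimately show ?thesis
      by (auto elim!: Reals_cases simp: complex_eq_iff)
  qed
  then have "a = (\<lambda>f. 0)" "b = (\<lambda>f. 0)"
    using nd ab by blast+
  then show ?thesis by (simp add: ab(1))
qed

section \<open>The circle bundle\<close>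

text \<open>The local clause of \<open>complex_line_bundle\<close> with \<open>U\<close> and
  \<open>\<Phi>\<close> as arguments, so that one trivialisation can be fixed and reused.\<close>

definition trivialization ::
    "('x, 'e::euclidean_space) manifold \<Rightarrow> ('l, 'x, 'e) line_bundle \<Rightarrow> 'x set \<Rightarrow> ('x \<times> complex \<Rightarrow> 'l) \<Rightarrow> bool" where
  "trivialization X L U \<Phi> \<longleftrightarrow> openin (mtop X) U \<and>
     bij_betw \<Phi> (U \<times> UNIV) {q \<in> points (total L). proj L q \<in> U} \<and>
     smooth_map (prod_manifold X (open_manifold UNIV)) (U \<times> UNIV) (total L) \<Phi> \<and>
     smooth_map (total L) {q \<in> points (total L). proj L q \<in> U} (prod_manifold X (open_manifold UNIV))
       (inv_into (U \<times> UNIV) \<Phi>) \<and>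
     (\<forall>y\<in>U. \<forall>c d. proj L (\<Phi> (y, c)) = y \<and> fadd L (\<Phi> (y, c)) (\<Phi> (y, d)) = \<Phi> (y, c + d) \<and>
        fscale L c (\<Phi> (y, d)) = \<Phi> (y, c * d))"

definition fibre_coordinate :: "'x set \<Rightarrow> ('x \<times> complex \<Rightarrow> 'l) \<Rightarrow> 'l \<Rightarrow> complex" where
  "fibre_coordinate U \<Phi> q = snd (inv_into (U \<times> UNIV) \<Phi> q)"

locale hermitian_line_bundle =
  fixes X :: "('x, 'e::euclidean_space) manifold" and L :: "('l, 'x, 'e) line_bundle"
    and H :: "'l \<Rightarrow> 'l \<Rightarrow> complex"
  assumes X: "smooth_manifold X" and line_bundle: "complex_line_bundle X L"
    and hermitian: "hermitian_structure X L H"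
begin

abbreviation L1 :: "('l, 'e \<times> real) manifold" where
  "L1 \<equiv> circle_bundle L H"

abbreviation orbit :: "'l \<Rightarrow> real \<Rightarrow> 'l" where
  "orbit q \<equiv> \<lambda>\<theta>. fscale L (cis \<theta>) q"

lemma total: "smooth_manifold (total L)"
  using line_bundle by (simp add: complex_line_bundle_def)

lemma proj_total: "smooth_map (total L) (points (total L)) X (proj L)"
  using line_bundle by (simp add: complex_line_bundle_def)

lemma trivialization_exists:
  assumes "x \<in> points X"
  obtains U \<Phi> where "x \<in> U" "trivialization X L U \<Phi>"
proof -
  have "\<exists>U \<Phi>. x \<in> U \<and> trivialization X L U \<Phi>"
    using line_bundle assms unfolding complex_line_bundle_def trivialization_def Let_def by blast
  then show thesis using that by blast
qed

lemma plane: "smooth_manifold (open_manifold (UNIV :: complex set))"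
  by (rule smooth_manifold_open_manifold) simp

lemma trivial_bundle: "smooth_manifold (prod_manifold X (open_manifold (UNIV :: complex set)))"
  by (rule smooth_manifold_prod_manifold[OF X plane])

context
  fixes U \<Phi>
  assumes triv: "trivialization X L U \<Phi>"
begin

lemma triv_openin: "openin (mtop X) U"
  using triv by (simp add: trivialization_def)

lemma triv_subset: "y \<in> U \<Longrightarrow> y \<in> points X"
  by (rule openin_points_subset[OF triv_openin])

lemma triv_proj: "y \<in> U \<Longrightarrow> proj L (\<Phi> (y, c)) = y"
  and triv_fadd: "y \<in> U \<Longrightarrow> fadd L (\<Phi> (y, c)) (\<Phi> (y, d)) = \<Phi> (y, c + d)"
  and triv_fscale: "y \<in> U \<Longrightarrow> fscale L c (\<Phi> (y, d)) = \<Phi> (y, c * d)"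
  using triv unfolding trivialization_def by blast+

lemma triv_bij: "bij_betw \<Phi> (U \<times> UNIV) {q \<in> points (total L). proj L q \<in> U}"
  using triv by (simp add: trivialization_def)

lemma triv_points: "y \<in> U \<Longrightarrow> \<Phi> (y, c) \<in> points (total L)"
  using bij_betwE[OF triv_bij] by blast

lemma triv_coordinate: "y \<in> U \<Longrightarrow> fibre_coordinate U \<Phi> (\<Phi> (y, c)) = c"
  using bij_betw_inv_into_left[OF triv_bij, of "(y, c)"] by (simp add: fibre_coordinate_def)

lemma triv_expand:
  assumes "q \<in> points (total L)" "proj L q \<in> U"
  shows "\<Phi> (proj L q, fibre_coordinate U \<Phi> q) = q"
proof -
  obtain y c where "y \<in> U" "q = \<Phi> (y, c)"
    using assms bij_betw_imp_surj_on[OF triv_bij] by blast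
  then show ?thesis by (simp add: triv_proj triv_coordinate)
qed

lemma fibre_coordinate_smooth:
  "smooth_fun (total L) {q \<in> points (total L). proj L q \<in> U} (fibre_coordinate U \<Phi>)"
proof -
  let ?E = "{q \<in> points (total L). proj L q \<in> U}"
  have inv: "smooth_map (total L) ?E (prod_manifold X (open_manifold UNIV)) (inv_into (U \<times> UNIV) \<Phi>)"
    using triv by (simp add: trivialization_def)
  have "smooth_map (total L) ?E (open_manifold UNIV) (\<lambda>q. snd (inv_into (U \<times> UNIV) \<Phi> q))"
  proof (rule smooth_map_compose_total[OF total trivial_bundle inv smooth_map_snd[OF X plane]])
    show "inv_into (U \<times> UNIV) \<Phi> ` ?E \<subseteq> points (prod_manifold X (open_manifold UNIV))"
      using smooth_map_image[OF inv] by blast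
  qed
  then show ?thesis
    by (simp add: smooth_map_into_open_manifold fibre_coordinate_def[abs_def])
qed

text \<open>Sections, circle orbits and the parametrisation of the circle bundle are all built this
  way, from a base map and a fibre coordinate.\<close>

lemma triv_smooth_map:
  assumes "smooth_manifold N" "smooth_map N W X f" "smooth_fun N W g" "f ` W \<subseteq> U"
  shows "smooth_map N W (total L) (\<lambda>p. \<Phi> (f p, g p))"
proof -
  have "smooth_map N W (open_manifold UNIV) g"
    using assms(3) by (simp add: smooth_map_into_open_manifold)
  then have "smooth_map N W (prod_manifold X (open_manifold UNIV)) (\<lambda>p. (f p, g p))"
    by (rule smooth_map_Pair[OF assms(1) X plane assms(2)])
  moreover have "smooth_map (prod_manifold X (open_manifold UNIV)) (U \<times> UNIV) (total L) \<Phi>"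
    using triv by (simp add: trivialization_def)
  ultimately show ?thesis
    by (rule smooth_map_compose_total[OF assms(1) trivial_bundle]) (use assms(4) in auto)
qed

lemma triv_section:
  assumes "smooth_fun X W g" "W \<subseteq> U"
  shows "smooth_map X W (total L) (\<lambda>y. \<Phi> (y, g y))"
proof (rule triv_smooth_map[OF X _ assms(1)])
  show "smooth_map X W X (\<lambda>y. y)"
    using smooth_fun_openin[OF assms(1)] openin_subset
    by (intro smooth_map_subset[OF smooth_map_ident[OF X]]) auto
qed (use assms(2) in auto)

text \<open>The squared length of the local frame given by fibre coordinate \<open>1\<close>;
  complex by type, positive real by \<open>frame_norm_pos\<close>.\<close>

abbreviation frame_norm :: "'x \<Rightarrow> complex" where
  "frame_norm y \<equiv> H (\<Phi> (y, 1)) (\<Phi> (y, 1))"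

lemma frame_norm_smooth: "smooth_fun X U frame_norm"
proof -
  have "smooth_map X U (total L) (\<lambda>y. \<Phi> (y, 1))"
    by (rule triv_section[OF smooth_fun_const[OF triv_openin] subset_refl])
  then have "smooth_section X L U (\<lambda>y. \<Phi> (y, 1))"
    by (simp add: smooth_section_def triv_proj)
  then show ?thesis
    using hermitian unfolding hermitian_structure_def by blast
qed

lemma hermitian_fibre:
  assumes "x \<in> points X" "q \<in> points (total L)" "proj L q = x" "q' \<in> points (total L)" "proj L q' = x"
  shows "H (fscale L c q) q' = c * H q q'" "H q' q = cnj (H q q')" "q \<noteq> fscale L 0 q \<Longrightarrow> 0 < Re (H q q)"
  using hermitian assms unfolding hermitian_structure_def Let_def by blast+

text \<open>Conjugate symmetry for equal arguments removes the imaginary part. Positivity applies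
  because injectivity of \<open>\<Phi>\<close> separates the frame vector from the zero vector
  \<open>\<Phi> (y, 0)\<close>.\<close>

lemma frame_norm_pos:
  assumes "y \<in> U"
  shows "frame_norm y = complex_of_real (Re (frame_norm y))" "0 < Re (frame_norm y)"
proof -
  note h = hermitian_fibre[OF triv_subset[OF assms] triv_points[OF assms] triv_proj[OF assms]
      triv_points[OF assms] triv_proj[OF assms]]
  have "\<Phi> (y, 1) \<noteq> \<Phi> (y, 0)"
    using bij_betw_imp_inj_on[OF triv_bij] assms by (auto dest: inj_onD)
  then show "0 < Re (frame_norm y)"
    by (intro h(3)) (simp add: triv_fscale[OF assms])
  have "Im (frame_norm y) = 0"
    using arg_cong[OF h(2)[of 1 1], of Im] by simp
  then show "frame_norm y = complex_of_real (Re (frame_norm y))"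
    by (simp add: complex_eq_iff)
qed

text \<open>Linearity is given in the first argument; the factor \<open>cnj c\<close> comes from
  conjugate symmetry, and the frame norm is its own conjugate.\<close>

lemma triv_norm:
  assumes "y \<in> U"
  shows "H (\<Phi> (y, c)) (\<Phi> (y, c)) = c * cnj c * frame_norm y"
proof -
  note h = hermitian_fibre[OF triv_subset[OF assms] triv_points[OF assms] triv_proj[OF assms]
      triv_points[OF assms] triv_proj[OF assms]]
  have "H (\<Phi> (y, c)) (\<Phi> (y, c)) = c * H (\<Phi> (y, 1)) (\<Phi> (y, c))"
    using h(1)[of c 1 c] by (simp add: triv_fscale[OF assms])
  also have "H (\<Phi> (y, 1)) (\<Phi> (y, c)) = cnj (H (\<Phi> (y, c)) (\<Phi> (y, 1)))"
    by (rule h(2))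
  also have "H (\<Phi> (y, c)) (\<Phi> (y, 1)) = c * frame_norm y"
    using h(1)[of c 1 1] by (simp add: triv_fscale[OF assms])
  also have "cnj (c * frame_norm y) = cnj c * frame_norm y"
    by (subst (1 2) frame_norm_pos(1)[OF assms]) simp
  finally show ?thesis by (simp add: mult.assoc)
qed

end

section \<open>Unit vectors in the fibres and the circle action\<close>

lemma points_L1: "points L1 = {q \<in> points (total L). H q q = 1}"
  by (auto simp: circle_bundle_def)

lemma proj_points: "q \<in> points L1 \<Longrightarrow> proj L q \<in> points X"
  using smooth_map_image[OF proj_total] by (simp add: points_L1)

lemma triv_circle:
  assumes "trivialization X L U \<Phi>" "y \<in> U"
  shows "\<Phi> (y, c) \<in> points L1 \<longleftrightarrow> c * cnj c * H (\<Phi> (y, 1)) (\<Phi> (y, 1)) = 1"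
  using triv_points[OF assms, of c] triv_norm[OF assms, of c] by (simp add: points_L1)

lemma circle_triv:
  assumes "q \<in> points L1"
  obtains U \<Phi> d where "proj L q \<in> U" "trivialization X L U \<Phi>" "q = \<Phi> (proj L q, d)" "d \<noteq> 0"
proof -
  obtain U \<Phi> where U: "proj L q \<in> U" "trivialization X L U \<Phi>"
    using trivialization_exists[OF proj_points[OF assms]] .
  have q: "\<Phi> (proj L q, fibre_coordinate U \<Phi> q) = q"
    using assms U(1) by (intro triv_expand[OF U(2)]) (simp_all add: points_L1)
  moreover have "fibre_coordinate U \<Phi> q \<noteq> 0"
    using triv_circle[OF U(2,1), of "fibre_coordinate U \<Phi> q"] assms unfolding q by auto
  ultimately show thesis using that[OF U] by metis
qed

context
  fixes q assumes q: "q \<in> points L1"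
begin

text \<open>A point of the circle bundle has nonzero fibre coordinate \<open>d\<close>, so it spans
  its fibre. The fibre identities become identities of complex numbers multiplied by
  \<open>d\<close>, carried over by \<open>\<Phi>\<close>.\<close>

lemma fscale_fscale: "fscale L a (fscale L b q) = fscale L (a * b) q"
  and fadd_fscale: "fadd L (fscale L a q) (fscale L b q) = fscale L (a + b) q"
  and fscale_one: "fscale L 1 q = q"
  and proj_fscale: "proj L (fscale L a q) = proj L q"
  and fscale_eq_iff: "fscale L a q = fscale L b q \<longleftrightarrow> a = b"
  and fibre_fscale: "q' \<in> points (total L) \<Longrightarrow> proj L q' = proj L q \<Longrightarrow> \<exists>c. q' = fscale L c q"
  and circle_fscale: "cmod c = 1 \<Longrightarrow> fscale L c q \<in> points L1"
proof -
  obtain U \<Phi> d where U: "proj L q \<in> U" "trivialization X L U \<Phi>" and d: "q = \<Phi> (proj L q, d)" "d \<noteq> 0"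
    using circle_triv[OF q] .
  note s = triv_fscale[OF U(2,1)]
  have sq: "fscale L a q = \<Phi> (proj L q, a * d)" for a
    by (subst d(1)) (rule s)
  show "fscale L a (fscale L b q) = fscale L (a * b) q"
    by (simp add: sq s mult.assoc)
  show "fadd L (fscale L a q) (fscale L b q) = fscale L (a + b) q"
    by (simp add: sq triv_fadd[OF U(2,1)] distrib_right)
  show "fscale L 1 q = q"
    using d(1) by (simp add: sq)
  show "proj L (fscale L a q) = proj L q"
    by (simp add: sq triv_proj[OF U(2,1)])
  show "fscale L a q = fscale L b q \<longleftrightarrow> a = b"
    using triv_coordinate[OF U(2,1), of "a * d"] triv_coordinate[OF U(2,1), of "b * d"] d(2)
    unfolding sq by (metis mult_right_cancel)
  show "\<exists>c. q' = fscale L c q" if "q' \<in> points (total L)" "proj L q' = proj L q"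
  proof -
    have "q' = \<Phi> (proj L q, fibre_coordinate U \<Phi> q')"
      using triv_expand[OF U(2) that(1)] U(1) that(2) by simp
    then show ?thesis
      using d(2) by (intro exI[of _ "fibre_coordinate U \<Phi> q' / d"]) (simp add: sq)
  qed
  show "fscale L c q \<in> points L1" if "cmod c = 1"
  proof -
    have c: "c * cnj c = 1"
      using that by (simp add: complex_norm_square[symmetric])
    have d': "d * cnj d * H (\<Phi> (proj L q, 1)) (\<Phi> (proj L q, 1)) = 1"
      using triv_circle[OF U(2,1), of d] q d(1) by simp
    have "c * d * cnj (c * d) * h = (c * cnj c) * (d * cnj d * h)" for h
      by simp
    then show ?thesis
      unfolding sq triv_circle[OF U(2,1)] by (simp only: c d' mult_1)
  qed
qed

end

text \<open>In a trivialisation the orbit stays over one base point and has fibre coordinate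
  \<open>cis \<theta> * d\<close>, smooth because \<open>exp\<close> is holomorphic.\<close>

lemma orbit_smooth:
  assumes q: "q \<in> points L1"
  shows "smooth_map (open_manifold UNIV) UNIV (total L) (orbit q)"
proof -
  obtain U \<Phi> d where U: "proj L q \<in> U" "trivialization X L U \<Phi>" and d: "q = \<Phi> (proj L q, d)" "d \<noteq> 0"
    using circle_triv[OF q] .
  have R: "smooth_manifold (open_manifold (UNIV :: real set))"
    by (rule smooth_manifold_open_manifold) simp
  have "smooth_fun (open_manifold UNIV) UNIV (\<lambda>\<theta>. exp (\<i> * complex_of_real \<theta>))"
  proof (rule smooth_fun_holomorphic[OF R _ open_UNIV,
        where h = exp and f = "\<lambda>\<theta>. \<i> * complex_of_real \<theta>"])
    have "bounded_linear (\<lambda>\<theta>. \<i> * complex_of_real \<theta>)"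
      using bounded_linear_compose[OF bounded_linear_mult_right bounded_linear_of_real] .
    then show "smooth_fun (open_manifold UNIV) UNIV (\<lambda>\<theta>. \<i> * complex_of_real \<theta>)"
      by (simp add: smooth_fun_open_manifold smooth_bounded_linear)
  qed (auto intro: holomorphic_intros)
  then have "smooth_fun (open_manifold UNIV) UNIV (\<lambda>\<theta>. cis \<theta> * d)"
    unfolding cis_conv_exp by (intro smooth_fun_mult[OF R] smooth_fun_const) simp_all
  then have "smooth_map (open_manifold UNIV) UNIV (total L) (\<lambda>\<theta>. \<Phi> (proj L q, cis \<theta> * d))"
    using U(1) by (intro triv_smooth_map[OF U(2) R] smooth_map_const[OF R _ proj_points[OF q]]) auto
  moreover have "fscale L (cis \<theta>) q = \<Phi> (proj L q, cis \<theta> * d)" for \<theta>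
    by (subst d(1)) (rule triv_fscale[OF U(2,1)])
  ultimately show ?thesis by simp
qed

lemma orbit_smooth_L1:
  assumes "q \<in> points L1"
  shows "smooth_map (open_manifold UNIV) UNIV L1 (orbit q)"
proof -
  have "smooth_manifold (open_manifold (UNIV :: real set))"
    by (rule smooth_manifold_open_manifold) simp
  moreover have "H (orbit q \<theta>) (orbit q \<theta>) = 1 \<and> orbit q \<theta> \<in> points (total L)" for \<theta>
    using circle_fscale[OF assms, of "cis \<theta>"] by (simp add: points_L1)
  ultimately show ?thesis
    unfolding circle_bundle_def
    by (intro smooth_map_into_submanifold[OF _ total orbit_smooth[OF assms]]) auto
qed

text \<open>Dividing the frame vector by its length gives a unit vector. Injectivity of the lift of
  functions rests on this: every point of \<open>X\<close> lies below the circle bundle.\<close>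

lemma circle_nonempty:
  assumes "x \<in> points X"
  obtains q where "q \<in> points L1" "proj L q = x"
proof -
  obtain U \<Phi> where U: "x \<in> U" "trivialization X L U \<Phi>"
    using trivialization_exists[OF assms] .
  obtain t where t: "H (\<Phi> (x, 1)) (\<Phi> (x, 1)) = complex_of_real t" "0 < t"
    using frame_norm_pos[OF U(2,1)] by blast
  have "1 / sqrt t * (1 / sqrt t) * t = 1"
    using t(2) by simp
  then have "complex_of_real (1 / sqrt t) * cnj (complex_of_real (1 / sqrt t)) * complex_of_real t = 1"
    by (simp only: complex_cnj_complex_of_real of_real_mult[symmetric] of_real_1)
  then have "\<Phi> (x, complex_of_real (1 / sqrt t)) \<in> points L1"
    unfolding triv_circle[OF U(2,1)] t(1) .
  then show thesis
    using that triv_proj[OF U(2,1)] by blast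
qed

text \<open>The frame is normalised by the factor \<open>e\<close>; a constant of modulus one then
  rotates the resulting section so that it passes through \<open>q\<close>.\<close>

lemma unit_section:
  assumes q: "q \<in> points L1" and U: "proj L q \<in> U" "trivialization X L U \<Phi>"
  obtains k where "smooth_fun X U k" "\<Phi> (proj L q, k (proj L q)) = q"
    "\<forall>y\<in>U. \<Phi> (y, k y) \<in> points L1"
proof -
  let ?h = "\<lambda>y. H (\<Phi> (y, 1)) (\<Phi> (y, 1))" and ?x = "proj L q"
  \<comment> \<open>The inverse square root of the squared frame length, written with
    \<open>exp\<close> and \<open>Ln\<close> so that holomorphy gives smoothness.\<close>
  define e where "e y = exp (- Ln (?h y) / 2)" for y
  define d where "d = fibre_coordinate U \<Phi> q"
  have q_eq: "\<Phi> (?x, d) = q"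
    unfolding d_def using q U(1) by (intro triv_expand[OF U(2)]) (simp_all add: points_L1)
  have e: "e y * cnj (e y) * ?h y = 1" if y: "y \<in> U" for y
  proof -
    obtain t where t: "?h y = complex_of_real t" "0 < t"
      using frame_norm_pos[OF U(2) y] by blast
    have "e y = complex_of_real (exp (- ln t / 2))"
      using t by (simp add: e_def Ln_of_real flip: exp_of_real)
    then have "e y * cnj (e y) * ?h y = complex_of_real (exp (- ln t / 2) * exp (- ln t / 2) * t)"
      by (simp add: t(1))
    also have "exp (- ln t / 2) * exp (- ln t / 2) * t = exp (- ln t) * t"
      by (simp flip: exp_add)
    also have "\<dots> = 1"
      using t(2) by (simp add: exp_minus)
    finally show ?thesis by simp
  qed
  have d: "d * cnj d * ?h ?x = 1"
    using triv_circle[OF U(2,1), of d] q q_eq by simp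
  have smooth_e: "smooth_fun X U e"
  proof -
    have "(\<lambda>z. exp (- Ln z / 2)) holomorphic_on - \<real>\<^sub>\<le>\<^sub>0"
      by (intro holomorphic_intros) auto
    \<comment> \<open>A positive real lies off the branch cut of \<open>Ln\<close>.\<close>
    moreover have "?h y \<notin> \<real>\<^sub>\<le>\<^sub>0" if "y \<in> U" for y
      using frame_norm_pos(2)[OF U(2) that] complex_nonpos_Reals_iff by fastforce
    moreover have "open (- \<real>\<^sub>\<le>\<^sub>0 :: complex set)"
      using closed_nonpos_Reals_complex by (simp add: open_Compl)
    ultimately show ?thesis
      unfolding e_def[abs_def] by (intro smooth_fun_holomorphic[OF X frame_norm_smooth[OF U(2)]]) auto
  qed
  show thesis
  \<comment> \<open>The numbers \<open>d\<close> and \<open>e ?x\<close> are fibre coordinates of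
    two unit vectors over the same point, so the constant \<open>d / e ?x\<close> has modulus
    one.\<close>
  proof (rule that[of "\<lambda>y. d / e ?x * e y"])
    show "smooth_fun X U (\<lambda>y. d / e ?x * e y)"
      by (intro smooth_fun_mult[OF X] smooth_fun_const smooth_e triv_openin[OF U(2)])
    show "\<Phi> (?x, d / e ?x * e ?x) = q"
      using e[OF U(1)] q_eq by auto
    show "\<forall>y\<in>U. \<Phi> (y, d / e ?x * e y) \<in> points L1"
    proof
      fix y assume y: "y \<in> U"
      have "?h ?x \<noteq> 0" "e ?x \<noteq> 0" using e[OF U(1)] by auto
      then have "d * cnj d = e ?x * cnj (e ?x)"
        using e[OF U(1)] d by (metis mult_right_cancel)
      moreover have "e ?x * cnj (e ?x) \<noteq> 0" using \<open>e ?x \<noteq> 0\<close> by simp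
      ultimately have "(d / e ?x * e y) * cnj (d / e ?x * e y) = e y * cnj (e y)"
        by (simp add: field_simps)
      then show "\<Phi> (y, d / e ?x * e y) \<in> points L1"
        unfolding triv_circle[OF U(2) y] using e[OF y] by (simp add: mult.assoc)
    qed
  qed
qed

text \<open>
  Over a chart of \<open>X\<close>, the point \<open>e\<^bsup>i\<theta>\<^esup> u(y)\<close> with a unit section \<open>u\<close> gets the coordinates of
  \<open>y\<close> together with the angle \<open>\<theta>\<close>.
\<close>

lemma adapted_chart:
  assumes q: "q \<in> points L1"
  obtains U u A \<phi> V \<kappa> where "proj L q \<in> U" "smooth_map X U L1 u" "\<forall>y\<in>U. proj L (u y) = y" "u (proj L q) = q"
    "(A, \<phi>) \<in> atlas X" "U \<subseteq> A" "(V, \<kappa>) \<in> atlas L1" "q \<in> V"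
    "\<forall>q'\<in>V. proj L q' \<in> U \<and> fst (\<kappa> q') = \<phi> (proj L q')"
    "\<forall>y\<in>U. u y \<in> V \<and> snd (\<kappa> (u y)) = 0"
    "\<forall>\<theta>\<in>{-pi/2<..<pi/2}. orbit q \<theta> \<in> V \<and> snd (\<kappa> (orbit q \<theta>)) = \<theta>"
proof -
  obtain U0 \<Phi> where U0: "proj L q \<in> U0" "trivialization X L U0 \<Phi>"
    using trivialization_exists[OF proj_points[OF q]] .
  obtain k where k: "smooth_fun X U0 k" "\<Phi> (proj L q, k (proj L q)) = q" "\<forall>y\<in>U0. \<Phi> (y, k y) \<in> points L1"
    using unit_section[OF q U0] .
  obtain A \<phi> where A: "(A, \<phi>) \<in> atlas X" "proj L q \<in> A"
    using chart_cover[OF X proj_points[OF q]] .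
  note T = U0(2)
  define U where "U = U0 \<inter> A"
  have oU: "openin (mtop X) U"
    unfolding U_def using triv_openin[OF T] chart_openin[OF X A(1)] by (rule openin_Int)
  have U: "U \<subseteq> U0" "U \<subseteq> A" "proj L q \<in> U"
    using U0(1) A(2) by (auto simp: U_def)
  define u where "u y = \<Phi> (y, k y)" for y
  define E0 where "E0 = {q \<in> points (total L). proj L q \<in> U0}"
  define E where "E = points (total L) \<inter> proj L -` U"
  have oE: "openin (mtop (total L)) E"
    unfolding E_def by (rule smooth_map_openin_vimage[OF total X proj_total oU])
  have E: "E \<subseteq> E0" using U(1) by (auto simp: E_def E0_def)
  have knz: "k y \<noteq> 0" if "y \<in> U0" for y
    using k(3) that triv_circle[OF T that, of "k y"] by auto
  \<comment> \<open>The coordinate of a point relative to the unit section \<open>u\<close>. On the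
    circle bundle it has modulus one, and its argument is the angle.\<close>
  define c where "c p = fibre_coordinate U0 \<Phi> p / k (proj L p)" for p
  have projE: "smooth_map (total L) E X (proj L)"
    using smooth_map_subset[OF proj_total oE] by (simp add: E_def)
  have smooth_c: "smooth_fun (total L) E c"
    unfolding c_def[abs_def]
  proof (rule smooth_fun_divide[OF total])
    show "smooth_fun (total L) E (fibre_coordinate U0 \<Phi>)"
      using smooth_fun_subset[OF fibre_coordinate_smooth[OF T] oE] E by (simp add: E0_def)
    show "smooth_fun (total L) E (\<lambda>p. k (proj L p))"
      using U(1) by (intro smooth_fun_compose_total[OF total X projE k(1)]) (auto simp: E_def)
    show "k (proj L p) \<noteq> 0" if "p \<in> E" for p
      using that U(1) knz by (auto simp: E_def)
  qed
  \<comment> \<open>On the right half-plane \<open>Ln\<close> is holomorphic, so the angle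
    \<open>Im (Ln (c p))\<close> is smooth; it lies strictly between \<open>-pi/2\<close> and
    \<open>pi/2\<close>.\<close>
  define W where "W = E \<inter> c -` {z. Re z > 0}"
  have oW: "openin (mtop (total L)) W"
    unfolding W_def by (rule smooth_fun_openin_vimage[OF total smooth_c open_halfspace_Re_gt])
  define \<kappa> where "\<kappa> p = (\<phi> (proj L p), Im (Ln (c p)))" for p
  have smooth_\<kappa>: "smooth_fun (total L) W \<kappa>"
    unfolding \<kappa>_def[abs_def]
  proof (rule smooth_fun_Pair[OF total])
    show "smooth_fun (total L) W (\<lambda>p. \<phi> (proj L p))"
      using U(2) openin_subset[OF oW]
      by (intro smooth_fun_subset[OF smooth_map_chartD[OF proj_total A(1)] oW]) (auto simp: W_def E_def)
    have "smooth_fun (total L) W (\<lambda>p. Ln (c p))"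
    proof (rule smooth_fun_holomorphic[OF total _ open_halfspace_Re_gt, where h = Ln and f = c])
      show "smooth_fun (total L) W c"
        by (rule smooth_fun_subset[OF smooth_c oW]) (simp add: W_def)
      show "Ln holomorphic_on {z. Re z > 0}"
        by (intro holomorphic_on_Ln) (auto simp: complex_nonpos_Reals_iff)
    qed (auto simp: W_def)
    then show "smooth_fun (total L) W (\<lambda>p. Im (Ln (c p)))"
      by (rule smooth_fun_bounded_linear[OF total bounded_linear_Im])
  qed
  define O' where "O' = \<phi> ` U \<times> {-pi/2<..<pi/2}"
  have oU\<phi>: "open (\<phi> ` U)" by (rule chart_open_image[OF X A(1) oU U(2)])
  then have oO: "open O'" unfolding O'_def by (intro open_Times) auto
  note MO = smooth_manifold_open_manifold[OF oO]
  \<comment> \<open>The inverse of \<open>\<kappa>\<close> on the circle bundle: the unit section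
    over the point with coordinates \<open>fst z\<close>, rotated by the angle
    \<open>snd z\<close>.\<close>
  define \<rho> where "\<rho> z = \<Phi> (inv_into A \<phi> (fst z), k (inv_into A \<phi> (fst z)) * exp (\<i> * complex_of_real (snd z)))" for z
  have invU: "inv_into A \<phi> (fst z) \<in> U" "\<phi> (inv_into A \<phi> (fst z)) = fst z" if z: "z \<in> O'" for z
  proof -
    obtain y where y: "y \<in> U" "fst z = \<phi> y" using z by (auto simp: O'_def)
    then show "inv_into A \<phi> (fst z) \<in> U" "\<phi> (inv_into A \<phi> (fst z)) = fst z"
      using chart_inv[OF X A(1), of y] U(2) by auto
  qed
  have smooth_\<rho>: "smooth_map (open_manifold O') O' (total L) \<rho>"
    unfolding \<rho>_def[abs_def]
  proof (rule triv_smooth_map[OF T MO])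
    have "smooth_map (open_manifold O') O' (open_manifold (\<phi> ` A)) fst"
      using oO U(2) smooth_bounded_linear[OF oO bounded_linear_fst]
      by (auto simp: smooth_map_into_open_manifold smooth_fun_open_manifold O'_def)
    then show s: "smooth_map (open_manifold O') O' X (\<lambda>z. inv_into A \<phi> (fst z))"
      using U(2) by (intro smooth_map_compose_total[OF MO
            smooth_manifold_open_manifold[OF chart_image_open[OF X A(1)]] _ chart_inv_smooth_map[OF X A(1)]])
        (auto simp: O'_def)
    have "smooth_fun (open_manifold O') O' (\<lambda>z. k (inv_into A \<phi> (fst z)))"
      using invU(1) U(1) by (intro smooth_fun_compose_total[OF MO X s k(1)]) auto
    moreover have "smooth_fun (open_manifold O') O' (\<lambda>z. exp (\<i> * complex_of_real (snd z)))"
    proof (rule smooth_fun_holomorphic[OF MO _ open_UNIV,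
          where h = exp and f = "\<lambda>z. \<i> * complex_of_real (snd z)"])
      have "bounded_linear (\<lambda>z :: 'e \<times> real. \<i> * complex_of_real (snd z))"
        using bounded_linear_compose[OF bounded_linear_mult_right
            bounded_linear_compose[OF bounded_linear_of_real bounded_linear_snd]] .
      then show "smooth_fun (open_manifold O') O' (\<lambda>z. \<i> * complex_of_real (snd z))"
        using oO by (simp add: smooth_fun_open_manifold[OF oO] smooth_bounded_linear)
    qed (auto intro: holomorphic_intros)
    ultimately show "smooth_fun (open_manifold O') O'
        (\<lambda>z. k (inv_into A \<phi> (fst z)) * exp (\<i> * complex_of_real (snd z)))"
      by (rule smooth_fun_mult[OF MO])
  qed (use invU(1) U(1) in auto)
  have frame: "\<Phi> (y, k y * cis \<theta>) \<in> W \<inter> {q \<in> points (total L). H q q = 1} \<and>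
      \<kappa> (\<Phi> (y, k y * cis \<theta>)) = (\<phi> y, \<theta>)"
    if y: "y \<in> U" and \<theta>: "\<theta> \<in> {-pi/2<..<pi/2}" for y \<theta>
  proof -
    have y0: "y \<in> U0" using y U(1) by blast
    have cc: "c (\<Phi> (y, k y * cis \<theta>)) = cis \<theta>"
      by (simp add: c_def triv_proj[OF T y0] triv_coordinate[OF T y0] knz[OF y0])
    have "cos \<theta> > 0" using \<theta> by (intro cos_gt_zero_pi) auto
    then have "\<Phi> (y, k y * cis \<theta>) \<in> W"
      using y by (simp add: W_def E_def cc triv_proj[OF T y0] triv_points[OF T y0])
    moreover have "\<Phi> (y, k y * cis \<theta>) \<in> points L1"
    proof -
      have c1: "cis \<theta> * cnj (cis \<theta>) = 1" by (simp add: cis_cnj cis_mult)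
      have k1: "k y * cnj (k y) * H (\<Phi> (y, 1)) (\<Phi> (y, 1)) = 1"
        using k(3) y0 triv_circle[OF T y0] by blast
      have "k y * cis \<theta> * cnj (k y * cis \<theta>) * h = (cis \<theta> * cnj (cis \<theta>)) * (k y * cnj (k y) * h)" for h
        by simp
      then show ?thesis unfolding triv_circle[OF T y0] by (simp only: c1 k1 mult_1)
    qed
    moreover have "Im (Ln (cis \<theta>)) = \<theta>"
      using \<theta> by (simp add: cis_conv_exp Ln_exp)
    ultimately show ?thesis
      by (simp add: points_L1 \<kappa>_def cc triv_proj[OF T y0])
  qed
  have chart: "\<rho> z \<in> W \<inter> {q \<in> points (total L). H q q = 1} \<and> \<kappa> (\<rho> z) = z" if z: "z \<in> O'" for z
    using frame[OF invU(1)[OF z], of "snd z"] z invU(2)[OF z] by (auto simp: \<rho>_def cis_conv_exp O'_def)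
  have chart': "\<kappa> p \<in> O' \<and> \<rho> (\<kappa> p) = p" if p: "p \<in> W \<inter> {q \<in> points (total L). H q q = 1}" for p
  proof -
    have pU: "proj L p \<in> U" and Re: "Re (c p) > 0" and pL: "p \<in> points (total L)"
      using p by (auto simp: W_def E_def)
    have y0: "proj L p \<in> U0" using pU U(1) by blast
    have p_eq: "\<Phi> (proj L p, k (proj L p) * c p) = p"
      using triv_expand[OF T pL y0] knz[OF y0] by (simp add: c_def)
    \<comment> \<open>Comparing the unit length of \<open>p\<close> with that of the section over
      the same base point leaves modulus one for \<open>c p\<close>, so its logarithm is purely
      imaginary.\<close>
    have "(k (proj L p) * c p) * cnj (k (proj L p) * c p) * H (\<Phi> (proj L p, 1)) (\<Phi> (proj L p, 1)) = 1"
      using p triv_circle[OF T y0, of "k (proj L p) * c p"] unfolding p_eq by (simp add: points_L1)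
    moreover have "k (proj L p) * cnj (k (proj L p)) * H (\<Phi> (proj L p, 1)) (\<Phi> (proj L p, 1)) = 1"
      using k(3) y0 triv_circle[OF T y0] by blast
    moreover have "(k (proj L p) * c p) * cnj (k (proj L p) * c p) * h =
        (c p * cnj (c p)) * (k (proj L p) * cnj (k (proj L p)) * h)" for h
      by simp
    ultimately have "c p * cnj (c p) = 1" by (metis mult.right_neutral)
    then have "cmod (c p) = 1"
      by (metis complex_mod_cnj norm_mult norm_one power2_eq_square power2_eq_1_iff norm_ge_zero
          le_minus_one_simps(3) order.trans one_neq_neg_one)
    moreover have "c p \<noteq> 0" using Re by auto
    ultimately have "Ln (c p) = \<i> * complex_of_real (Im (Ln (c p)))"
      by (simp add: complex_eq_iff)
    then have "exp (\<i> * complex_of_real (Im (Ln (c p)))) = c p"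
      using \<open>c p \<noteq> 0\<close> exp_Ln by metis
    moreover have "\<bar>Im (Ln (c p))\<bar> < pi / 2"
      using Re_Ln_pos_lt[OF \<open>c p \<noteq> 0\<close>] Re by simp
    ultimately show ?thesis
      using pU U(2) p_eq chart_inv[OF X A(1), of "proj L p"] by (auto simp: \<kappa>_def \<rho>_def O'_def)
  qed
  define V where "V = W \<inter> {q \<in> points (total L). H q q = 1}"
  have VL1: "(V, \<kappa>) \<in> atlas L1"
    unfolding circle_bundle_def V_def
    by (rule submanifold_chartI(1)[OF total smooth_\<kappa> oO smooth_\<rho> chart chart'])
  have frame0: "u y \<in> V \<and> \<kappa> (u y) = (\<phi> y, 0)" if "y \<in> U" for y
    using frame[OF that, of 0] by (simp add: V_def u_def)
  have orbit: "orbit q \<theta> \<in> V \<and> \<kappa> (orbit q \<theta>) = (\<phi> (proj L q), \<theta>)" if "\<theta> \<in> {-pi/2<..<pi/2}" for \<theta>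
  proof -
    have "orbit q \<theta> = \<Phi> (proj L q, k (proj L q) * cis \<theta>)"
      using triv_fscale[OF T U0(1), of "cis \<theta>" "k (proj L q)"] k(2) by (simp add: mult.commute)
    then show ?thesis using frame[OF U(3) that] by (simp add: V_def)
  qed
  show thesis
  proof (rule that[of U u A \<phi> V \<kappa>])
    show "proj L q \<in> U" "(A, \<phi>) \<in> atlas X" "U \<subseteq> A" "(V, \<kappa>) \<in> atlas L1" by (fact U(3) A(1) U(2) VL1)+
    show "u (proj L q) = q" using k(2) by (simp add: u_def)
    then show "q \<in> V" using frame0[OF U(3)] by simp
    have "smooth_map X U (total L) u"
      unfolding u_def[abs_def] by (rule triv_section[OF T smooth_fun_subset[OF k(1) oU U(1)] U(1)])
    then show "smooth_map X U L1 u"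
      unfolding circle_bundle_def using frame0
      by (intro smooth_map_into_submanifold[OF X total]) (auto simp: V_def)
    show "\<forall>y\<in>U. proj L (u y) = y" using U(1) triv_proj[OF T] by (auto simp: u_def)
    show "\<forall>q'\<in>V. proj L q' \<in> U \<and> fst (\<kappa> q') = \<phi> (proj L q')"
      by (auto simp: V_def W_def E_def \<kappa>_def)
    show "\<forall>y\<in>U. u y \<in> V \<and> snd (\<kappa> (u y)) = 0" using frame0 by simp
    show "\<forall>\<theta>\<in>{-pi/2<..<pi/2}. orbit q \<theta> \<in> V \<and> snd (\<kappa> (orbit q \<theta>)) = \<theta>" using orbit by simp
  qed
qed

text \<open>The adapted charts cover the circle bundle, the one condition that a submanifold still
  has to meet.\<close>

lemma L1: "smooth_manifold L1"
  unfolding circle_bundle_def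
proof (rule smooth_manifold_submanifold[OF total])
  fix p assume "p \<in> points (total L)" "p \<in> {q \<in> points (total L). H q q = 1}"
  then have "p \<in> points L1" by (simp add: points_L1)
  then show "\<exists>V \<psi>. (V, \<psi>) \<in> atlas (submanifold (total L) {q \<in> points (total L). H q q = 1} :: ('l, 'e \<times> real) manifold) \<and> p \<in> V"
    (is ?P)
  proof (rule adapted_chart)
    fix V \<kappa> assume "(V, \<kappa>) \<in> atlas L1" "p \<in> V"
    then show ?P unfolding circle_bundle_def by blast
  qed
qed

lemma circle_inclusion: "smooth_map L1 (points L1) (total L) (\<lambda>q. q)"
  using smooth_map_submanifold_inclusion[OF total] by (simp add: circle_bundle_def)

lemma proj_L1: "smooth_map L1 (points L1) X (proj L)"
  using smooth_map_compose_total[OF L1 total circle_inclusion proj_total] by (simp add: points_L1)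

text \<open>Both sides are compared on the coordinates of the adapted chart. Base coordinates are
  unchanged by \<open>u\<close> after \<open>proj L\<close> and constant along the orbit; the angle
  vanishes along \<open>u\<close> and has derivative \<open>1\<close> along the orbit. Hence
  \<open>l\<close> is the value of \<open>v\<close> on the angle. The section \<open>u\<close> is
  chosen before \<open>v\<close>, so it serves all vectors at \<open>q\<close>.\<close>

lemma tangent_decomposition:
  assumes q: "q \<in> points L1"
  obtains U u where "proj L q \<in> U" "smooth_map X U L1 u" "\<forall>y\<in>U. proj L (u y) = y" "u (proj L q) = q"
    "\<forall>v\<in>complex_tangent_space L1 q. \<exists>l. v = (\<lambda>f. pushforward L1 u (proj L q) (pushforward X (proj L) q v) f +
      l * velocity L1 (orbit q) 0 f)"
proof -
  obtain U u A \<phi> V \<kappa> where U: "proj L q \<in> U" and u: "smooth_map X U L1 u" "\<forall>y\<in>U. proj L (u y) = y"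
      "u (proj L q) = q" and A: "(A, \<phi>) \<in> atlas X" "U \<subseteq> A" and V: "(V, \<kappa>) \<in> atlas L1" "q \<in> V"
    and \<kappa>1: "\<forall>q'\<in>V. proj L q' \<in> U \<and> fst (\<kappa> q') = \<phi> (proj L q')"
    and \<kappa>2: "\<forall>y\<in>U. u y \<in> V \<and> snd (\<kappa> (u y)) = 0"
    and \<kappa>3: "\<forall>\<theta>\<in>{-pi/2<..<pi/2}. orbit q \<theta> \<in> V \<and> snd (\<kappa> (orbit q \<theta>)) = \<theta>"
    by (rule adapted_chart[OF q])
  have orbit0: "orbit q 0 = q" using fscale_one[OF q] by simp
  have vel: "velocity L1 (orbit q) 0 \<in> complex_tangent_space L1 q"
    using velocity_in_tangent[OF L1 orbit_smooth_L1[OF q], of 0] unfolding orbit0 .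
  have smooth_coord: "smooth_fun L1 V (\<lambda>p. complex_of_real (\<kappa> p \<bullet> b))" for b
    using smooth_fun_bounded_linear[OF L1 bounded_linear_compose[OF bounded_linear_of_real
          bounded_linear_inner_left] chart_smooth_fun[OF L1 V(1)]] .
  have "\<exists>l. v = (\<lambda>f. pushforward L1 u (proj L q) (pushforward X (proj L) q v) f +
      l * velocity L1 (orbit q) 0 f)" if v: "v \<in> complex_tangent_space L1 q" for v
  proof
    let ?\<theta> = "\<lambda>p. complex_of_real (\<kappa> p \<bullet> (0, 1))"
    let ?h = "pushforward L1 u (proj L q) (pushforward X (proj L) q v)"
    let ?r = "\<lambda>f. ?h f + v ?\<theta> * velocity L1 (orbit q) 0 f"
    have tv: "pushforward X (proj L) q v \<in> complex_tangent_space X (proj L q)"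
      by (rule pushforward_in_tangent[OF L1 X proj_L1 q v])
    have h: "?h \<in> complex_tangent_space L1 q"
      using pushforward_in_tangent[OF X L1 u(1) U tv] unfolding u(3) .
    have r: "?r \<in> complex_tangent_space L1 q"
      by (rule complex_tangent_add[OF L1 q h complex_tangent_scale[OF L1 q vel]])
    have happly: "?h f = v (\<lambda>p. f (u (proj L p)))" if f: "smooth_fun L1 V f" for f
    proof -
      have "smooth_near L1 (u (proj L q)) f"
        using f V(2) unfolding u(3) by (rule smooth_nearI)
      moreover have "smooth_near X (proj L q) (\<lambda>y. f (u y))"
        by (rule smooth_nearI[OF smooth_fun_compose[OF X L1 u(1) f]]) (use U \<kappa>2 in auto)
      ultimately show ?thesis by (simp add: pushforward_apply)
    qed
    have velocity_apply: "velocity L1 (orbit q) 0 f = vector_derivative (\<lambda>\<theta>. f (orbit q \<theta>)) (at 0)"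
      if "smooth_fun L1 V f" for f
      using smooth_nearI[OF that V(2)] orbit0 by (simp add: velocity_def o_def)
    show "v = ?r"
    proof (rule complex_tangent_eqI[OF L1 v r V])
      fix b :: "'e \<times> real" assume "b \<in> Basis"
      then consider b1 where "b = (b1, 0)" | "b = (0, 1)"
        by (auto simp: Basis_prod_def)
      then show "v (\<lambda>p. complex_of_real (\<kappa> p \<bullet> b)) = ?r (\<lambda>p. complex_of_real (\<kappa> p \<bullet> b))"
      proof cases
        case 1
        have "v (\<lambda>p. complex_of_real (\<kappa> p \<bullet> b)) = v (\<lambda>p. complex_of_real (\<kappa> (u (proj L p)) \<bullet> b))"
        proof (rule complex_tangent_cong[OF L1 q v smooth_coord V(2)])
          fix p assume p: "p \<in> V"
          then have "proj L p \<in> U" "fst (\<kappa> p) = \<phi> (proj L p)" using \<kappa>1 by auto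
          moreover then have "fst (\<kappa> (u (proj L p))) = \<phi> (proj L p)" using \<kappa>1 \<kappa>2 u(2) by metis
          ultimately show "complex_of_real (\<kappa> p \<bullet> b) = complex_of_real (\<kappa> (u (proj L p)) \<bullet> b)"
            by (simp add: 1 inner_prod_def)
        qed
        moreover have "velocity L1 (orbit q) 0 (\<lambda>p. complex_of_real (\<kappa> p \<bullet> b)) = 0"
        proof -
          have "((\<lambda>\<theta>. complex_of_real (\<kappa> (orbit q \<theta>) \<bullet> b)) has_vector_derivative 0) (at 0)"
          proof (rule has_vector_derivative_transform_within_open[of "\<lambda>\<theta>. complex_of_real (\<phi> (proj L q) \<bullet> b1)"])
            fix \<theta> :: real assume "\<theta> \<in> {-pi/2<..<pi/2}"
            then have "fst (\<kappa> (orbit q \<theta>)) = \<phi> (proj L q)"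
              using \<kappa>1 \<kappa>3 proj_fscale[OF q] by metis
            then show "complex_of_real (\<phi> (proj L q) \<bullet> b1) = complex_of_real (\<kappa> (orbit q \<theta>) \<bullet> b)"
              by (simp add: 1 inner_prod_def)
          qed auto
          then show ?thesis
            unfolding velocity_apply[OF smooth_coord] by (rule vector_derivative_at)
        qed
        ultimately show ?thesis
          using happly[OF smooth_coord] by simp
      next
        case 2
        have "?h ?\<theta> = v (\<lambda>p. ?\<theta> (u (proj L p)))" by (rule happly[OF smooth_coord])
        also have "\<dots> = v (\<lambda>p. 0)"
        proof (rule complex_tangent_cong[OF L1 q v _ V(2), symmetric])
          show "smooth_fun L1 V (\<lambda>p. 0 :: complex)"
            by (rule smooth_fun_const[OF chart_openin[OF L1 V(1)]])
          show "0 = ?\<theta> (u (proj L p))" if "p \<in> V" for p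
            using that \<kappa>1 \<kappa>2 by (simp add: inner_prod_def)
        qed
        also have "\<dots> = 0" by (rule complex_tangent_const[OF L1 q v])
        finally have h0: "?h ?\<theta> = 0" .
        have "((\<lambda>\<theta>. ?\<theta> (orbit q \<theta>)) has_vector_derivative 1) (at 0)"
        proof (rule has_vector_derivative_transform_within_open[of complex_of_real])
          show "(complex_of_real has_vector_derivative 1) (at 0)"
            using has_vector_derivative_of_real[OF DERIV_ident] by simp
          show "complex_of_real \<theta> = ?\<theta> (orbit q \<theta>)" if "\<theta> \<in> {-pi/2<..<pi/2}" for \<theta>
            using that \<kappa>3 by (simp add: inner_prod_def)
        qed auto
        then have "velocity L1 (orbit q) 0 ?\<theta> = 1"
          unfolding velocity_apply[OF smooth_coord] by (rule vector_derivative_at)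
        then show ?thesis
          unfolding 2 using h0 by simp
      qed
    qed
  qed
  then show thesis using that[OF U u] by blast
qed

end

section \<open>The induced symplectic manifold\<close>

locale prequantum_bundle = hermitian_line_bundle X L H
  for X :: "('x, 'e::euclidean_space) manifold" and L :: "('l, 'x, 'e) line_bundle"
    and H :: "'l \<Rightarrow> 'l \<Rightarrow> complex" +
  fixes \<omega> :: "'x form2" and D :: "('l, 'x) covariant_derivative" and \<alpha> :: "'l form1"
  assumes symplectic: "symplectic_manifold X \<omega>" and conn: "connection X L D"
    and conn_form: "connection_form X L D H \<alpha>"
begin

abbreviation Xi :: "('l \<times> real, ('e \<times> real) \<times> real) manifold" where
  "Xi \<equiv> induced_manifold L H"

abbreviation \<Omega> :: "('l \<times> real) form2" where
  "\<Omega> \<equiv> induced_form X \<omega> L H \<alpha>"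

abbreviation radius :: "'l \<times> real \<Rightarrow> complex" where
  "radius z \<equiv> complex_of_real (snd z)"

abbreviation push_fibre :: "'l \<times> real \<Rightarrow> ('l \<times> real) tvec \<Rightarrow> 'l tvec" where
  "push_fibre z \<equiv> pushforward L1 fst z"

abbreviation push_base :: "'l \<Rightarrow> 'l tvec \<Rightarrow> 'x tvec" where
  "push_base q \<equiv> pushforward X (proj L) q"

abbreviation vertical :: "'l \<Rightarrow> 'l tvec" where
  "vertical q \<equiv> velocity L1 (orbit q) 0"

lemma half_line: "smooth_manifold (open_manifold {0::real<..})"
  by (rule smooth_manifold_open_manifold) simp

lemma Xi: "smooth_manifold Xi"
  unfolding induced_manifold_def by (rule smooth_manifold_prod_manifold[OF L1 half_line])

lemma points_Xi: "points Xi = points L1 \<times> {0<..}"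
  by (simp add: induced_manifold_def)

lemma fst_Xi: "smooth_map Xi (points Xi) L1 fst"
  unfolding induced_manifold_def by (rule smooth_map_fst[OF L1 half_line])

lemma radius_smooth: "smooth_fun Xi (points Xi) radius"
proof -
  have "smooth_map Xi (points Xi) (open_manifold {0<..}) snd"
    unfolding induced_manifold_def by (rule smooth_map_snd[OF L1 half_line])
  then have "smooth_fun Xi (points Xi) snd"
    by (simp add: smooth_map_into_open_manifold)
  then show ?thesis
    by (rule smooth_fun_bounded_linear[OF Xi bounded_linear_of_real])
qed

lemma fst_points: "z \<in> points Xi \<Longrightarrow> fst z \<in> points L1"
  by (auto simp: points_Xi)

lemma snd_points: "z \<in> points Xi \<Longrightarrow> snd z > 0"
  by (auto simp: points_Xi)

lemma induced_form_apply:
  "\<Omega> z v w = v radius * \<alpha> (fst z) (push_fibre z w) - w radius * \<alpha> (fst z) (push_fibre z v) +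
    radius z * \<omega> (proj L (fst z)) (push_base (fst z) (push_fibre z v)) (push_base (fst z) (push_fibre z w))"
  by (simp add: induced_form_def wedge_def differential_def pullback1_def pullback2_def Let_def)

lemma \<alpha>: "smooth_linear_form L1 \<alpha>"
  using conn_form unfolding connection_form_def Let_def by (blast intro: one_form_smooth_linear_form)

lemma \<alpha>_linear: "q \<in> points L1 \<Longrightarrow> complex_linear_on (complex_tangent_space L1 q) (\<alpha> q)"
  using \<alpha> unfolding smooth_linear_form_def by blast

lemma \<omega>: "smooth_bilinear_form X \<omega>"
  using symplectic unfolding symplectic_manifold_def by (blast intro: two_form_smooth_bilinear_form)

lemma \<omega>_linear:
  assumes "x \<in> points X" "v \<in> complex_tangent_space X x"
  shows "complex_linear_on (complex_tangent_space X x) (\<omega> x v)"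
    "complex_linear_on (complex_tangent_space X x) (\<lambda>w. \<omega> x w v)"
  using \<omega> assms unfolding smooth_bilinear_form_def by blast+

lemma \<Omega>: "smooth_bilinear_form Xi \<Omega>"
  unfolding induced_form_def Let_def
  by (intro smooth_bilinear_form_add_mult[OF Xi _ _ radius_smooth] smooth_bilinear_form_wedge[OF Xi]
      smooth_linear_form_differential[OF radius_smooth] smooth_linear_form_pullback1[OF Xi L1 fst_Xi \<alpha>]
      smooth_bilinear_form_pullback2[OF Xi L1 fst_Xi] smooth_bilinear_form_pullback2[OF L1 X proj_L1 \<omega>])

lemma vertical_tangent:
  assumes "q \<in> points L1"
  shows "vertical q \<in> complex_tangent_space L1 q"
  using velocity_in_tangent[OF L1 orbit_smooth_L1[OF assms], of 0] fscale_one[OF assms] by simp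

lemma \<alpha>_vertical:
  assumes "q \<in> points L1"
  shows "\<alpha> q (vertical q) = complex_of_real (1 / (2 * pi))"
proof -
  have "\<alpha> (fscale L (cis 0) q) (velocity L1 (\<lambda>\<theta>. fscale L (cis \<theta>) q) 0) = complex_of_real (1 / (2 * pi))"
    using conn_form assms unfolding connection_form_def Let_def by blast
  then show ?thesis using fscale_one[OF assms] by simp
qed

text \<open>A function pulled back from \<open>X\<close> is constant along an orbit.\<close>

lemma push_base_vertical:
  assumes "q \<in> points L1"
  shows "push_base q (vertical q) = (\<lambda>f. 0)"
proof
  fix f :: "'x \<Rightarrow> complex"
  have "(f \<circ> proj L) \<circ> orbit q = (\<lambda>\<theta>. f (proj L q))"
    by (auto simp: proj_fscale[OF assms])
  then show "push_base q (vertical q) f = 0"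
    by (simp add: pushforward_def velocity_def)
qed

lemma push_fibre_tangent:
  "z \<in> points Xi \<Longrightarrow> v \<in> complex_tangent_space Xi z \<Longrightarrow> push_fibre z v \<in> complex_tangent_space L1 (fst z)"
  using pushforward_in_tangent[OF Xi L1 fst_Xi] .

lemma push_base_tangent:
  "q \<in> points L1 \<Longrightarrow> v \<in> complex_tangent_space L1 q \<Longrightarrow> push_base q v \<in> complex_tangent_space X (proj L q)"
  using pushforward_in_tangent[OF L1 X proj_L1] .

text \<open>The slice of constant radius through \<open>z\<close> is a copy of the circle bundle:
  \<open>fst\<close> restricts to the identity on it, and the radius is constant along it.\<close>

lemma tangent_lift:
  assumes z: "z \<in> points Xi" and v: "v \<in> complex_tangent_space L1 (fst z)"
  obtains w where "w \<in> complex_tangent_space Xi z" "w radius = 0" "push_fibre z w = v"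
proof -
  let ?i = "\<lambda>q. (q, snd z)" and ?q = "fst z"
  note q = fst_points[OF z]
  have o: "openin (mtop L1) (points L1)" by simp
  have i: "smooth_map L1 (points L1) Xi ?i"
    unfolding induced_manifold_def using snd_points[OF z]
    by (intro smooth_map_Pair[OF L1 L1 half_line smooth_map_ident[OF L1] smooth_map_const[OF L1 o]]) simp
  show thesis
  proof (rule that)
    show "pushforward Xi ?i ?q v \<in> complex_tangent_space Xi z"
      using pushforward_in_tangent[OF L1 Xi i q v] by simp
    have "smooth_near Xi z radius"
      by (rule smooth_nearI[OF radius_smooth z])
    then have "pushforward Xi ?i ?q v radius = v (\<lambda>q. complex_of_real (snd z))"
      by (simp add: pushforward_apply)
    then show "pushforward Xi ?i ?q v radius = 0"
      using complex_tangent_const[OF L1 q v] by simp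
    have "push_fibre (?i ?q) (pushforward Xi ?i ?q v) = pushforward L1 (\<lambda>q. fst (?i q)) ?q v"
      by (rule pushforward_compose[OF L1 Xi L1 i q fst_Xi]) (use z in simp)
    then show "push_fibre z (pushforward Xi ?i ?q v) = v"
      using pushforward_ident[OF L1 q v] by simp
  qed
qed

text \<open>The unit vector of the half-line, pushed along the ray over \<open>fst z\<close>, on
  which \<open>fst\<close> is constant.\<close>

lemma radial_vector:
  assumes z: "z \<in> points Xi"
  obtains w where "w \<in> complex_tangent_space Xi z" "w radius = 1" "push_fibre z w = (\<lambda>f. 0)"
proof -
  let ?R = "open_manifold {0::real<..}" and ?i = "\<lambda>s. (fst z, s)"
  let ?d = "chart_vector ?R {0<..} (\<lambda>x. x) (snd z) (\<lambda>b. 1)"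
  note t = snd_points[OF z]
  have chart: "({0<..}, \<lambda>x. x) \<in> atlas ?R" by simp
  have tp: "snd z \<in> {0<..}" "snd z \<in> points ?R" using t by auto
  have o: "openin (mtop ?R) {0<..}" by simp
  have ident: "smooth_map ?R {0<..} ?R (\<lambda>s. s)"
    using smooth_map_ident[OF half_line] by simp
  have i: "smooth_map ?R {0<..} Xi ?i"
    unfolding induced_manifold_def
    by (rule smooth_map_Pair[OF half_line L1 half_line smooth_map_const[OF half_line o fst_points[OF z]] ident])
  have d: "?d \<in> complex_tangent_space ?R (snd z)"
    unfolding complex_tangent_space_eq[OF half_line chart tp(1)] by (rule rangeI)
  show thesis
  proof (rule that)
    show "pushforward Xi ?i (snd z) ?d \<in> complex_tangent_space Xi z"
      using pushforward_in_tangent[OF half_line Xi i tp(1) d] by simp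
    have "smooth_near Xi z radius"
      by (rule smooth_nearI[OF radius_smooth z])
    then have "pushforward Xi ?i (snd z) ?d radius = ?d (\<lambda>s. complex_of_real s)"
      by (simp add: pushforward_apply)
    also have "\<dots> = 1"
      using chart_vector_coordinate[OF half_line chart tp(1), of 1 "\<lambda>b. 1"] by simp
    finally show "pushforward Xi ?i (snd z) ?d radius = 1" .
    have "push_fibre (?i (snd z)) (pushforward Xi ?i (snd z) ?d) = pushforward L1 (\<lambda>s. fst (?i s)) (snd z) ?d"
      by (rule pushforward_compose[OF half_line Xi L1 i tp(1) fst_Xi]) (use z in simp)
    then show "push_fibre z (pushforward Xi ?i (snd z) ?d) = (\<lambda>f. 0)"
      using pushforward_const[OF half_line tp(2) d, of L1 "fst z"] by simp
  qed
qed

text \<open>The coordinates of a product chart are those of \<open>fst\<close> together with the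
  radius, and a vector that annihilates all coordinates is zero.\<close>

lemma tangent_eq_zeroI:
  assumes z: "z \<in> points Xi" and v: "v \<in> complex_tangent_space Xi z"
    and v_radius: "v radius = 0" and v_fibre: "push_fibre z v = (\<lambda>f. 0)"
  shows "v = (\<lambda>f. 0)"
proof -
  obtain V \<kappa> where V: "(V, \<kappa>) \<in> atlas L1" "fst z \<in> V"
    using chart_cover[OF L1 fst_points[OF z]] .
  have chart: "(V \<times> {0<..}, map_prod \<kappa> (\<lambda>x. x)) \<in> atlas Xi"
    using V(1) by (auto simp: induced_manifold_def atlas_prod_manifold)
  show ?thesis
  proof (rule complex_tangent_eqI[OF Xi v complex_tangent_zero[OF Xi z] chart])
    show "z \<in> V \<times> {0<..}" using V(2) snd_points[OF z] by (simp add: mem_Times_iff)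
    fix b :: "('e \<times> real) \<times> real" assume "b \<in> Basis"
    then consider b1 where "b = (b1, 0)" | "b = (0, 1)"
      by (auto simp: Basis_prod_def)
    then show "v (\<lambda>q. complex_of_real (map_prod \<kappa> (\<lambda>x. x) q \<bullet> b)) = 0"
    proof cases
      case 1
      have "smooth_fun L1 V (\<lambda>p. complex_of_real (\<kappa> p \<bullet> b1))"
        using smooth_fun_bounded_linear[OF L1 bounded_linear_compose[OF bounded_linear_of_real
              bounded_linear_inner_left] chart_smooth_fun[OF L1 V(1)]] .
      then have "smooth_near L1 (fst z) (\<lambda>p. complex_of_real (\<kappa> p \<bullet> b1))"
        using V(2) by (rule smooth_nearI)
      then have "push_fibre z v (\<lambda>p. complex_of_real (\<kappa> p \<bullet> b1)) = v (\<lambda>q. complex_of_real (\<kappa> (fst q) \<bullet> b1))"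
        by (simp add: pushforward_apply)
      then show ?thesis
        unfolding v_fibre 1 by (simp add: inner_prod_def)
    next
      case 2
      then show ?thesis using v_radius by (simp add: inner_prod_def)
    qed
  qed
qed

lemma \<alpha>_zero: "q \<in> points L1 \<Longrightarrow> \<alpha> q (\<lambda>f. 0) = 0"
  using complex_linear_on_zero[OF \<alpha>_linear complex_tangent_zero[OF L1]] by blast

lemma \<omega>_zero: "x \<in> points X \<Longrightarrow> v \<in> complex_tangent_space X x \<Longrightarrow> \<omega> x v (\<lambda>f. 0) = 0"
  using complex_linear_on_zero[OF \<omega>_linear(1) complex_tangent_zero[OF X]] by blast

lemma pushforward_zero: "pushforward N F p (\<lambda>f. 0) = (\<lambda>g. 0)"
  by (auto simp: pushforward_def)

text \<open>Since \<open>proj L\<close> after \<open>u\<close> is the identity on \<open>U\<close>,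
  the push along \<open>u\<close> is undone by the push to the base.\<close>

lemma section_push_base:
  assumes q: "q \<in> points L1" and U: "proj L q \<in> U" "smooth_map X U L1 u" "\<forall>y\<in>U. proj L (u y) = y"
      "u (proj L q) = q"
    and y: "y \<in> complex_tangent_space X (proj L q)"
  shows "pushforward L1 u (proj L q) y \<in> complex_tangent_space L1 q"
    "push_base q (pushforward L1 u (proj L q) y) = y"
proof -
  show "pushforward L1 u (proj L q) y \<in> complex_tangent_space L1 q"
    using pushforward_in_tangent[OF X L1 U(2,1) y] unfolding U(4) .
  have "push_base (u (proj L q)) (pushforward L1 u (proj L q) y) =
      pushforward X (\<lambda>x. proj L (u x)) (proj L q) y"
    by (rule pushforward_compose[OF X L1 X U(2,1) proj_L1]) (use q U(4) in simp)
  also have "\<dots> = pushforward X (\<lambda>x. x) (proj L q) y"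
  proof (rule pushforward_cong[OF X X _ U(1) y, symmetric])
    show "smooth_map X U X (\<lambda>x. x)"
      using smooth_map_openin[OF U(2)] openin_subset
      by (intro smooth_map_subset[OF smooth_map_ident[OF X]]) auto
  qed (use U(3) in auto)
  also have "\<dots> = y"
    by (rule pushforward_ident[OF X proj_points[OF q] y])
  finally show "push_base q (pushforward L1 u (proj L q) y) = y"
    unfolding U(4) .
qed

lemma base_nondegenerate:
  "x \<in> points X \<Longrightarrow> v \<in> complex_tangent_space X x \<Longrightarrow>
    (\<And>w. w \<in> complex_tangent_space X x \<Longrightarrow> \<omega> x v w = 0) \<Longrightarrow> v = (\<lambda>f. 0)"
  using symplectic_nondegenerate[OF symplectic] .

text \<open>The lift is the push along a local unit section, at constant radius. It need not be
  annihilated by \<open>\<alpha>\<close>: it is paired only with vectors that have no radial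
  component either, and then both terms of the wedge vanish.\<close>

lemma horizontal_test:
  assumes z: "z \<in> points Xi" and y: "y \<in> complex_tangent_space X (proj L (fst z))"
  obtains w where "w \<in> complex_tangent_space Xi z" "w radius = 0" "push_base (fst z) (push_fibre z w) = y"
proof -
  note q = fst_points[OF z]
  obtain U u where U: "proj L (fst z) \<in> U" "smooth_map X U L1 u" "\<forall>y\<in>U. proj L (u y) = y"
      "u (proj L (fst z)) = fst z"
    and "\<forall>v\<in>complex_tangent_space L1 (fst z). \<exists>l. v = (\<lambda>f.
      pushforward L1 u (proj L (fst z)) (push_base (fst z) v) f + l * vertical (fst z) f)"
    using tangent_decomposition[OF q] .
  obtain w where "w \<in> complex_tangent_space Xi z" "w radius = 0"
    "push_fibre z w = pushforward L1 u (proj L (fst z)) y"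
    using tangent_lift[OF z section_push_base(1)[OF q U y]] .
  then show thesis
    using section_push_base(2)[OF q U y] that by simp
qed

lemma vertical_test:
  assumes z: "z \<in> points Xi"
  obtains w where "w \<in> complex_tangent_space Xi z" "w radius = 0" "push_fibre z w = vertical (fst z)"
  using tangent_lift[OF z vertical_tangent[OF fst_points[OF z]]] .

text \<open>The three kinds of test vector with right-hand side \<open>0\<close>. The radial one
  yields \<open>\<alpha>(v) = 0\<close>; the generator yields \<open>v radius = 0\<close>, which
  must be known before a horizontal test isolates \<open>\<omega>\<close>. Once the image in
  \<open>X\<close> is zero, \<open>l\<close> times the generator remains, and
  \<open>\<alpha>(v) = l / (2 pi)\<close> gives \<open>l = 0\<close>.\<close>

lemma induced_nondegenerate:
  assumes z: "z \<in> points Xi" and v: "v \<in> complex_tangent_space Xi z"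
    and \<Omega>0: "\<And>w. w \<in> complex_tangent_space Xi z \<Longrightarrow> \<Omega> z v w = 0"
  shows "v = (\<lambda>f. 0)"
proof -
  let ?q = "fst z" and ?x = "proj L (fst z)"
  note q = fst_points[OF z] and Pv = push_fibre_tangent[OF z v]
  note x = proj_points[OF q] and TPv = push_base_tangent[OF q Pv]
  obtain w where w: "w \<in> complex_tangent_space Xi z" "w radius = 1" "push_fibre z w = (\<lambda>f. 0)"
    using radial_vector[OF z] .
  have a: "\<alpha> ?q (push_fibre z v) = 0"
    using \<Omega>0[OF w(1)]
    by (simp add: induced_form_apply w(2,3) \<alpha>_zero[OF q] pushforward_zero \<omega>_zero[OF x TPv])
  obtain w where w: "w \<in> complex_tangent_space Xi z" "w radius = 0" "push_fibre z w = vertical ?q"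
    using vertical_test[OF z] .
  have r: "v radius = 0"
    using \<Omega>0[OF w(1)]
    by (simp add: induced_form_apply w(2,3) \<alpha>_vertical[OF q] push_base_vertical[OF q] \<omega>_zero[OF x TPv])
  have TP0: "push_base ?q (push_fibre z v) = (\<lambda>f. 0)"
  proof (rule base_nondegenerate[OF x TPv])
    fix y assume "y \<in> complex_tangent_space X ?x"
    then obtain w where w: "w \<in> complex_tangent_space Xi z" "w radius = 0"
      "push_base ?q (push_fibre z w) = y"
      using horizontal_test[OF z] by metis
    show "\<omega> ?x (push_base ?q (push_fibre z v)) y = 0"
      using \<Omega>0[OF w(1)] snd_points[OF z] by (simp add: induced_form_apply w(2,3) r a)
  qed
  obtain U u where "?x \<in> U" "smooth_map X U L1 u" "\<forall>y\<in>U. proj L (u y) = y" "u ?x = ?q"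
    and "\<forall>v\<in>complex_tangent_space L1 ?q.
      \<exists>l. v = (\<lambda>f. pushforward L1 u ?x (push_base ?q v) f + l * vertical ?q f)"
    using tangent_decomposition[OF q] .
  then obtain l where l: "push_fibre z v = (\<lambda>f. l * vertical ?q f)"
    using Pv TP0 by (fastforce simp: pushforward_zero)
  then have "\<alpha> ?q (push_fibre z v) = l * complex_of_real (1 / (2 * pi))"
    using complex_linear_on_scale[OF \<alpha>_linear[OF q] vertical_tangent[OF q]] \<alpha>_vertical[OF q] by simp
  then have "l = 0" using a by simp
  then show ?thesis
    using l by (intro tangent_eq_zeroI[OF z v r]) simp
qed

lemmas base_hamiltonian = hamiltonian_field[OF X \<omega> base_nondegenerate]

lemmas induced_hamiltonian = hamiltonian_field[OF Xi \<Omega> induced_nondegenerate]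

section \<open>Lifts of functions and their Hamiltonian fields\<close>

lemma smooth_functionsD: "f \<in> smooth_functions M \<Longrightarrow> smooth_fun M (points M) f"
  by (simp add: smooth_functions_def)

lemma base_function_smooth:
  assumes "\<phi> \<in> smooth_functions X"
  shows "smooth_fun L1 (points L1) (\<lambda>q. \<phi> (proj L q))"
    "smooth_fun Xi (points Xi) (\<lambda>z. \<phi> (proj L (fst z)))"
proof -
  show s: "smooth_fun L1 (points L1) (\<lambda>q. \<phi> (proj L q))"
    by (rule smooth_fun_compose_total[OF L1 X proj_L1 smooth_functionsD[OF assms]])
      (use proj_points in auto)
  show "smooth_fun Xi (points Xi) (\<lambda>z. \<phi> (proj L (fst z)))"
    by (rule smooth_fun_compose_total[OF Xi L1 fst_Xi s]) (use fst_points in auto)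
qed

lemma function_lift_apply: "z \<in> points Xi \<Longrightarrow> function_lift L H \<phi> z = radius z * \<phi> (proj L (fst z))"
  by (simp add: function_lift_def on_induced_def split_def)

lemma function_lift_outside: "z \<notin> points Xi \<Longrightarrow> function_lift L H \<phi> z = 0"
  by (simp add: function_lift_def on_induced_def)

lemma function_lift_smooth:
  assumes "\<phi> \<in> smooth_functions X"
  shows "function_lift L H \<phi> \<in> smooth_functions Xi"
proof -
  have "smooth_fun Xi (points Xi) (\<lambda>z. radius z * \<phi> (proj L (fst z)))"
    by (rule smooth_fun_mult[OF Xi radius_smooth base_function_smooth(2)[OF assms]])
  then have "smooth_fun Xi (points Xi) (function_lift L H \<phi>)"
    using smooth_fun_cong[OF Xi, of "points Xi" "function_lift L H \<phi>"] function_lift_apply by simp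
  then show ?thesis
    by (simp add: smooth_functions_def function_lift_outside)
qed

text \<open>The Leibniz rule for the radius times the pulled back function.\<close>

lemma tangent_function_lift:
  assumes z: "z \<in> points Xi" and v: "v \<in> complex_tangent_space Xi z" and \<phi>: "\<phi> \<in> smooth_functions X"
  shows "v (function_lift L H \<phi>) =
    v radius * \<phi> (proj L (fst z)) + radius z * push_base (fst z) (push_fibre z v) \<phi>"
proof -
  have "v (function_lift L H \<phi>) = v (\<lambda>z. radius z * \<phi> (proj L (fst z)))"
    by (rule complex_tangent_cong[OF Xi z v smooth_functionsD[OF function_lift_smooth[OF \<phi>]] z])
      (rule function_lift_apply)
  also have "\<dots> = v radius * \<phi> (proj L (fst z)) + radius z * v (\<lambda>z. \<phi> (proj L (fst z)))"
    by (rule complex_tangent_mult[OF Xi z v radius_smooth base_function_smooth(2)[OF \<phi>] z])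
  also have "v (\<lambda>z. \<phi> (proj L (fst z))) = push_base (fst z) (push_fibre z v) \<phi>"
  proof -
    have "smooth_near X (proj L (fst z)) \<phi>"
      by (rule smooth_nearI[OF smooth_functionsD[OF \<phi>] proj_points[OF fst_points[OF z]]])
    moreover have "smooth_near L1 (fst z) (\<lambda>q. \<phi> (proj L q))"
      by (rule smooth_nearI[OF base_function_smooth(1)[OF \<phi>] fst_points[OF z]])
    ultimately show ?thesis by (simp add: pushforward_apply)
  qed
  finally show ?thesis .
qed

lemma lift_hamiltonian:
  assumes z: "z \<in> points Xi" and \<phi>: "\<phi> \<in> smooth_functions X"
  defines "\<xi> \<equiv> hamiltonian_field Xi \<Omega> (function_lift L H \<phi>) z"
  shows "\<xi> \<in> complex_tangent_space Xi z" "\<xi> radius = 0"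
    "\<alpha> (fst z) (push_fibre z \<xi>) = - \<phi> (proj L (fst z))"
    "push_base (fst z) (push_fibre z \<xi>) = hamiltonian_field X \<omega> \<phi> (proj L (fst z))"
proof -
  let ?q = "fst z" and ?x = "proj L (fst z)"
  note ham = induced_hamiltonian[OF _ _ _ smooth_functionsD[OF function_lift_smooth[OF \<phi>]]]
  note q = fst_points[OF z]
  note x = proj_points[OF q]
  show \<xi>: "\<xi> \<in> complex_tangent_space Xi z"
    unfolding \<xi>_def by (rule vector_field_tangent[OF ham(1) z])
  have eq: "\<Omega> z \<xi> w = w radius * \<phi> ?x + radius z * push_base ?q (push_fibre z w) \<phi>"
    if "w \<in> complex_tangent_space Xi z" for w
    unfolding \<xi>_def using ham(2)[OF _ _ _ z that] tangent_function_lift[OF z that \<phi>] by simp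
  note TP\<xi> = push_base_tangent[OF q push_fibre_tangent[OF z \<xi>]]
  \<comment> \<open>Radial test: the left side is \<open>- \<alpha>(\<xi>)\<close>, the right side
    \<open>\<phi>\<close>.\<close>
  obtain w where w: "w \<in> complex_tangent_space Xi z" "w radius = 1" "push_fibre z w = (\<lambda>f. 0)"
    using radial_vector[OF z] .
  show a: "\<alpha> ?q (push_fibre z \<xi>) = - \<phi> ?x"
    using eq[OF w(1)]
    by (simp add: induced_form_apply w(2,3) \<alpha>_zero[OF q] pushforward_zero \<omega>_zero[OF x TP\<xi>])
      (metis minus_minus)
  \<comment> \<open>Vertical test: the lift is invariant under rotation, so the right side is
    \<open>0\<close>, while the left side is the radial component of \<open>\<xi>\<close> divided by
    \<open>2 pi\<close>.\<close>
  obtain w where w: "w \<in> complex_tangent_space Xi z" "w radius = 0" "push_fibre z w = vertical ?q"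
    using vertical_test[OF z] .
  show r: "\<xi> radius = 0"
    using eq[OF w(1)]
    by (simp add: induced_form_apply w(2,3) \<alpha>_vertical[OF q] push_base_vertical[OF q] \<omega>_zero[OF x TP\<xi>])
  note ham_X = base_hamiltonian[OF _ _ _ smooth_functionsD[OF \<phi>]]
  show "push_base ?q (push_fibre z \<xi>) = hamiltonian_field X \<omega> \<phi> ?x"
  proof (rule nondegenerate_eqI[OF X \<omega> x base_nondegenerate[OF x] TP\<xi> vector_field_tangent[OF ham_X(1) x]])
    \<comment> \<open>Horizontal test: both sides carry the radius as a factor, which is positive
      and cancels.\<close>
    fix y assume y: "y \<in> complex_tangent_space X ?x"
    then obtain w where w: "w \<in> complex_tangent_space Xi z" "w radius = 0"
      "push_base ?q (push_fibre z w) = y"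
      using horizontal_test[OF z] by metis
    show "\<omega> ?x (push_base ?q (push_fibre z \<xi>)) y = \<omega> ?x (hamiltonian_field X \<omega> \<phi> ?x) y"
      using eq[OF w(1)] snd_points[OF z] ham_X(2)[OF _ _ _ x y] by (simp add: induced_form_apply w(2,3) r)
  qed
qed

text \<open>Without radial component, the Leibniz rule leaves the radius times the image of the
  Hamiltonian vector in \<open>X\<close>, applied to \<open>g\<close>. Injectivity is read off at
  radius \<open>1\<close>. Off the induced manifold both sides of the bracket identity are
  normalised to \<open>0\<close>.\<close>

lemma poisson_monomorphism_lift: "poisson_monomorphism X \<omega> Xi \<Omega> (function_lift L H)"
  unfolding poisson_monomorphism_def
proof (intro conjI ballI allI)
  show "function_lift L H ` smooth_functions X \<subseteq> smooth_functions Xi"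
    using function_lift_smooth by blast
  show "function_lift L H (\<lambda>p. a * f p + b * g p) = (\<lambda>q. a * function_lift L H f q + b * function_lift L H g q)"
    for a b f g
    by (auto simp: function_lift_def on_induced_def algebra_simps)
  show "inj_on (function_lift L H) (smooth_functions X)"
  proof (rule inj_onI)
    fix f g assume f: "f \<in> smooth_functions X" and g: "g \<in> smooth_functions X"
      and eq: "function_lift L H f = function_lift L H g"
    show "f = g"
    proof
      fix x
      show "f x = g x"
      proof (cases "x \<in> points X")
        case True
        obtain q where q: "q \<in> points L1" "proj L q = x"
          using circle_nonempty[OF True] .
        then have "(q, 1) \<in> points Xi" by (simp add: points_Xi)
        from function_lift_apply[OF this, of f] function_lift_apply[OF this, of g]
        show ?thesis using eq q(2) by simp
      next
        case False
        then show ?thesis using f g by (simp add: smooth_functions_def)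
      qed
    qed
  qed
  fix f g assume f: "f \<in> smooth_functions X" and g: "g \<in> smooth_functions X"
  show "function_lift L H (poisson_bracket X \<omega> f g) =
      poisson_bracket Xi \<Omega> (function_lift L H f) (function_lift L H g)"
  proof
    fix z
    show "function_lift L H (poisson_bracket X \<omega> f g) z =
        poisson_bracket Xi \<Omega> (function_lift L H f) (function_lift L H g) z"
    proof (cases "z \<in> points Xi")
      case True
      note l = lift_hamiltonian[OF True f]
      show ?thesis
        using tangent_function_lift[OF True l(1) g]
        by (simp add: function_lift_apply[OF True] poisson_bracket_def l(2,4))
    next
      case False
      then show ?thesis
        using induced_hamiltonian(3)[OF _ _ _ smooth_functionsD[OF function_lift_smooth[OF f]] False]
        by (simp add: function_lift_outside poisson_bracket_def)
    qed
  qed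
qed

text \<open>The function \<open>tilde s\<close> of the paper, on \<open>L\<^sup>1\<close> rather than on the induced manifold.\<close>

definition equivariant :: "('x \<Rightarrow> 'l) \<Rightarrow> 'l \<Rightarrow> complex" where
  "equivariant s q = (THE c. s (proj L q) = fscale L c q)"

lemma equivariant_eqI:
  assumes "q \<in> points L1" "s (proj L q) = fscale L c q"
  shows "equivariant s q = c"
  unfolding equivariant_def using assms fscale_eq_iff[OF assms(1)] by (intro the_equality) auto

lemma section_lift_apply: "z \<in> points Xi \<Longrightarrow> section_lift L H s z = equivariant s (fst z)"
  by (simp add: section_lift_def on_induced_def equivariant_def split_def)

lemma section_lift_outside: "z \<notin> points Xi \<Longrightarrow> section_lift L H s z = 0"
  by (simp add: section_lift_def on_induced_def)

section \<open>Sections as equivariant functions, and prequantization\<close>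

context
  fixes s assumes s: "smooth_section X L (points X) s"
begin

lemma section_map: "smooth_map X (points X) (total L) s"
  and section_proj: "x \<in> points X \<Longrightarrow> proj L (s x) = x"
  using s by (auto simp: smooth_section_def)

text \<open>A unit vector spans its fibre, so the coefficient in the definite description exists;
  \<open>fscale_eq_iff\<close> makes it unique.\<close>

lemma equivariant:
  assumes q: "q \<in> points L1"
  shows "s (proj L q) = fscale L (equivariant s q) q"
proof -
  note x = proj_points[OF q]
  obtain c where c: "s (proj L q) = fscale L c q"
    using fibre_fscale[OF q smooth_map_image[OF section_map x] section_proj[OF x]] by blast
  then show ?thesis using equivariant_eqI[of q s c, OF q c] by simp
qed

text \<open>The vector \<open>s (proj L q)\<close> stays fixed while the basis vector
  \<open>q\<close> is multiplied by \<open>cis \<theta>\<close>, so the coefficient is divided by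
  it.\<close>

lemma equivariant_orbit:
  assumes q: "q \<in> points L1"
  shows "equivariant s (orbit q \<theta>) = cis (- \<theta>) * equivariant s q"
proof (rule equivariant_eqI)
  show "orbit q \<theta> \<in> points L1" by (rule circle_fscale[OF q]) simp
  have "s (proj L (orbit q \<theta>)) = fscale L (equivariant s q) q"
    using equivariant[OF q] by (simp add: proj_fscale[OF q])
  also have "\<dots> = fscale L (cis (- \<theta>) * equivariant s q * cis \<theta>) q"
  proof -
    have "cis (- \<theta>) * equivariant s q * cis \<theta> = equivariant s q * (cis (- \<theta>) * cis \<theta>)"
      by (simp add: ac_simps)
    also have "\<dots> = equivariant s q" by (simp add: cis_mult)
    finally show ?thesis by (simp only:)
  qed
  finally show "s (proj L (orbit q \<theta>)) = fscale L (cis (- \<theta>) * equivariant s q) (orbit q \<theta>)"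
    by (simp add: fscale_fscale[OF q])
qed

text \<open>In a trivialisation it is the quotient of the fibre coordinates of
  \<open>s (proj L q)\<close> and of \<open>q\<close>, the second of which does not vanish on the
  circle bundle.\<close>

lemma equivariant_smooth: "smooth_fun L1 (points L1) (equivariant s)"
proof (rule smooth_fun_local[OF L1])
  fix q assume q: "q \<in> points L1"
  obtain U \<Phi> where U: "proj L q \<in> U" "trivialization X L U \<Phi>"
    using trivialization_exists[OF proj_points[OF q]] .
  let ?W = "points L1 \<inter> proj L -` U" and ?E = "{q \<in> points (total L). proj L q \<in> U}"
  have o: "openin (mtop L1) ?W"
    by (rule smooth_map_openin_vimage[OF L1 X proj_L1 triv_openin[OF U(2)]])
  have incl: "smooth_map L1 ?W (total L) (\<lambda>q. q)"
    by (rule smooth_map_subset[OF circle_inclusion o Int_lower1])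
  have base: "smooth_map L1 ?W X (proj L)"
    by (rule smooth_map_subset[OF proj_L1 o Int_lower1])
  have s_base: "smooth_map L1 ?W (total L) (\<lambda>q. s (proj L q))"
    by (rule smooth_map_compose_total[OF L1 X base section_map]) (use proj_points in auto)
  have f1: "smooth_fun L1 ?W (\<lambda>q. fibre_coordinate U \<Phi> (s (proj L q)))"
    by (rule smooth_fun_compose_total[OF L1 total s_base fibre_coordinate_smooth[OF U(2)]])
      (use smooth_map_image[OF s_base] section_proj proj_points in auto)
  have f2: "smooth_fun L1 ?W (\<lambda>q. fibre_coordinate U \<Phi> q)"
    by (rule smooth_fun_compose_total[OF L1 total incl fibre_coordinate_smooth[OF U(2)]])
      (auto simp: points_L1)
  have *: "fibre_coordinate U \<Phi> p \<noteq> 0 \<and>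
      fibre_coordinate U \<Phi> (s (proj L p)) / fibre_coordinate U \<Phi> p = equivariant s p" if p: "p \<in> ?W" for p
  proof -
    have pL1: "p \<in> points L1" and pU: "proj L p \<in> U" using p by auto
    have p_eq: "\<Phi> (proj L p, fibre_coordinate U \<Phi> p) = p"
      using pL1 pU by (intro triv_expand[OF U(2)]) (simp_all add: points_L1)
    have nz: "fibre_coordinate U \<Phi> p \<noteq> 0"
      using triv_circle[OF U(2) pU, of "fibre_coordinate U \<Phi> p"] pL1 unfolding p_eq by auto
    have "s (proj L p) = \<Phi> (proj L p, equivariant s p * fibre_coordinate U \<Phi> p)"
      using equivariant[OF pL1] triv_fscale[OF U(2) pU, of "equivariant s p" "fibre_coordinate U \<Phi> p"]
      unfolding p_eq by simp
    then show ?thesis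
      using nz by (simp add: triv_coordinate[OF U(2) pU])
  qed
  have "smooth_fun L1 ?W (\<lambda>p. fibre_coordinate U \<Phi> (s (proj L p)) / fibre_coordinate U \<Phi> p)"
    by (rule smooth_fun_divide[OF L1 f1 f2]) (use * in auto)
  also have "?this \<longleftrightarrow> smooth_fun L1 ?W (equivariant s)"
    by (rule smooth_fun_cong[OF L1]) (use * in auto)
  finally show "\<exists>W. q \<in> W \<and> smooth_fun L1 W (equivariant s)"
    using q U(1) by (intro exI[of _ ?W]) simp
qed simp

lemma vertical_equivariant:
  assumes q: "q \<in> points L1"
  shows "vertical q (equivariant s) = - \<i> * equivariant s q"
proof -
  have "((\<lambda>\<theta>. exp (\<theta> *\<^sub>R (- \<i>)) * equivariant s q) has_vector_derivative
      exp (0 *\<^sub>R (- \<i>)) * (- \<i>) * equivariant s q) (at 0)"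
    by (rule has_vector_derivative_mult_left[OF exp_scaleR_has_vector_derivative_right])
  moreover have "exp (\<theta> *\<^sub>R (- \<i>)) = cis (- \<theta>)" for \<theta>
    by (simp add: cis_conv_exp scaleR_conv_of_real mult.commute)
  ultimately have "((\<lambda>\<theta>. equivariant s (orbit q \<theta>)) has_vector_derivative - \<i> * equivariant s q) (at 0)"
    by (simp add: equivariant_orbit[OF q])
  moreover have "smooth_near L1 (orbit q 0) (equivariant s)"
    using smooth_nearI[OF equivariant_smooth q] fscale_one[OF q] by simp
  ultimately show ?thesis
    using vector_derivative_at by (simp add: velocity_def o_def)
qed

text \<open>The lift is constant in the radius, so only the component along the circle bundle acts
  on it.\<close>

lemma tangent_section_lift:
  assumes z: "z \<in> points Xi" and v: "v \<in> complex_tangent_space Xi z"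
  shows "v (section_lift L H s) = push_fibre z v (equivariant s)"
proof -
  have e: "smooth_fun Xi (points Xi) (\<lambda>z. equivariant s (fst z))"
    by (rule smooth_fun_compose_total[OF Xi L1 fst_Xi equivariant_smooth]) (use fst_points in auto)
  then have sm: "smooth_fun Xi (points Xi) (section_lift L H s)"
    using smooth_fun_cong[OF Xi, of "points Xi" "section_lift L H s"] section_lift_apply by simp
  have "v (section_lift L H s) = v (\<lambda>z. equivariant s (fst z))"
    by (rule complex_tangent_cong[OF Xi z v sm z section_lift_apply])
  then show ?thesis
    using smooth_nearI[OF equivariant_smooth fst_points[OF z]] by (simp add: pushforward_apply)
qed

text \<open>On \<open>U\<close> the section is a function times \<open>u\<close>, the function being
  \<open>equivariant s\<close> after \<open>u\<close>, and the connection form gives the derivative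
  of \<open>u\<close>; the Leibniz rule combines them. All terms are multiples of \<open>q\<close>,
  so that \<open>equivariant_eqI\<close> can read off the coefficient.\<close>

lemma prequantization_apply:
  assumes q: "q \<in> points L1" and \<phi>: "\<phi> \<in> smooth_functions X"
    and U: "proj L q \<in> U" "smooth_map X U L1 u" "\<forall>y\<in>U. proj L (u y) = y" "u (proj L q) = q"
  defines "\<xi> \<equiv> hamiltonian_field X \<omega> \<phi> (proj L q)"
  shows "prequantization X \<omega> L D \<phi> s (proj L q) =
    fscale L (\<xi> (\<lambda>y. equivariant s (u y)) + 2 * pi * \<i> * (\<alpha> q (pushforward L1 u (proj L q) \<xi>) + \<phi> (proj L q)) *
      equivariant s q) q"
proof -
  let ?x = "proj L q" and ?f = "\<lambda>y. equivariant s (u y)"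
  note x = proj_points[OF q]
  have oU: "openin (mtop X) U" "U \<subseteq> points X"
    using smooth_map_openin[OF U(2)] openin_subset by auto
  \<comment> \<open>The formula for the derivative of \<open>u\<close> in
    \<open>connection_form\<close> is stated for fields, so the Hamiltonian field is restricted to
    \<open>U\<close>.\<close>
  have field: "vector_field X U (hamiltonian_field X \<omega> \<phi>)"
    by (rule vector_field_subset[OF base_hamiltonian(1)[OF _ _ _ smooth_functionsD[OF \<phi>]] oU])
  have \<xi>: "\<xi> \<in> complex_tangent_space X ?x"
    unfolding \<xi>_def by (rule vector_field_tangent[OF field U(1)])
  have uL1: "u y \<in> points L1" if "y \<in> U" for y
    by (rule smooth_map_image[OF U(2) that])
  have f: "smooth_fun X U ?f"
    by (rule smooth_fun_compose_total[OF X L1 U(2) equivariant_smooth]) (use uL1 in auto)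
  have "smooth_map X U (total L) u"
    by (rule smooth_map_compose_total[OF X L1 U(2) circle_inclusion]) (use uL1 in auto)
  then have su: "smooth_section X L U u"
    using U(3) by (simp add: smooth_section_def)
  have sU: "smooth_section X L U s"
    using smooth_map_subset[OF section_map oU] section_proj oU(2) by (auto simp: smooth_section_def)
  have s_eq: "s y = fscale L (?f y) (u y)" if "y \<in> U" for y
    using equivariant[OF uL1[OF that]] U(3) that by simp
  \<comment> \<open>Locality of the connection compares two smooth sections on a common open set;
    this is the second one.\<close>
  have sfu: "smooth_section X L U (\<lambda>y. fscale L (?f y) (u y))"
  proof -
    have "smooth_map X U (total L) s \<longleftrightarrow> smooth_map X U (total L) (\<lambda>y. fscale L (?f y) (u y))"
      by (rule smooth_map_cong[OF X s_eq])
    then show ?thesis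
      using sU U(3) proj_fscale[OF uL1] by (simp add: smooth_section_def)
  qed
  have "D ?x \<xi> s = D ?x \<xi> (\<lambda>y. fscale L (?f y) (u y))"
    using conn sU sfu U(1) \<xi> s_eq unfolding connection_def by blast
  also have "\<dots> = fadd L (fscale L (\<xi> ?f) (u ?x)) (fscale L (?f ?x) (D ?x \<xi> u))"
    using conn su U(1) \<xi> f unfolding connection_def by blast
  also have "D ?x \<xi> u = fscale L (2 * pi * \<i> * pullback1 L1 u \<alpha> ?x \<xi>) (u ?x)"
    using conn_form U(1-3) field unfolding connection_form_def Let_def \<xi>_def by blast
  finally have D: "D ?x \<xi> s = fscale L (\<xi> ?f + equivariant s q * (2 * pi * \<i> * pullback1 L1 u \<alpha> ?x \<xi>)) q"
    by (simp only: U(4) fscale_fscale[OF q] fadd_fscale[OF q])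
  have "prequantization X \<omega> L D \<phi> s ?x =
      fadd L (D ?x \<xi> s) (fscale L (2 * pi * \<i> * \<phi> ?x) (fscale L (equivariant s q) q))"
    using equivariant[OF q] by (simp add: prequantization_def \<xi>_def)
  also have "\<dots> = fscale L (\<xi> ?f + equivariant s q * (2 * pi * \<i> * pullback1 L1 u \<alpha> ?x \<xi>) +
      2 * pi * \<i> * \<phi> ?x * equivariant s q) q"
    unfolding D fscale_fscale[OF q] fadd_fscale[OF q] by (rule refl)
  finally show ?thesis
    by (simp add: pullback1_def U(4) algebra_simps)
qed

text \<open>On the circle bundle the Hamiltonian vector is the push of \<open>\<xi>\<close> along
  \<open>u\<close> plus \<open>c\<close> times the generator. On the equivariant function, the push
  gives the first-order term of \<open>prequantization_apply\<close> and the generator its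
  zero-order term.\<close>

lemma section_lift_prequantization:
  assumes \<phi>: "\<phi> \<in> smooth_functions X"
  shows "section_lift L H (prequantization X \<omega> L D \<phi> s) =
    poisson_bracket Xi \<Omega> (function_lift L H \<phi>) (section_lift L H s)"
proof
  fix z
  show "section_lift L H (prequantization X \<omega> L D \<phi> s) z =
    poisson_bracket Xi \<Omega> (function_lift L H \<phi>) (section_lift L H s) z"
  proof (cases "z \<in> points Xi")
    case False
    then show ?thesis
      using induced_hamiltonian(3)[OF _ _ _ smooth_functionsD[OF function_lift_smooth[OF \<phi>]] False]
      by (simp add: section_lift_outside poisson_bracket_def)
  next
    case True
    let ?q = "fst z" and ?x = "proj L (fst z)"
    note q = fst_points[OF True] and l = lift_hamiltonian[OF True \<phi>]
    define \<xi> where "\<xi> = hamiltonian_field X \<omega> \<phi> ?x"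
    define v where "v = push_fibre z (hamiltonian_field Xi \<Omega> (function_lift L H \<phi>) z)"
    have v: "v \<in> complex_tangent_space L1 ?q" "push_base ?q v = \<xi>" "\<alpha> ?q v = - \<phi> ?x"
      using push_fibre_tangent[OF True l(1)] l(3,4) by (simp_all add: v_def \<xi>_def)
    have \<xi>: "\<xi> \<in> complex_tangent_space X ?x"
      using push_base_tangent[OF q v(1)] v(2) by simp
    obtain U u where U: "?x \<in> U" "smooth_map X U L1 u" "\<forall>y\<in>U. proj L (u y) = y" "u ?x = ?q"
      and dec: "\<forall>v\<in>complex_tangent_space L1 ?q. \<exists>c. v = (\<lambda>f. pushforward L1 u ?x (push_base ?q v) f +
        c * vertical ?q f)"
      using tangent_decomposition[OF q] .
    let ?h = "pushforward L1 u ?x \<xi>"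
    have h: "?h \<in> complex_tangent_space L1 ?q"
      by (rule section_push_base(1)[OF q U \<xi>])
    obtain c where c: "v = (\<lambda>f. ?h f + c * vertical ?q f)"
      using dec v(1,2) by blast
    have "\<alpha> ?q v = \<alpha> ?q ?h + c * complex_of_real (1 / (2 * pi))"
      unfolding c using complex_linear_on_add[OF \<alpha>_linear[OF q] h complex_tangent_scale[OF L1 q vertical_tangent[OF q]]]
        complex_linear_on_scale[OF \<alpha>_linear[OF q] vertical_tangent[OF q]] \<alpha>_vertical[OF q]
      by simp
    \<comment> \<open>The condition \<open>\<alpha>(v) = - \<phi>\<close> fixes the vertical
      coefficient; the factor \<open>2 * pi\<close> is the inverse of the value of
      \<open>\<alpha>\<close> on the generator.\<close>
    then have c_eq: "c = - (2 * pi * (\<alpha> ?q ?h + \<phi> ?x))"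
      using v(3) by (simp add: field_simps)
    have "smooth_near L1 (u ?x) (equivariant s)"
      using smooth_nearI[OF equivariant_smooth q] U(4) by simp
    then have "?h (equivariant s) = \<xi> (\<lambda>y. equivariant s (u y))"
      by (rule pushforward_apply)
    \<comment> \<open>The generator multiplies the function by \<open>-\<i>\<close>; this minus sign
      cancels the one in \<open>c\<close>.\<close>
    then have "v (equivariant s) = \<xi> (\<lambda>y. equivariant s (u y)) +
        2 * pi * \<i> * (\<alpha> ?q ?h + \<phi> ?x) * equivariant s ?q"
      unfolding c using vertical_equivariant[OF q] by (simp add: c_eq)
    moreover have "poisson_bracket Xi \<Omega> (function_lift L H \<phi>) (section_lift L H s) z = v (equivariant s)"
      unfolding poisson_bracket_def v_def by (rule tangent_section_lift[OF True l(1)])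
    moreover have "section_lift L H (prequantization X \<omega> L D \<phi> s) z = \<xi> (\<lambda>y. equivariant s (u y)) +
        2 * pi * \<i> * (\<alpha> ?q ?h + \<phi> ?x) * equivariant s ?q"
      unfolding section_lift_apply[OF True] \<xi>_def
      by (rule equivariant_eqI[OF q]) (rule prequantization_apply[OF q \<phi> U])
    ultimately show ?thesis by simp
  qed
qed

end

end

theorem theorem0p1:
  fixes X :: "('x, 'e::euclidean_space) manifold" and \<omega> :: "'x form2"
    and L :: "('l, 'x, 'e) line_bundle" and D :: "('l, 'x) covariant_derivative"
    and H :: "'l \<Rightarrow> 'l \<Rightarrow> complex" and \<alpha> :: "'l form1"
  assumes "symplectic_manifold X \<omega>" and "connected_space (mtop X)" and "integral_form X \<omega>"
    and "complex_line_bundle X L" and "connection X L D"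
    and "hermitian_structure X L H" and "parallel_invariant X L D H"
    and "connection_form X L D H \<alpha>" and "has_curvature X L H \<alpha> \<omega>"
  shows "poisson_monomorphism X \<omega> (induced_manifold L H) (induced_form X \<omega> L H \<alpha>) (function_lift L H) \<and>
    (\<forall>s \<phi>. smooth_section X L (points X) s \<and> \<phi> \<in> smooth_functions X \<longrightarrow>
      section_lift L H (prequantization X \<omega> L D \<phi> s) =
      poisson_bracket (induced_manifold L H) (induced_form X \<omega> L H \<alpha>)
        (function_lift L H \<phi>) (section_lift L H s))"
proof -
  interpret prequantum_bundle X L H \<omega> D \<alpha>
    using assms by unfold_locales (auto simp: symplectic_manifold_def)
  show ?thesis
    using poisson_monomorphism_lift section_lift_prequantization by blast
qed

end
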